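(* Let $(V,\Delta,V^*,\Delta^\vee)$ be a Kac-Moody root system with Weyl group $W$, let $r$ be the radius of convergence of the Poincaré series $W(t)=\sum_{w\in W}t^{\ell(w)}$, and let $D_r=\{t\in\mathbb{C}:|t|<r\}$. Let $\Omega=V+iI^\circ\subseteq V\otimes\mathbb{C}$, where $I^\circ$ is the interior of the Tits cone. Let $\mathcal{C}(t,h)$ be the holomorphic function on $D_r\times(V+iW\cdot C)$ given by the (absolutely and locally uniformly convergent) sum $$\mathcal{C}(t,h)=\sum_{w\in W}\prod_{a\in\Phi_{re,+}}\frac{1-te^{2\pi i\langle h,wa^\vee\rangle}}{1-e^{2\pi i\langle h,wa^\vee\rangle}}.$$ Then $\mathcal{C}(t,h)$ can be analytically continued to a holomorphic function on $D_r\times\Omega$.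
   Context: A Kac-Moody root system is a quadruple $(V,\Delta,V^*,\Delta^\vee)$ where $V$ is a finite-dimensional real vector space with linear dual $V^*$, $\Delta\subset V$ is a finite linearly independent subset (the simple roots), and $\Delta^\vee\subset V^*$ is a finite linearly independent subset with a bijection $\Delta\to\Delta^\vee$, $a\mapsto a^\vee$, such that, with $\langle-,-\rangle$ the natural pairing between $V$ and $V^*$: $\langle a,a^\vee\rangle=2$ for $a\in\Delta$; $\langle a,b^\vee\rangle$ is a non-positive integer for $a\neq b$ in $\Delta$; and $\langle a,b^\vee\rangle=0$ implies $\langle b,a^\vee\rangle=0$. For $a\in\Delta$ let $s_a(v)=v-\langle v,a^\vee\rangle a$. The Weyl group $W\subseteq\mathrm{Aut}(V)$ is generated by the $s_a$, $a\in\Delta$, with $\ell$ the length function for these generators; $W$ acts on $V^*$ by $\langle v,wl\rangle=\langle w^{-1}v,l\rangle$. A real root is an element of $V$ that is $W$-conjugate to a simple root; $\Phi_{re}$ is the set of real roots and $\Phi_{re,+}$ is the set of real roots that are $\mathbb{Z}_{\geq0}$-linear combinations of simple roots. For a real root $a=wa_0$ with $a_0\in\Delta$, its coroot is $a^\vee=wa_0^\vee$ (well defined). $C=\{x\in V:\langle x,a^\vee\rangle>0\ \forall a\in\Delta\}$, $\overline{C}$ is its closure, $W\cdot C=\bigcup_{w\in W}wC$. The Tits cone is $I=\bigcup_{w\in W}w\overline{C}$, and $I^\circ$ is its interior in $V$. For $A,B\subseteq V$, $A+iB=\{x+iy\in V\otimes\mathbb{C}:x\in A,\ y\in B\}$.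 The pairing is extended $\mathbb{C}$-linearly to $V\otimes\mathbb{C}$. *)

theory Defs
  imports "HOL-Analysis.Analysis"
begin

text \<open>
  The finite-dimensional real vector space \<open>V\<close> is a type \<open>'v\<close>. Both sorts \<open>banach\<close> and
  \<open>heine_borel\<close> hold for every norm on a finite-dimensional space (including the zero space), and
  the topology does not depend on the norm. The dual \<open>V\<^sup>*\<close> is \<open>'v \<Rightarrow>\<^sub>L real\<close>: in finite dimension
  every linear form is bounded. The bijection \<open>a \<mapsto> a\<^sup>\<or>\<close> on simple roots is \<open>co\<close>, and the set of
  simple coroots is \<open>co ` \<Delta>\<close>; values of \<open>co\<close> outside \<open>\<Delta>\<close> are irrelevant.
\<close>

locale kac_moody_root_system =
  fixes \<Delta> :: "'v::{banach,heine_borel} set"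
    and co :: "'v \<Rightarrow> ('v \<Rightarrow>\<^sub>L real)"
  assumes finite_dimensional: "\<exists>B::'v set. finite B \<and> span B = UNIV"
    and finite_simple: "finite \<Delta>"
    and independent_simple: "independent \<Delta>"
    and inj_co: "inj_on co \<Delta>"
    and independent_co: "independent (co ` \<Delta>)"
    and pairing_diag: "a \<in> \<Delta> \<Longrightarrow> blinfun_apply (co a) a = 2"
    and pairing_off_diag:
      "a \<in> \<Delta> \<Longrightarrow> b \<in> \<Delta> \<Longrightarrow> a \<noteq> b \<Longrightarrow>
        blinfun_apply (co b) a \<in> \<int> \<and> blinfun_apply (co b) a \<le> 0"
    and pairing_zero:
      "a \<in> \<Delta> \<Longrightarrow> b \<in> \<Delta> \<Longrightarrow> blinfun_apply (co b) a = 0 \<Longrightarrow> blinfun_apply (co a) b = 0"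

definition simple_reflection :: "('v::real_normed_vector \<Rightarrow> ('v \<Rightarrow>\<^sub>L real)) \<Rightarrow> 'v \<Rightarrow> 'v \<Rightarrow> 'v" where
  "simple_reflection co a v = v - blinfun_apply (co a) v *\<^sub>R a"

inductive_set weyl_group :: "'v::real_normed_vector set \<Rightarrow> ('v \<Rightarrow> ('v \<Rightarrow>\<^sub>L real)) \<Rightarrow> ('v \<Rightarrow> 'v) set"
  for \<Delta> co where
    weyl_id: "id \<in> weyl_group \<Delta> co"
  | weyl_gen: "a \<in> \<Delta> \<Longrightarrow> simple_reflection co a \<in> weyl_group \<Delta> co"
  | weyl_comp: "u \<in> weyl_group \<Delta> co \<Longrightarrow> w \<in> weyl_group \<Delta> co \<Longrightarrow> u \<circ> w \<in> weyl_group \<Delta> co"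
  | weyl_inv: "w \<in> weyl_group \<Delta> co \<Longrightarrow> inv w \<in> weyl_group \<Delta> co"

text \<open>The generators are involutions, so inverses of generators are not needed in words.\<close>

definition weyl_length ::
  "'v::real_normed_vector set \<Rightarrow> ('v \<Rightarrow> ('v \<Rightarrow>\<^sub>L real)) \<Rightarrow> ('v \<Rightarrow> 'v) \<Rightarrow> nat" where
  "weyl_length \<Delta> co w =
    (LEAST n. \<exists>as. length as = n \<and> set as \<subseteq> \<Delta> \<and> w = foldr (\<lambda>a u. simple_reflection co a \<circ> u) as id)"

text \<open>
  The power series \<open>\<Sum>\<^sub>w t\<^bsup>\<ell>(w)\<^esup>\<close> collected by degree. The coefficients are true
  cardinalities: only finitely many \<open>w\<close> have a given length, because \<open>\<Delta>\<close> is finite.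
\<close>

definition poincare_radius ::
  "'v::real_normed_vector set \<Rightarrow> ('v \<Rightarrow> ('v \<Rightarrow>\<^sub>L real)) \<Rightarrow> ereal" where
  "poincare_radius \<Delta> co =
    conv_radius (\<lambda>n. complex_of_nat (card {w \<in> weyl_group \<Delta> co. weyl_length \<Delta> co w = n}))"

definition real_roots :: "'v::real_normed_vector set \<Rightarrow> ('v \<Rightarrow> ('v \<Rightarrow>\<^sub>L real)) \<Rightarrow> 'v set" where
  "real_roots \<Delta> co = {w a | w a. w \<in> weyl_group \<Delta> co \<and> a \<in> \<Delta>}"

definition pos_real_roots :: "'v::real_normed_vector set \<Rightarrow> ('v \<Rightarrow> ('v \<Rightarrow>\<^sub>L real)) \<Rightarrow> 'v set" where
  "pos_real_roots \<Delta> co =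
    {a \<in> real_roots \<Delta> co. \<exists>c :: 'v \<Rightarrow> nat. a = (\<Sum>b\<in>\<Delta>. real (c b) *\<^sub>R b)}"

definition dual_action ::
  "('v::real_normed_vector \<Rightarrow> 'v) \<Rightarrow> ('v \<Rightarrow>\<^sub>L real) \<Rightarrow> ('v \<Rightarrow>\<^sub>L real)" where
  "dual_action w l = Blinfun (\<lambda>v. blinfun_apply l (inv w v))"

definition coroot ::
  "'v::real_normed_vector set \<Rightarrow> ('v \<Rightarrow> ('v \<Rightarrow>\<^sub>L real)) \<Rightarrow> 'v \<Rightarrow> ('v \<Rightarrow>\<^sub>L real)" where
  "coroot \<Delta> co a =
    (THE l. \<exists>w\<in>weyl_group \<Delta> co. \<exists>b\<in>\<Delta>. a = w b \<and> l = dual_action w (co b))"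

definition chamber :: "'v::real_normed_vector set \<Rightarrow> ('v \<Rightarrow> ('v \<Rightarrow>\<^sub>L real)) \<Rightarrow> 'v set" where
  "chamber \<Delta> co = {x. \<forall>a\<in>\<Delta>. blinfun_apply (co a) x > 0}"

definition weyl_chambers :: "'v::real_normed_vector set \<Rightarrow> ('v \<Rightarrow> ('v \<Rightarrow>\<^sub>L real)) \<Rightarrow> 'v set" where
  "weyl_chambers \<Delta> co = (\<Union>w\<in>weyl_group \<Delta> co. w ` chamber \<Delta> co)"

definition tits_cone :: "'v::real_normed_vector set \<Rightarrow> ('v \<Rightarrow> ('v \<Rightarrow>\<^sub>L real)) \<Rightarrow> 'v set" where
  "tits_cone \<Delta> co = (\<Union>w\<in>weyl_group \<Delta> co. w ` closure (chamber \<Delta> co))"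

text \<open>
  The complexification of \<open>V\<close> is \<open>'v \<times> 'v\<close>, the pair \<open>(x, y)\<close> standing for \<open>x + iy\<close>.
  In particular \<open>A + iB\<close> is \<open>A \<times> B\<close>.
\<close>

definition cscale :: "complex \<Rightarrow> 'v::real_vector \<times> 'v \<Rightarrow> 'v \<times> 'v" where
  "cscale c h = (Re c *\<^sub>R fst h - Im c *\<^sub>R snd h, Re c *\<^sub>R snd h + Im c *\<^sub>R fst h)"

definition cpairing :: "'v::real_normed_vector \<times> 'v \<Rightarrow> ('v \<Rightarrow>\<^sub>L real) \<Rightarrow> complex" where
  "cpairing h l = Complex (blinfun_apply l (fst h)) (blinfun_apply l (snd h))"

text \<open>
  Holomorphy on an open subset of \<open>\<complex> \<times> (V \<otimes> \<complex>)\<close>: the (real) Frechet derivative exists at every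
  point and is complex linear.
\<close>

definition holomorphic_several_on ::
  "(complex \<times> ('v::real_normed_vector \<times> 'v) \<Rightarrow> complex) \<Rightarrow> (complex \<times> ('v \<times> 'v)) set \<Rightarrow> bool"
  where
  "holomorphic_several_on f S \<longleftrightarrow>
    (\<forall>p\<in>S. \<exists>L. (f has_derivative L) (at p) \<and>
      (\<forall>c s v. L (c * s, cscale c v) = c * L (s, v)))"

text \<open>Unordered product over an arbitrary index set, the multiplicative counterpart of \<open>infsum\<close>.\<close>

definition infprod :: "('i \<Rightarrow> complex) \<Rightarrow> 'i set \<Rightarrow> complex" where
  "infprod f A = Lim (finite_subsets_at_top A) (prod f)"

definition exp_coroot ::
  "'v::real_normed_vector set \<Rightarrow> ('v \<Rightarrow> ('v \<Rightarrow>\<^sub>L real)) \<Rightarrow> ('v \<Rightarrow> 'v) \<Rightarrow> 'v \<Rightarrow> 'v \<times> 'v \<Rightarrow> complex" where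
  "exp_coroot \<Delta> co w a h =
    exp (2 * complex_of_real pi * \<i> * cpairing h (dual_action w (coroot \<Delta> co a)))"

definition C_factor ::
  "'v::real_normed_vector set \<Rightarrow> ('v \<Rightarrow> ('v \<Rightarrow>\<^sub>L real)) \<Rightarrow> ('v \<Rightarrow> 'v) \<Rightarrow> 'v \<Rightarrow>
    complex \<times> ('v \<times> 'v) \<Rightarrow> complex" where
  "C_factor \<Delta> co w a = (\<lambda>(t, h). (1 - t * exp_coroot \<Delta> co w a h) / (1 - exp_coroot \<Delta> co w a h))"

definition C_term ::
  "'v::real_normed_vector set \<Rightarrow> ('v \<Rightarrow> ('v \<Rightarrow>\<^sub>L real)) \<Rightarrow> ('v \<Rightarrow> 'v) \<Rightarrow>
    complex \<times> ('v \<times> 'v) \<Rightarrow> complex" where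
  "C_term \<Delta> co w p = infprod (\<lambda>a. C_factor \<Delta> co w a p) (pos_real_roots \<Delta> co)"

definition C_sum ::
  "'v::real_normed_vector set \<Rightarrow> ('v \<Rightarrow> ('v \<Rightarrow>\<^sub>L real)) \<Rightarrow> complex \<times> ('v \<times> 'v) \<Rightarrow> complex" where
  "C_sum \<Delta> co p = (\<Sum>\<^sub>\<infinity>w\<in>weyl_group \<Delta> co. C_term \<Delta> co w p)"

text \<open>
  The sum defining \<open>C_sum\<close> makes sense on \<open>S\<close>: no denominator vanishes, every product converges
  absolutely, and the sum over the Weyl group converges absolutely and locally uniformly.
\<close>

definition C_sum_converges_on ::
  "'v::real_normed_vector set \<Rightarrow> ('v \<Rightarrow> ('v \<Rightarrow>\<^sub>L real)) \<Rightarrow> (complex \<times> ('v \<times> 'v)) set \<Rightarrow> bool" where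
  "C_sum_converges_on \<Delta> co S \<longleftrightarrow>
    (\<forall>p\<in>S. \<forall>w\<in>weyl_group \<Delta> co.
      (\<forall>a\<in>pos_real_roots \<Delta> co. exp_coroot \<Delta> co w a (snd p) \<noteq> 1) \<and>
      (\<lambda>a. norm (C_factor \<Delta> co w a p - 1)) summable_on pos_real_roots \<Delta> co) \<and>
    (\<forall>p\<in>S. (\<lambda>w. norm (C_term \<Delta> co w p)) summable_on weyl_group \<Delta> co) \<and>
    (\<forall>p\<in>S. \<exists>U. open U \<and> p \<in> U \<and>
      uniform_limit (U \<inter> S) (\<lambda>F q. \<Sum>w\<in>F. C_term \<Delta> co w q) (C_sum \<Delta> co)
        (finite_subsets_at_top (weyl_group \<Delta> co)))"

end

theory Submission
  imports Defs "HOL-Complex_Analysis.Complex_Analysis"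
begin

text \<open>
  Near a point whose imaginary part is \<open>y\<^sub>0 = y\<^sub>1 + 2 c\<close> with \<open>c\<close> in the chamber and \<open>y\<^sub>1\<close> in the Tits cone, only
  finitely many positive coroots are negative on \<open>y\<^sub>1\<close>, and the exponentials of all the others decay
  geometrically with the height. Multiplying the sum by the finitely many remaining denominators
  therefore makes it converge, since the summand of \<open>w\<close> has size \<open>O(\<rho>\<^bsup>\<ell>(w)\<^esup>)\<close>: the number of positive coroots
  made negative by \<open>w\<^sup>-\<^sup>1\<close> is \<open>\<ell>(w)\<close>. So the sum has at most simple poles along finitely many affine
  hyperplanes. It is invariant under the affine reflections in these hyperplanes, so the numerator
  vanishes at the generic points of each of them, hence on all of them by density, and the
  denominators can be divided out one at a time. The local extensions agree because \<open>W \<cdot> C\<close> is dense in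
  the Tits cone.

  The Coxeter theory needed here is Tits' dichotomy (a real root is positive or negative, decided by
  the length function, and hence simultaneously for roots and coroots), proved by reduction to rank two.
\<close>

section \<open>Holomorphic functions of several variables\<close>

text \<open>The growth estimate rests on one rewriting. If \<open>w a\<close> is negative and
  \<open>b = - w a\<close>, the factor equals \<open>(t - e) / (1 - e)\<close> with
  \<open>e = E b\<close>, which is close to \<open>t\<close> where \<open>e\<close> is small. Each
  inverted root thus contributes about one power of \<open>t\<close>, and a radius \<rho> strictly
  between |t| and the radius of convergence absorbs the errors uniformly. In \<open>y1 + 2 c\<close>
  one copy of \<open>c\<close> provides the decay, the other leaves room for an open neighbourhood.
  Coroots are given by a description, so first it must be known that equal roots have equal coroots.
  Roots and coroots are therefore treated as two representations of the same words with one length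
  function: a relation between reflections found on either side holds in the Weyl group and can be
  read on the other side. A zero of the numerator can be propagated from generic points of a divisor
  only if the other divisors do not contain it. This is where coroots of distinct positive roots
  must be shown non-proportional.\<close>

definition cmul :: "complex \<Rightarrow> complex \<times> ('v::real_vector \<times> 'v) \<Rightarrow> complex \<times> ('v \<times> 'v)" where
  "cmul c u = (c * fst u, cscale c (snd u))"

text \<open>The pair \<open>(- snd h, fst h)\<close> is \<open>i h\<close>, so
  \<open>cscale c h\<close> is \<open>Re c\<close> times \<open>h\<close> plus \<open>Im c\<close>
  times \<open>i h\<close>.\<close>

lemma norm_swap_neg: "norm (- snd h, fst h) = norm (h :: 'v::real_normed_vector \<times> 'v)"
  by (cases h) (simp add: norm_Pair add.commute)

text \<open>The norm on pairs comes from an arbitrary norm of the real space and need not be complex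
  homogeneous; bounding \<open>Re c\<close> and \<open>Im c\<close> separately costs the factor
  2.\<close>

lemma norm_cscale_le: "norm (cscale c h) \<le> 2 * norm c * norm (h :: 'v::real_normed_vector \<times> 'v)"
proof -
  have "cscale c h = Re c *\<^sub>R h + Im c *\<^sub>R (- snd h, fst h)"
    by (cases h) (simp add: cscale_def)
  then have "norm (cscale c h) \<le> \<bar>Re c\<bar> * norm h + \<bar>Im c\<bar> * norm h"
    by (metis norm_triangle_ineq norm_scaleR norm_swap_neg)
  also have "\<dots> \<le> norm c * norm h + norm c * norm h"
    by (intro add_mono mult_right_mono abs_Re_le_cmod abs_Im_le_cmod) auto
  finally show ?thesis by simp
qed

lemma norm_cmul_le: "norm (cmul c u) \<le> 2 * norm c * norm (u :: complex \<times> ('v::real_normed_vector \<times> 'v))"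
proof -
  obtain s h where u: "u = (s, h)" by (cases u)
  have "norm (cmul c u) ^ 2 = (norm c * norm s)^2 + norm (cscale c h)^2"
    by (simp add: cmul_def u norm_Pair norm_mult)
  also have "\<dots> \<le> (2 * norm c * norm s)^2 + (2 * norm c * norm h)^2"
    by (intro add_mono power_mono norm_cscale_le) (auto simp: mult_right_mono)
  also have "\<dots> = (2 * norm c * norm u)^2"
    by (simp add: u norm_Pair power_mult_distrib algebra_simps)
  finally show ?thesis
    by (rule power2_le_imp_le) auto
qed

lemma bounded_bilinear_cmul:
  "bounded_bilinear (cmul :: complex \<Rightarrow> complex \<times> ('v::real_normed_vector \<times> 'v) \<Rightarrow> _)"
proof
  show "\<exists>K. \<forall>a b. norm (cmul a (b :: complex \<times> ('v \<times> 'v))) \<le> norm a * norm b * K"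
    using norm_cmul_le by (intro exI[of _ 2]) (auto simp: algebra_simps)
qed (auto simp: cmul_def cscale_def algebra_simps scaleR_add_left)

lemmas bounded_linear_cmul_left = bounded_bilinear.bounded_linear_left[OF bounded_bilinear_cmul]

lemma cmul_zero [simp]: "cmul 0 u = 0"
  by (simp add: cmul_def cscale_def zero_prod_def)

lemma holomorphic_several_on_iff:
  "holomorphic_several_on f S \<longleftrightarrow>
    (\<forall>p\<in>S. \<exists>L. (f has_derivative L) (at p) \<and> (\<forall>c u. L (cmul c u) = c * L u))"
  unfolding holomorphic_several_on_def cmul_def by fastforce

lemma holo_subset: "holomorphic_several_on f S \<Longrightarrow> T \<subseteq> S \<Longrightarrow> holomorphic_several_on f T"
  unfolding holomorphic_several_on_def by blast

lemma holo_pointwise: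
  "(\<And>p. p \<in> S \<Longrightarrow> \<exists>T. p \<in> T \<and> holomorphic_several_on f T) \<Longrightarrow> holomorphic_several_on f S"
  unfolding holomorphic_several_on_def by blast

lemma holo_cong_open:
  assumes "holomorphic_several_on f S" "open S" "\<And>p. p \<in> S \<Longrightarrow> f p = g p"
  shows "holomorphic_several_on g S"
  unfolding holomorphic_several_on_def
proof
  fix p assume p: "p \<in> S"
  then obtain L where L: "(f has_derivative L) (at p)" "\<forall>c s v. L (c * s, cscale c v) = c * L (s, v)"
    using assms(1) unfolding holomorphic_several_on_def by blast
  from has_derivative_transform_within_open[OF L(1) assms(2) p assms(3)] L(2)
  show "\<exists>L. (g has_derivative L) (at p) \<and> (\<forall>c s v. L (c * s, cscale c v) = c * L (s, v))" by blast
qed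

lemma holo_const: "holomorphic_several_on (\<lambda>p. c) S"
  unfolding holomorphic_several_on_iff by (intro ballI exI[of _ "\<lambda>_. 0"]) auto

lemma holo_fst: "holomorphic_several_on fst S"
  unfolding holomorphic_several_on_iff by (intro ballI exI[of _ fst]) (auto simp: cmul_def has_derivative_fst)

lemma cpairing_alt: "cpairing h l = of_real (blinfun_apply l (fst h)) + \<i> * of_real (blinfun_apply l (snd h))"
  by (simp add: cpairing_def complex_eq_iff)

lemma bounded_linear_cpairing: "bounded_linear (\<lambda>h. cpairing h l)"
  unfolding cpairing_alt
  by (intro bounded_linear_add bounded_linear_mult_right[THEN bounded_linear_compose]
      bounded_linear_of_real[THEN bounded_linear_compose] blinfun.bounded_linear_right[THEN bounded_linear_compose]
      bounded_linear_fst bounded_linear_snd)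

lemma cpairing_cscale: "cpairing (cscale c h) l = c * cpairing h l"
  by (simp add: cpairing_def cscale_def complex_eq_iff blinfun.bilinear_simps)

lemma holo_cpairing: "holomorphic_several_on (\<lambda>p. cpairing (snd p) l) S"
  unfolding holomorphic_several_on_iff
  by (intro ballI exI[of _ "\<lambda>p. cpairing (snd p) l"])
    (auto simp: cmul_def cpairing_cscale intro!: bounded_linear.has_derivative[OF bounded_linear_cpairing] derivative_eq_intros)

lemma holo_add:
  assumes "holomorphic_several_on f S" "holomorphic_several_on g S"
  shows "holomorphic_several_on (\<lambda>p. f p + g p) S"
  unfolding holomorphic_several_on_iff
proof
  fix p assume "p \<in> S"
  then obtain L M where "(f has_derivative L) (at p)" "\<And>c u. L (cmul c u) = c * L u"
    "(g has_derivative M) (at p)" "\<And>c u. M (cmul c u) = c * M u"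
    using assms unfolding holomorphic_several_on_iff by metis
  then show "\<exists>L. ((\<lambda>p. f p + g p) has_derivative L) (at p) \<and> (\<forall>c u. L (cmul c u) = c * L u)"
    by (intro exI[of _ "\<lambda>u. L u + M u"]) (auto intro!: derivative_intros simp: algebra_simps)
qed

lemma holo_mult:
  assumes "holomorphic_several_on f S" "holomorphic_several_on g S"
  shows "holomorphic_several_on (\<lambda>p. f p * g p) S"
  unfolding holomorphic_several_on_iff
proof
  fix p assume "p \<in> S"
  then obtain L M where "(f has_derivative L) (at p)" "\<And>c u. L (cmul c u) = c * L u"
    "(g has_derivative M) (at p)" "\<And>c u. M (cmul c u) = c * M u"
    using assms unfolding holomorphic_several_on_iff by metis
  then show "\<exists>L. ((\<lambda>p. f p * g p) has_derivative L) (at p) \<and> (\<forall>c u. L (cmul c u) = c * L u)"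
    by (intro exI[of _ "\<lambda>u. f p * M u + L u * g p"] conjI has_derivative_mult) (simp_all add: algebra_simps)
qed

lemma holo_compose:
  assumes "holomorphic_several_on f S" "\<And>p. p \<in> S \<Longrightarrow> g field_differentiable at (f p)"
  shows "holomorphic_several_on (\<lambda>p. g (f p)) S"
  unfolding holomorphic_several_on_iff
proof
  fix p assume "p \<in> S"
  then obtain L D where L: "(f has_derivative L) (at p)" "\<And>c u. L (cmul c u) = c * L u"
    and D: "(g has_field_derivative D) (at (f p))"
    using assms unfolding holomorphic_several_on_iff field_differentiable_def by metis
  have "((\<lambda>p. g (f p)) has_derivative (\<lambda>u. D * L u)) (at p)"
    using has_derivative_compose[OF L(1) D[unfolded has_field_derivative_def]] by simp
  with L(2) show "\<exists>L. ((\<lambda>p. g (f p)) has_derivative L) (at p) \<and> (\<forall>c u. L (cmul c u) = c * L u)"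
    by (intro exI[of _ "\<lambda>u. D * L u"]) auto
qed

lemma holo_exp: "holomorphic_several_on f S \<Longrightarrow> holomorphic_several_on (\<lambda>p. exp (f p)) S"
  by (rule holo_compose) (auto intro: field_differentiable_within_exp)

lemma holo_divide:
  assumes "holomorphic_several_on f S" "holomorphic_several_on g S" "\<And>p. p \<in> S \<Longrightarrow> g p \<noteq> 0"
  shows "holomorphic_several_on (\<lambda>p. f p / g p) S"
proof -
  have "holomorphic_several_on (\<lambda>p. inverse (g p)) S"
    by (rule holo_compose[OF assms(2)]) (rule field_differentiable_inverse[OF field_differentiable_ident], rule assms(3))
  from holo_mult[OF assms(1) this] show ?thesis by (simp add: divide_inverse)
qed

lemma holo_diff:
  assumes "holomorphic_several_on f S" "holomorphic_several_on g S"
  shows "holomorphic_several_on (\<lambda>p. f p - g p) S"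
  using holo_add[OF assms(1) holo_mult[OF holo_const[of "-1"] assms(2)]] by simp

lemma holo_sum: "(\<And>i. i \<in> A \<Longrightarrow> holomorphic_several_on (f i) S) \<Longrightarrow> holomorphic_several_on (\<lambda>p. \<Sum>i\<in>A. f i p) S"
  by (induction A rule: infinite_finite_induct) (auto intro: holo_const holo_add)

lemma holo_prod: "(\<And>i. i \<in> A \<Longrightarrow> holomorphic_several_on (f i) S) \<Longrightarrow> holomorphic_several_on (\<lambda>p. \<Prod>i\<in>A. f i p) S"
  by (induction A rule: infinite_finite_induct) (auto intro: holo_const holo_mult)

lemma holo_isCont: "holomorphic_several_on f S \<Longrightarrow> p \<in> S \<Longrightarrow> isCont f p"
  unfolding holomorphic_several_on_def by (meson has_derivative_continuous)

lemma holo_continuous_on: "holomorphic_several_on f S \<Longrightarrow> continuous_on S f"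
  by (meson continuous_at_imp_continuous_on holo_isCont)

section \<open>Complex lines, Cauchy estimates and uniform limits\<close>

lemma holo_line_derivative:
  assumes "(f has_derivative L) (at (p + cmul z u))" "\<And>c u. L (cmul c u) = c * L u"
  shows "((\<lambda>z. f (p + cmul z u)) has_field_derivative L u) (at z)"
proof -
  have "((\<lambda>z. p + cmul z u) has_derivative (\<lambda>z. cmul z u)) (at z)"
    by (auto intro!: derivative_eq_intros bounded_linear.has_derivative[OF bounded_linear_cmul_left])
  from has_derivative_compose[OF this assms(1)] show ?thesis
    by (simp add: has_field_derivative_def assms(2) mult_commute_abs)
qed

lemma holo_line_holomorphic:
  assumes "holomorphic_several_on f S" "\<And>z. z \<in> T \<Longrightarrow> p + cmul z u \<in> S"
  shows "(\<lambda>z. f (p + cmul z u)) holomorphic_on T"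
proof (rule holomorphic_onI)
  fix z assume "z \<in> T"
  with assms obtain L where "(f has_derivative L) (at (p + cmul z u))" "\<And>c u. L (cmul c u) = c * L u"
    unfolding holomorphic_several_on_iff by metis
  from holo_line_derivative[OF this] show "(\<lambda>z. f (p + cmul z u)) field_differentiable at z within T"
    by (meson field_differentiable_at_within field_differentiable_def)
qed

text \<open>The derivative in direction \<open>u\<close> is that of a one-variable function on the
  complex line through \<open>q\<close>, so the one-variable Cauchy inequality applies.\<close>

lemma holo_Cauchy_estimate:
  assumes f: "holomorphic_several_on f (ball q R)" and "R > 0"
    and bd: "\<And>x. x \<in> ball q R \<Longrightarrow> norm (f x) \<le> M"
    and L: "(f has_derivative L) (at q)" "\<And>c u. L (cmul c u) = c * L u"
  shows "norm (L u) \<le> 3 * M / R * norm u"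
proof (cases "u = 0")
  case True
  then have "L u = 0" using L(2)[of 0 0] by simp
  with True show ?thesis by simp
next
  case False
  \<comment> \<open>\<open>norm_cmul_le\<close> loses a factor 2; dividing by 3 keeps the closed
    disc inside the open ball.\<close>
  define \<rho> where "\<rho> = R / (3 * norm u)"
  have \<rho>: "\<rho> > 0" using False \<open>R > 0\<close> by (simp add: \<rho>_def)
  have sub: "q + cmul z u \<in> ball q R" if "z \<in> cball 0 \<rho>" for z
  proof -
    have "norm (cmul z u) \<le> 2 * norm z * norm u" by (rule norm_cmul_le)
    also have "\<dots> \<le> 2 * \<rho> * norm u" using that by (intro mult_right_mono) auto
    also have "\<dots> < R" using False \<open>R > 0\<close> by (simp add: \<rho>_def field_simps)
    finally show ?thesis by (simp add: dist_norm)
  qed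
  have hol: "(\<lambda>z. f (q + cmul z u)) holomorphic_on cball 0 \<rho>"
    by (rule holo_line_holomorphic[OF f sub])
  have "norm ((deriv ^^ 1) (\<lambda>z. f (q + cmul z u)) 0) \<le> fact 1 * M / \<rho> ^ 1"
  proof (rule Cauchy_inequality)
    show "(\<lambda>z. f (q + cmul z u)) holomorphic_on ball 0 \<rho>"
      using hol by (rule holomorphic_on_subset) auto
    show "continuous_on (cball 0 \<rho>) (\<lambda>z. f (q + cmul z u))"
      using hol by (rule holomorphic_on_imp_continuous_on)
    show "norm (f (q + cmul x u)) \<le> M" if "norm (0 - x) = \<rho>" for x
      using that by (intro bd sub) auto
  qed (use \<rho> in auto)
  moreover have "deriv (\<lambda>z. f (q + cmul z u)) 0 = L u"
    by (rule DERIV_imp_deriv, rule holo_line_derivative) (use L in auto)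
  ultimately show ?thesis
    using False \<open>R > 0\<close> by (simp add: \<rho>_def field_simps)
qed

text \<open>Choose approximants with error 1/(n+1). By the Cauchy estimate on balls of radius R/2
  their derivatives are uniformly Cauchy on the half ball, so the limit is differentiable, and
  complex linearity passes to the limit of the derivatives.\<close>

lemma holo_approx_ball:
  fixes g :: "complex \<times> ('v::real_normed_vector \<times> 'v) \<Rightarrow> complex"
  assumes "R > 0"
    and appr: "\<And>e. e > 0 \<Longrightarrow> \<exists>f. holomorphic_several_on f (ball p R) \<and> (\<forall>q\<in>ball p R. norm (f q - g q) \<le> e)"
  shows "holomorphic_several_on g (ball p (R/2))"
proof -
  define B where "B = ball p (R/2)"
  have "\<exists>f. \<forall>n::nat. holomorphic_several_on (f n) (ball p R) \<and> (\<forall>q\<in>ball p R. norm (f n q - g q) \<le> inverse (real (Suc n)))"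
    using appr by (intro choice allI) auto
  then obtain f where f: "\<And>n. holomorphic_several_on (f n) (ball p R)"
    and fg: "\<And>n q. q \<in> ball p R \<Longrightarrow> norm (f n q - g q) \<le> inverse (real (Suc n))" by blast
  have "\<forall>n. \<exists>L. \<forall>x\<in>ball p R. (f n has_derivative L x) (at x) \<and> (\<forall>c u. L x (cmul c u) = c * L x u)"
    using f unfolding holomorphic_several_on_iff by (intro allI bchoice) blast
  then obtain L where L: "\<And>n x. x \<in> ball p R \<Longrightarrow> (f n has_derivative L n x) (at x)"
    and Lc: "\<And>n x c u. x \<in> ball p R \<Longrightarrow> L n x (cmul c u) = c * L n x u" by metis
  have BR: "B \<subseteq> ball p R" using \<open>R > 0\<close> by (auto simp: B_def)
  have est: "norm (L m x u - L n x u) \<le> 6 / R * (inverse (real (Suc m)) + inverse (real (Suc n))) * norm u"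
    if x: "x \<in> B" for m n x u
  proof -
    have sub: "ball x (R/2) \<subseteq> ball p R"
    proof
      fix y assume "y \<in> ball x (R/2)"
      then show "y \<in> ball p R" using x dist_triangle[of p y x] by (auto simp: B_def)
    qed
    have xR: "x \<in> ball p R" using x BR by auto
    have "norm (L m x u - L n x u) \<le> 3 * (inverse (real (Suc m)) + inverse (real (Suc n))) / (R/2) * norm u"
    proof (rule holo_Cauchy_estimate[where f = "\<lambda>x. f m x - f n x"])
      show "holomorphic_several_on (\<lambda>x. f m x - f n x) (ball x (R/2))"
        by (intro holo_diff holo_subset[OF f sub])
      show "((\<lambda>x. f m x - f n x) has_derivative (\<lambda>u. L m x u - L n x u)) (at x)"
        by (intro derivative_intros L xR)
      show "norm (f m y - f n y) \<le> inverse (real (Suc m)) + inverse (real (Suc n))" if "y \<in> ball x (R/2)" for y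
      proof -
        have "y \<in> ball p R" using that sub by auto
        have "norm (f m y - f n y) = norm ((f m y - g y) - (f n y - g y))" by simp
        also have "\<dots> \<le> inverse (real (Suc m)) + inverse (real (Suc n))"
          by (rule order_trans[OF norm_triangle_ineq4 add_mono[OF fg fg]]) (rule \<open>y \<in> ball p R\<close>)+
        finally show ?thesis .
      qed
    qed (use \<open>R > 0\<close> xR in \<open>auto simp: Lc algebra_simps\<close>)
    then show ?thesis by (simp add: field_simps)
  qed
  have inv0: "(\<lambda>n. inverse (real (Suc n))) \<longlonglongrightarrow> 0" by (rule LIMSEQ_inverse_real_of_nat)
  have conv: "\<exists>l. (\<lambda>n. L n x u) \<longlonglongrightarrow> l" if x: "x \<in> B" for x u
  proof -
    have "Cauchy (\<lambda>n. L n x u)"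
    proof (rule metric_CauchyI)
      fix e :: real assume "e > 0"
      \<comment> \<open>The summand 1 keeps \<open>K\<close> positive also for
        \<open>u = 0\<close>.\<close>
      define K where "K = 12 / R * norm u + 1"
      have K: "K > 0" using \<open>R > 0\<close> by (simp add: K_def add_nonneg_pos)
      obtain M where M: "\<And>n. n \<ge> M \<Longrightarrow> inverse (real (Suc n)) < e / K"
        using order_tendstoD(2)[OF inv0, of "e/K"] K \<open>e > 0\<close> by (auto simp: eventually_sequentially)
      have "dist (L m x u) (L n x u) < e" if "m \<ge> M" "n \<ge> M" for m n
      proof -
        have "norm (L m x u - L n x u) \<le> 6 / R * (inverse (real (Suc m)) + inverse (real (Suc n))) * norm u"
          by (rule est[OF x])
        also have "\<dots> \<le> 6 / R * (e/K + e/K) * norm u"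
          using M[OF that(1)] M[OF that(2)] \<open>R > 0\<close> by (intro mult_right_mono mult_left_mono) auto
        also have "\<dots> = (K - 1) * (e / K)" by (simp add: K_def field_simps)
        also have "\<dots> < K * (e/K)" using K \<open>e > 0\<close> by (intro mult_strict_right_mono) auto
        finally show ?thesis using K by (simp add: dist_norm)
      qed
      then show "\<exists>M. \<forall>m\<ge>M. \<forall>n\<ge>M. dist (L m x u) (L n x u) < e" by blast
    qed
    then show ?thesis by (simp add: Cauchy_convergent_iff convergent_def)
  qed
  define L' where "L' x u = lim (\<lambda>n. L n x u)" for x u
  have L': "(\<lambda>n. L n x u) \<longlonglongrightarrow> L' x u" if "x \<in> B" for x u
    unfolding L'_def using conv[OF that] by (metis limI)
  have est': "norm (L n x u - L' x u) \<le> 6 / R * inverse (real (Suc n)) * norm u" if x: "x \<in> B" for n x u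
  proof (rule LIMSEQ_le[where X = "\<lambda>m. norm (L n x u - L m x u)"])
    show "(\<lambda>m. norm (L n x u - L m x u)) \<longlonglongrightarrow> norm (L n x u - L' x u)"
      by (intro tendsto_intros L'[OF x])
    have "(\<lambda>m. 6 / R * (inverse (real (Suc n)) + inverse (real (Suc m))) * norm u)
        \<longlonglongrightarrow> 6 / R * (inverse (real (Suc n)) + 0) * norm u"
      by (intro tendsto_intros inv0)
    then show "(\<lambda>m. 6 / R * (inverse (real (Suc n)) + inverse (real (Suc m))) * norm u)
        \<longlonglongrightarrow> 6 / R * inverse (real (Suc n)) * norm u" by simp
    show "\<exists>N. \<forall>m\<ge>N. norm (L n x u - L m x u) \<le> 6 / R * (inverse (real (Suc n)) + inverse (real (Suc m))) * norm u"
      using est[OF x] by blast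
  qed
  have limg: "(\<lambda>n. f n x) \<longlonglongrightarrow> g x" if "x \<in> B" for x
  proof -
    have "x \<in> ball p R" using that BR by auto
    then have "(\<lambda>n. f n x - g x) \<longlonglongrightarrow> 0"
      by (intro Lim_null_comparison[OF _ inv0]) (rule always_eventually, intro allI fg)
    then show ?thesis by (simp add: LIM_zero_iff)
  qed
  have "\<exists>h. \<forall>x\<in>B. (\<lambda>n. f n x) \<longlonglongrightarrow> h x \<and> (h has_derivative L' x) (at x within B)"
  proof (rule has_derivative_sequence[where f' = L and ?x0.0 = p])
    show "convex B" by (simp add: B_def)
    show "(f n has_derivative L n x) (at x within B)" if "x \<in> B" for n x
      using that BR L by (meson has_derivative_at_withinI subsetD)
    show "p \<in> B" using \<open>R > 0\<close> by (simp add: B_def)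
    then show "(\<lambda>n. f n p) \<longlonglongrightarrow> g p" by (rule limg)
    fix e :: real assume "e > 0"
    then have "\<forall>\<^sub>F n in sequentially. inverse (real (Suc n)) < e * R / 6"
      using \<open>R > 0\<close> by (intro order_tendstoD(2)[OF inv0]) simp
    then show "\<forall>\<^sub>F n in sequentially. \<forall>x\<in>B. \<forall>h. norm (L n x h - L' x h) \<le> e * norm h"
    proof eventually_elim
      case (elim n)
      show ?case
      proof (intro ballI allI)
        fix x h assume "x \<in> B"
        then have "norm (L n x h - L' x h) \<le> 6 / R * inverse (real (Suc n)) * norm h" by (rule est')
        also have "\<dots> \<le> 6 / R * (e * R / 6) * norm h"
          using elim \<open>R > 0\<close> by (intro mult_right_mono mult_left_mono) auto
        also have "\<dots> = e * norm h" using \<open>R > 0\<close> by simp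
        finally show "norm (L n x h - L' x h) \<le> e * norm h" .
      qed
    qed
  qed
  then obtain h where h: "\<And>x. x \<in> B \<Longrightarrow> (\<lambda>n. f n x) \<longlonglongrightarrow> h x"
    and h': "\<And>x. x \<in> B \<Longrightarrow> (h has_derivative L' x) (at x within B)" by blast
  \<comment> \<open>\<open>has_derivative_sequence\<close> only yields some limit function
    \<open>h\<close>; uniqueness of limits identifies it with \<open>g\<close>.\<close>
  have hg: "h x = g x" if "x \<in> B" for x
    using LIMSEQ_unique[OF h[OF that] limg[OF that]] .
  have oB: "open B" by (simp add: B_def)
  show ?thesis unfolding holomorphic_several_on_iff B_def[symmetric]
  proof
    fix x assume x: "x \<in> B"
    have "(h has_derivative L' x) (at x)" using h'[OF x] at_within_open[OF x oB] by simp
    then have "(g has_derivative L' x) (at x)"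
      using hg by (rule has_derivative_transform_within_open[OF _ oB x])
    moreover have "L' x (cmul c u) = c * L' x u" for c u
    proof (rule LIMSEQ_unique[OF L'[OF x]])
      have "x \<in> ball p R" using x BR by auto
      then have "(\<lambda>n. L n x (cmul c u)) = (\<lambda>n. c * L n x u)" using Lc by auto
      then show "(\<lambda>n. L n x (cmul c u)) \<longlonglongrightarrow> c * L' x u"
        using tendsto_mult_left[OF L'[OF x]] by simp
    qed
    ultimately show "\<exists>L. (g has_derivative L) (at x) \<and> (\<forall>c u. L (cmul c u) = c * L u)" by blast
  qed
qed

text \<open>Asking for one holomorphic function within each \<open>e\<close>, instead of a sequence,
  covers both limits along finite subsets and Riemann sums.\<close>

lemma holo_approx:
  fixes g :: "complex \<times> ('v::real_normed_vector \<times> 'v) \<Rightarrow> complex"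
  assumes "open S"
    and appr: "\<And>e. e > 0 \<Longrightarrow> \<exists>f. holomorphic_several_on f S \<and> (\<forall>q\<in>S. norm (f q - g q) \<le> e)"
  shows "holomorphic_several_on g S"
proof (rule holo_pointwise)
  fix p assume "p \<in> S"
  then obtain R where R: "R > 0" "ball p R \<subseteq> S" using \<open>open S\<close> open_contains_ball by blast
  have "holomorphic_several_on g (ball p (R/2))"
  proof (rule holo_approx_ball[OF R(1)])
    fix e :: real assume "e > 0"
    then show "\<exists>f. holomorphic_several_on f (ball p R) \<and> (\<forall>q\<in>ball p R. norm (f q - g q) \<le> e)"
      using appr R(2) by (meson holo_subset subsetD)
  qed
  then show "\<exists>T. p \<in> T \<and> holomorphic_several_on g T" using R(1) by (intro exI[of _ "ball p (R/2)"]) auto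
qed

lemma holo_uniform_limit:
  fixes g :: "complex \<times> ('v::real_normed_vector \<times> 'v) \<Rightarrow> complex"
  assumes "open S" "uniform_limit S f g F" "F \<noteq> bot" "\<forall>\<^sub>F i in F. holomorphic_several_on (f i) S"
  shows "holomorphic_several_on g S"
proof (rule holo_approx[OF \<open>open S\<close>])
  fix e :: real assume "e > 0"
  then have "\<forall>\<^sub>F i in F. \<forall>q\<in>S. dist (f i q) (g q) < e" using assms(2) by (rule uniform_limitD[rotated])
  with assms(4) have "\<forall>\<^sub>F i in F. holomorphic_several_on (f i) S \<and> (\<forall>q\<in>S. norm (f i q - g q) \<le> e)"
    by eventually_elim (auto simp: dist_norm less_imp_le)
  with \<open>F \<noteq> bot\<close> show "\<exists>f. holomorphic_several_on f S \<and> (\<forall>q\<in>S. norm (f q - g q) \<le> e)"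
    using eventually_happens' by blast
qed


lemma holo_shift:
  assumes "holomorphic_several_on f S" "\<And>q. q \<in> T \<Longrightarrow> q + w \<in> S"
  shows "holomorphic_several_on (\<lambda>q. f (q + w)) T"
  unfolding holomorphic_several_on_iff
proof
  fix q assume "q \<in> T"
  then obtain L where L: "(f has_derivative L) (at (q + w))" "\<And>c u. L (cmul c u) = c * L u"
    using assms unfolding holomorphic_several_on_iff by metis
  have "((\<lambda>q. q + w) has_derivative (\<lambda>h. h)) (at q)" by (auto intro!: derivative_eq_intros)
  from has_derivative_compose[OF this L(1)] L(2)
  show "\<exists>L. ((\<lambda>q. f (q + w)) has_derivative L) (at q) \<and> (\<forall>c u. L (cmul c u) = c * L u)" by blast
qed

section \<open>Circle means and division by a divisor\<close>

lemma riemann_sum_close: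
  fixes F :: "real \<Rightarrow> complex"
  assumes cont: "continuous_on {0..1} F" and n: "n > 0"
    and close: "\<And>x y. x \<in> {0..1} \<Longrightarrow> y \<in> {0..1} \<Longrightarrow> \<bar>x - y\<bar> \<le> 1 / real n \<Longrightarrow> norm (F x - F y) \<le> e"
  shows "norm (integral {0..1} F - (\<Sum>k<n. F (real k / n) / n)) \<le> e"
proof -
  \<comment> \<open>The induction needs the error on an initial interval to be proportional to its
    length.\<close>
  have "norm (integral {0..real j / n} F - (\<Sum>k<j. F (real k / n) / n)) \<le> e * (real j / n)" if "j \<le> n" for j
    using that
  proof (induction j)
    case (Suc j)
    define a b where "a = real j / n" and "b = real (Suc j) / n"
    have ab: "0 \<le> a" "a \<le> b" "b \<le> 1" "b - a = 1 / n"
      using Suc.prems n by (auto simp: a_def b_def field_simps)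
    have cont': "continuous_on {0..b} F" "continuous_on {a..b} F"
      using ab by (auto intro!: continuous_on_subset[OF cont])
    have "integral {0..b} F = integral {0..a} F + integral {a..b} F"
      using ab by (intro Henstock_Kurzweil_Integration.integral_combine[symmetric] integrable_continuous_real cont')
    moreover have "integral {a..b} (\<lambda>x. F x - F a) = integral {a..b} F - F a / n"
      using ab cont'(2) by (subst integral_diff) (auto intro!: integrable_continuous_real simp: scaleR_conv_of_real)
    moreover have "norm (integral {a..b} (\<lambda>x. F x - F a)) \<le> e * (b - a)"
      using ab by (intro integral_bound) (auto intro!: continuous_intros cont' close)
    moreover have "norm (integral {0..a} F - (\<Sum>k<j. F (real k / n) / n)) \<le> e * a"
      using Suc by (simp add: a_def)
    ultimately have "integral {0..b} F - (\<Sum>k<Suc j. F (real k / n) / n) =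
        (integral {0..a} F - (\<Sum>k<j. F (real k / n) / n)) + integral {a..b} (\<lambda>x. F x - F a)"
      and "norm (integral {0..a} F - (\<Sum>k<j. F (real k / n) / n)) \<le> e * a"
      and "norm (integral {a..b} (\<lambda>x. F x - F a)) \<le> e * (b - a)"
      by (simp_all add: a_def)
    then have "norm (integral {0..b} F - (\<Sum>k<Suc j. F (real k / n) / n)) \<le> e * a + e * (b - a)"
      by (metis norm_triangle_mono)
    then show ?case by (simp add: b_def algebra_simps)
  qed simp
  from this[of n] n show ?thesis by simp
qed

text \<open>Joint uniform continuity on the compact product of \<open>cball p R\<close> and
  \<open>[0,1]\<close> makes the Riemann sums converge uniformly in \<open>q\<close>; each is a
  finite combination of translates of \<psi>, hence holomorphic. Compactness of the ball is where
  finite dimension enters.\<close>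

lemma holo_circle_mean:
  fixes \<psi> :: "complex \<times> ('v::{real_normed_vector,heine_borel} \<times> 'v) \<Rightarrow> complex"
  assumes \<psi>: "holomorphic_several_on \<psi> S"
    and S: "\<And>q z. q \<in> cball p R \<Longrightarrow> norm z = \<sigma> \<Longrightarrow> q + cmul z u \<in> S" and "\<sigma> \<ge> 0"
  shows "holomorphic_several_on
    (\<lambda>q. integral {0..1} (\<lambda>x. \<psi> (q + cmul (of_real \<sigma> * exp (2 * of_real pi * \<i> * of_real x)) u))) (ball p R)"
proof (rule holo_approx)
  define \<gamma> where "\<gamma> x = of_real \<sigma> * exp (2 * of_real pi * \<i> * of_real x)" for x :: real
  have n\<gamma>: "norm (\<gamma> x) = \<sigma>" for x using \<open>\<sigma> \<ge> 0\<close> by (simp add: \<gamma>_def norm_mult norm_exp_eq_Re)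
  have cont: "continuous_on (cball p R \<times> {0..1}) (\<lambda>(q, x). \<psi> (q + cmul (\<gamma> x) u))"
  proof -
    have c1: "continuous_on (cball p R \<times> {0..1}) (\<lambda>y. fst y + cmul (\<gamma> (snd y)) u)"
      unfolding \<gamma>_def
      by (intro continuous_intros bounded_linear.continuous_on[OF bounded_linear_cmul_left])
    have "continuous_on (cball p R \<times> {0..1}) (\<lambda>y. \<psi> (fst y + cmul (\<gamma> (snd y)) u))"
      by (rule continuous_on_compose2[OF holo_continuous_on[OF \<psi>] c1]) (auto simp del: split_paired_All intro!: S[OF _ n\<gamma>])
    then show ?thesis by (simp add: case_prod_unfold)
  qed
  fix e :: real assume "e > 0"
  have "uniformly_continuous_on (cball p R \<times> {0..1}) (\<lambda>(q, x). \<psi> (q + cmul (\<gamma> x) u))"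
    by (intro compact_uniformly_continuous cont compact_Times) auto
  then obtain d where d: "d > 0"
    "\<And>a b. a \<in> cball p R \<times> {0..1} \<Longrightarrow> b \<in> cball p R \<times> {0..1} \<Longrightarrow> dist b a < d \<Longrightarrow>
      dist (case b of (q, x) \<Rightarrow> \<psi> (q + cmul (\<gamma> x) u)) (case a of (q, x) \<Rightarrow> \<psi> (q + cmul (\<gamma> x) u)) < e"
    unfolding uniformly_continuous_on_def using \<open>e > 0\<close> by metis
  obtain n :: nat where n: "n > 0" "1 / real n < d"
    using reals_Archimedean[OF d(1)] by (metis inverse_eq_divide zero_less_Suc)
  have "norm ((\<Sum>k<n. \<psi> (q + cmul (\<gamma> (real k / n)) u) / n) - integral {0..1} (\<lambda>x. \<psi> (q + cmul (\<gamma> x) u))) \<le> e"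
    if q: "q \<in> ball p R" for q
  proof -
    have q': "q \<in> cball p R" using q by auto
    have "norm (integral {0..1} (\<lambda>x. \<psi> (q + cmul (\<gamma> x) u)) - (\<Sum>k<n. \<psi> (q + cmul (\<gamma> (real k / n)) u) / n)) \<le> e"
    proof (rule riemann_sum_close[OF _ n(1)])
      show "continuous_on {0..1} (\<lambda>x. \<psi> (q + cmul (\<gamma> x) u))"
        using continuous_on_compose2[OF cont, of "{0..1}" "\<lambda>x. (q, x)"] q'
        by (simp add: image_subset_iff continuous_on_Pair)
      show "norm (\<psi> (q + cmul (\<gamma> x) u) - \<psi> (q + cmul (\<gamma> y) u)) \<le> e"
        if "x \<in> {0..1}" "y \<in> {0..1}" "\<bar>x - y\<bar> \<le> 1 / real n" for x y
        using d(2)[of "(q, y)" "(q, x)"] that n(2) q' by (auto simp: dist_Pair_Pair dist_norm)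
    qed
    then show ?thesis by (simp add: norm_minus_commute)
  qed
  moreover have "holomorphic_several_on (\<lambda>q. \<Sum>k<n. \<psi> (q + cmul (\<gamma> (real k / n)) u) / n) (ball p R)"
    using n(1) by (intro holo_sum holo_divide holo_const holo_shift[OF \<psi>] S) (auto simp: n\<gamma>)
  ultimately show "\<exists>f. holomorphic_several_on f (ball p R) \<and> (\<forall>q\<in>ball p R. norm (f q -
      integral {0..1} (\<lambda>x. \<psi> (q + cmul (of_real \<sigma> * exp (2 * of_real pi * \<i> * of_real x)) u))) \<le> e)"
    unfolding \<gamma>_def by (intro exI conjI ballI) auto
qed auto

lemma mean_value_circle:
  assumes h: "h holomorphic_on cball 0 \<sigma>" and \<sigma>: "\<sigma> > 0"
  shows "integral {0..1} (\<lambda>x. h (of_real \<sigma> * exp (2 * of_real pi * \<i> * of_real x))) = h 0"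
proof -
  have "((\<lambda>z. h z / (z - 0)) has_contour_integral (2 * of_real pi * \<i> * h 0)) (circlepath 0 \<sigma>)"
    using \<sigma> by (intro Cauchy_integral_circlepath_simple h) auto
  then have "((\<lambda>x. (2 * of_real pi * \<i>) * h (of_real \<sigma> * exp (2 * of_real pi * \<i> * of_real x)))
      has_integral (2 * of_real pi * \<i> * h 0)) {0..1}"
    unfolding has_contour_integral_def
  proof (rule has_integral_eq[rotated])
    fix x :: real assume "x \<in> {0..1}"
    then show "h (circlepath 0 \<sigma> x) / (circlepath 0 \<sigma> x - 0) * vector_derivative (circlepath 0 \<sigma>) (at x within {0..1})
        = 2 * of_real pi * \<i> * h (of_real \<sigma> * exp (2 * of_real pi * \<i> * of_real x))"
      using \<sigma> by (subst vector_derivative_circlepath01) (auto simp: circlepath)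
  qed
  from has_integral_mult_right[OF this, of "inverse (2 * of_real pi * \<i>)"] show ?thesis
    by (intro integral_unique) (simp add: field_simps)
qed

lemma one_minus_exp_eq_0_iff: "1 - exp (2 * of_real pi * \<i> * z) = 0 \<longleftrightarrow> z \<in> \<int>" for z :: complex
proof -
  have "1 - exp (2 * of_real pi * \<i> * z) = 0 \<longleftrightarrow> exp (2 * of_real pi * \<i> * z) = 1" by auto
  also have "\<dots> \<longleftrightarrow> (\<exists>n::int. Re z = n \<and> Im z = 0)"
    unfolding exp_eq_1 by (auto simp: mult.commute)
  also have "\<dots> \<longleftrightarrow> z \<in> \<int>" by (auto simp: Ints_def complex_eq_iff)
  finally show ?thesis .
qed

text \<open>The quotient is the mean over a circle, in a direction transversal to the divisor, of the quotient
  off the divisor.\<close>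

lemma holo_divide_zero:
  fixes g :: "complex \<times> ('v::{real_normed_vector,heine_borel} \<times> 'v) \<Rightarrow> complex" and l :: "'v \<Rightarrow>\<^sub>L real"
  defines "\<phi> \<equiv> \<lambda>q. 1 - exp (2 * of_real pi * \<i> * cpairing (snd q) l)"
  assumes g: "holomorphic_several_on g (ball p R)" and R: "R > 0"
    and v: "blinfun_apply l v = 1" and p0: "\<phi> p = 0"
    and g0: "\<And>q. q \<in> ball p R \<Longrightarrow> \<phi> q = 0 \<Longrightarrow> g q = 0"
  shows "\<exists>R' g1. R' > 0 \<and> R' \<le> R \<and> holomorphic_several_on g1 (ball p R') \<and> (\<forall>q\<in>ball p R'. g q = \<phi> q * g1 q)"
proof -
  \<comment> \<open>Along \<open>u\<close> the pairing \<Lambda> moves with unit speed, so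
    \<open>u\<close> is transversal to its level sets.\<close>
  define u :: "complex \<times> ('v \<times> 'v)" where "u = (0, (v, 0))"
  define \<Lambda> where "\<Lambda> q = cpairing (snd q) l" for q :: "complex \<times> ('v \<times> 'v)"
  have \<Lambda>u: "\<Lambda> (q + cmul z u) = \<Lambda> q + z" for q z
    using v by (simp add: \<Lambda>_def u_def cmul_def cscale_def cpairing_def blinfun.bilinear_simps complex_eq_iff)
  have \<phi>\<Lambda>: "\<phi> q = 1 - exp (2 * of_real pi * \<i> * \<Lambda> q)" for q by (simp add: \<phi>_def \<Lambda>_def)
  have \<phi>0: "\<phi> q = 0 \<longleftrightarrow> \<Lambda> q \<in> \<int>" for q unfolding \<phi>\<Lambda> by (rule one_minus_exp_eq_0_iff)
  from p0 obtain k :: int where k: "\<Lambda> p = of_int k" unfolding \<phi>0 by (auto elim: Ints_cases)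
  have nz: "\<phi> q \<noteq> 0" if "\<Lambda> q \<noteq> of_int k" "norm (\<Lambda> q - of_int k) < 1" for q
  proof
    assume "\<phi> q = 0"
    then obtain j :: int where j: "\<Lambda> q = of_int j" unfolding \<phi>0 by (auto elim: Ints_cases)
    with that have "norm (of_int (j - k) :: complex) < 1" by simp
    then have "\<bar>j - k\<bar> < 1" unfolding norm_of_int by linarith
    with that j show False by simp
  qed
  \<comment> \<open>The bound 1/8 keeps \<Lambda> within distance 1 of \<open>k\<close>, so no other
    integer level is met; the bound by \<open>R\<close> keeps discs of radius
    \<open>2 * \<sigma>\<close> in direction \<open>u\<close> inside the ball. With
    \<open>\<Lambda> q\<close> within \<open>\<sigma> / 2\<close> of \<open>k\<close>, the zero on
    the line lies strictly inside the circle of radius \<sigma>.\<close>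
  define \<sigma> where "\<sigma> = min (1/8) (R / (8 * (norm u + 1)))"
  have \<sigma>: "\<sigma> > 0" "\<sigma> \<le> 1/8" using R unfolding \<sigma>_def by (simp_all only: min_less_iff_conj min.cobounded1) (simp add: add_nonneg_pos)
  have "4 * \<sigma> * norm u \<le> R / 2"
  proof -
    have "4 * \<sigma> * norm u \<le> 4 * (R / (8 * (norm u + 1))) * norm u"
      by (intro mult_right_mono mult_left_mono) (auto simp: \<sigma>_def)
    also have "\<dots> = (R / 2) * (norm u / (norm u + 1))"
    proof -
      have "4 * (R / (8 * N)) * x = (R / 2) * (x / N)" for N x :: real by (cases "N = 0") (auto simp: field_simps)
      then show ?thesis .
    qed
    also have "\<dots> \<le> (R / 2) * 1" using R by (intro mult_left_mono) (auto simp: divide_le_eq add_nonneg_pos)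
    finally show ?thesis by simp
  qed
  then have cu: "norm (cmul z u) \<le> R / 2" if "norm z \<le> 2 * \<sigma>" for z
    using norm_cmul_le[of z u] mult_right_mono[OF that norm_ge_zero[of u]] by (simp add: algebra_simps)
  have "isCont \<Lambda> p" unfolding \<Lambda>_def by (rule holo_isCont[OF holo_cpairing[of _ UNIV]]) simp
  then obtain R0 where R0: "R0 > 0" "\<And>q. dist q p < R0 \<Longrightarrow> norm (\<Lambda> q - of_int k) < \<sigma> / 2"
    unfolding continuous_at_eps_delta using \<sigma> k by (metis dist_norm half_gt_zero)
  define R' where "R' = min (R0/2) (R/4)"
  have R': "R' > 0" "R' < R0" "R' < R/2" using R R0 by (auto simp: R'_def)
  have near: "norm (\<Lambda> q - of_int k) < \<sigma> / 2" if "q \<in> cball p R'" for q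
    using R0(2)[of q] that R' by (simp add: dist_commute)
  have inR: "q + cmul z u \<in> ball p R" if "q \<in> cball p R'" "norm z \<le> 2 * \<sigma>" for q z
  proof -
    have "dist p (q + cmul z u) \<le> dist p q + norm (cmul z u)"
      using dist_triangle[of p "q + cmul z u" q] by (simp add: dist_norm)
    then show ?thesis using that R' cu[OF that(2)] by simp
  qed
  define S where "S = ball p R \<inter> {q. \<phi> q \<noteq> 0}"
  define \<psi> where "\<psi> q = g q / \<phi> q" for q
  have hs\<phi>: "holomorphic_several_on \<phi> T" for T
    unfolding \<phi>_def by (intro holo_diff holo_const holo_exp holo_mult holo_cpairing)
  have hs\<psi>: "holomorphic_several_on \<psi> S"
    unfolding \<psi>_def by (rule holo_divide[OF holo_subset[OF g] hs\<phi>]) (auto simp: S_def)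
  define g1 where "g1 q = integral {0..1} (\<lambda>x. \<psi> (q + cmul (of_real \<sigma> * exp (2 * of_real pi * \<i> * of_real x)) u))" for q
  have hol: "holomorphic_several_on g1 (ball p R')" unfolding g1_def[abs_def]
  proof (rule holo_circle_mean[OF hs\<psi>])
    fix q and z :: complex assume q: "q \<in> cball p R'" and z: "norm z = \<sigma>"
    have n: "norm (\<Lambda> (q + cmul z u) - of_int k) \<ge> norm z - norm (\<Lambda> q - of_int k)"
      using norm_triangle_ineq2[of z "- (\<Lambda> q - of_int k)"] by (simp add: \<Lambda>u algebra_simps norm_minus_commute)
    have n': "norm (\<Lambda> (q + cmul z u) - of_int k) \<le> norm z + norm (\<Lambda> q - of_int k)"
      using norm_triangle_ineq[of z "\<Lambda> q - of_int k"] by (simp add: \<Lambda>u algebra_simps)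
    have "norm (\<Lambda> (q + cmul z u) - of_int k) > 0" "norm (\<Lambda> (q + cmul z u) - of_int k) < 1"
      using n n' near[OF q] z \<sigma> by linarith+
    then have "\<phi> (q + cmul z u) \<noteq> 0" by (intro nz) auto
    then show "q + cmul z u \<in> S" using inR[OF q, of z] z \<sigma> by (simp add: S_def)
  qed (use \<sigma> in auto)
  have "g q = \<phi> q * g1 q" if q: "q \<in> ball p R'" for q
  proof (cases "\<phi> q = 0")
    case True
    then show ?thesis using g0[of q] q R' R by auto
  next
    case False
    define z0 where "z0 = of_int k - \<Lambda> q"
    have q': "q \<in> cball p R'" using q by auto
    have z0: "norm z0 < \<sigma> / 2" using near[OF q'] by (simp add: z0_def norm_minus_commute)
    have "z0 \<noteq> 0" using False Ints_of_int[of k, where 'a=complex] unfolding \<phi>0 z0_def by (metis eq_iff_diff_eq_0)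
    define B where "B = ball (0::complex) (2 * \<sigma>)"
    have z0B: "z0 \<in> B" "z0 \<in> interior B" using z0 \<sigma> by (auto simp: B_def)
    define f where "f z = g (q + cmul z u)" for z
    define d where "d z = 1 - exp (2 * of_real pi * \<i> * (\<Lambda> q + z))" for z
    have "f holomorphic_on B" unfolding f_def[abs_def]
      by (rule holo_line_holomorphic[OF g], rule inR[OF q']) (simp add: B_def)
    moreover have "d holomorphic_on B" unfolding d_def[abs_def] by (intro holomorphic_intros)
    ultimately have fd: "f holomorphic_on B" "d holomorphic_on B" .
    have d\<phi>: "d z = \<phi> (q + cmul z u)" for z by (simp add: d_def \<phi>\<Lambda> \<Lambda>u)
    have d0: "d z0 = 0" by (simp add: d\<phi> \<phi>0 \<Lambda>u z0_def)
    have f0: "f z0 = 0" unfolding f_def using d0[unfolded d\<phi>] inR[OF q', of z0] z0 \<sigma> by (intro g0) auto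
    \<comment> \<open>Numerator and denominator are both divided by \<open>z - z0\<close>. As
      \<open>d\<close> has a simple zero there, \<open>f1 / d1\<close> extends the quotient across
      \<open>z0\<close>, and its mean over the circle is its value at 0, the quotient at
      \<open>q\<close>.\<close>
    define f1 where "f1 z = (if z = z0 then deriv f z0 else (f z - f z0) / (z - z0))" for z
    define d1 where "d1 z = (if z = z0 then deriv d z0 else (d z - d z0) / (z - z0))" for z
    have fd1: "f1 holomorphic_on B" "d1 holomorphic_on B"
      unfolding f1_def[abs_def] d1_def[abs_def] by (intro pole_lemma fd z0B)+
    have "(d has_field_derivative - (2 * of_real pi * \<i>) * exp (2 * of_real pi * \<i> * (\<Lambda> q + z0))) (at z0)"
      unfolding d_def[abs_def] by (auto intro!: derivative_eq_intros)
    then have dd: "deriv d z0 \<noteq> 0" by (simp add: DERIV_imp_deriv)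
    have dnz: "d z \<noteq> 0" if "z \<in> B" "z \<noteq> z0" for z
      unfolding d\<phi>
    proof (rule nz)
      show "\<Lambda> (q + cmul z u) \<noteq> of_int k" using that(2) unfolding \<Lambda>u z0_def by (metis add_diff_cancel_left')
      have "norm (\<Lambda> (q + cmul z u) - of_int k) \<le> norm z + norm (\<Lambda> q - of_int k)"
        using norm_triangle_ineq[of z "\<Lambda> q - of_int k"] by (simp add: \<Lambda>u algebra_simps)
      also have "\<dots> < 1" using that(1) near[OF q'] \<sigma> by (simp add: B_def)
      finally show "norm (\<Lambda> (q + cmul z u) - of_int k) < 1" .
    qed
    have d1nz: "d1 z \<noteq> 0" if "z \<in> B" for z
      using dd dnz[OF that] d0 by (auto simp: d1_def)
    have hh: "(\<lambda>z. f1 z / d1 z) holomorphic_on cball 0 \<sigma>"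
      using d1nz \<sigma> by (intro holomorphic_on_subset[OF holomorphic_on_divide[OF fd1]]) (auto simp: B_def)
    have eq: "f1 z / d1 z = \<psi> (q + cmul z u)" if "z \<noteq> z0" for z
      using that by (simp add: f1_def d1_def f0 d0) (simp add: \<psi>_def f_def d\<phi>)
    have "g1 q = integral {0..1} (\<lambda>x. (\<lambda>z. f1 z / d1 z) (of_real \<sigma> * exp (2 * of_real pi * \<i> * of_real x)))"
      unfolding g1_def
    proof (rule integral_cong)
      fix x :: real
      have "norm (of_real \<sigma> * exp (2 * of_real pi * \<i> * of_real x)) = \<sigma>" using \<sigma> by (simp add: norm_mult norm_exp_eq_Re)
      then have "of_real \<sigma> * exp (2 * of_real pi * \<i> * of_real x) \<noteq> z0" using z0 \<sigma> by auto
      then show "\<psi> (q + cmul (of_real \<sigma> * exp (2 * of_real pi * \<i> * of_real x)) u) =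
        (\<lambda>z. f1 z / d1 z) (of_real \<sigma> * exp (2 * of_real pi * \<i> * of_real x))" by (simp add: eq)
    qed
    also have "\<dots> = f1 0 / d1 0" using mean_value_circle[OF hh \<sigma>(1)] by simp
    also have "\<dots> = \<psi> q" using eq[of 0] \<open>z0 \<noteq> 0\<close> by simp
    finally show ?thesis using False by (simp add: \<psi>_def)
  qed
  with hol R' R show ?thesis by (intro exI[of _ R'] exI[of _ g1]) auto
qed

section \<open>Signs of roots in reflection representations\<close>

text \<open>Letters are added on the left, so a nonempty word ends in \<open>t\<close>: applied to
  the simple vector of \<open>s\<close>, the reflection in \<open>t\<close> acts first.\<close>

fun alt_word :: "'i \<Rightarrow> 'i \<Rightarrow> nat \<Rightarrow> 'i list" where
  "alt_word s t 0 = []"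
| "alt_word s t (Suc k) = (if even k then t else s) # alt_word s t k"

lemma length_alt_word [simp]: "length (alt_word s t k) = k"
  by (induction k) auto

lemma set_alt_word: "set (alt_word s t k) \<subseteq> {s, t}"
  by (induction k) auto

lemma alt_word_suffix: "m \<le> k \<Longrightarrow> \<exists>u. set u \<subseteq> {s, t} \<and> length u = k - m \<and> alt_word s t k = u @ alt_word s t m"
proof (induction k)
  case 0
  then show ?case by auto
next
  case (Suc k)
  show ?case
  proof (cases "m = Suc k")
    case False
    with Suc obtain u where u: "set u \<subseteq> {s, t}" "length u = k - m" "alt_word s t k = u @ alt_word s t m"
      by auto
    with False Suc.prems show ?thesis
      by (intro exI[of _ "(if even k then t else s) # u"]) (auto simp: Suc_diff_le)
  qed (auto intro: exI[of _ "[]"])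
qed

text \<open>Order of the product of two simple reflections whose Cartan entries multiply to
  \<open>n\<close>: 2, 3, 4, 6 for \<open>n\<close> = 0, 1, 2, 3. The last branch is meant for
  \<open>n = 3\<close>; from 4 on the order is infinite.\<close>

definition braid_order :: "nat \<Rightarrow> nat" where
  "braid_order n = (if n = 0 then 2 else if n = 1 then 3 else if n = 2 then 4 else 6)"

lemma braid_order_cases:
  "n \<le> 3 \<Longrightarrow> k < braid_order n \<Longrightarrow>
    k = 0 \<or> k = 1 \<or> k = 2 \<and> n \<ge> 1 \<or> k = 3 \<and> n \<ge> 2 \<or> k = 4 \<and> n = 3 \<or> k = 5 \<and> n = 3"
  unfolding braid_order_def by (simp split: if_splits; presburger)

lemma alt_word_expand: "alt_word s t 1 = [t]" "alt_word s t 2 = [s, t]" "alt_word s t 3 = [t, s, t]"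
  "alt_word s t 4 = [s, t, s, t]" "alt_word s t 5 = [t, s, t, s, t]" "alt_word s t 6 = [s, t, s, t, s, t]"
proof -
  have "alt_word s t (Suc 0) = [t]" "alt_word s t (Suc (Suc 0)) = [s, t]" "alt_word s t (Suc (Suc (Suc 0))) = [t, s, t]"
    "alt_word s t (Suc (Suc (Suc (Suc 0)))) = [s, t, s, t]"
    "alt_word s t (Suc (Suc (Suc (Suc (Suc 0))))) = [t, s, t, s, t]"
    "alt_word s t (Suc (Suc (Suc (Suc (Suc (Suc 0)))))) = [s, t, s, t, s, t]" by simp_all
  then show "alt_word s t 1 = [t]" "alt_word s t 2 = [s, t]" "alt_word s t 3 = [t, s, t]"
    "alt_word s t 4 = [s, t, s, t]" "alt_word s t 5 = [t, s, t, s, t]" "alt_word s t 6 = [s, t, s, t, s, t]"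
    by (simp_all only: eval_nat_numeral BitM.simps numeral_One One_nat_def)
qed

text \<open>Abstracted because it is instantiated twice: with simple roots as vectors and coroots as
  forms, and with simple coroots as vectors and evaluation at simple roots as forms. Transposing the
  Cartan matrix preserves the axioms.\<close>

locale refl_data =
  fixes I :: "'i set" and \<alpha> :: "'i \<Rightarrow> 'a::real_vector" and \<beta> :: "'i \<Rightarrow> 'a \<Rightarrow> real"
  assumes fin: "finite I"
    and lin: "i \<in> I \<Longrightarrow> linear (\<beta> i)"
    and inj: "inj_on \<alpha> I"
    and indep: "independent (\<alpha> ` I)"
    and diag: "i \<in> I \<Longrightarrow> \<beta> i (\<alpha> i) = 2"
    and offdiag: "i \<in> I \<Longrightarrow> j \<in> I \<Longrightarrow> i \<noteq> j \<Longrightarrow> \<exists>n::nat. \<beta> j (\<alpha> i) = - real n"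
    and zero: "i \<in> I \<Longrightarrow> j \<in> I \<Longrightarrow> \<beta> j (\<alpha> i) = 0 \<Longrightarrow> \<beta> i (\<alpha> j) = 0"
begin

definition ref :: "'i \<Rightarrow> 'a \<Rightarrow> 'a" where
  "ref i v = v - \<beta> i v *\<^sub>R \<alpha> i"

definition act :: "'i list \<Rightarrow> 'a \<Rightarrow> 'a" where
  "act ws = foldr (\<lambda>i u. ref i \<circ> u) ws id"

lemma act_Nil [simp]: "act [] = id"
  and act_Cons [simp]: "act (i # ws) v = ref i (act ws v)"
  by (simp_all add: act_def)

lemma act_append [simp]: "act (us @ ws) v = act us (act ws v)"
  by (induction us) auto

lemma linear_ref: "i \<in> I \<Longrightarrow> linear (ref i)"
  using lin[of i] by (intro linearI) (simp_all add: ref_def linear_add linear_scale algebra_simps)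

lemma linear_act: "set ws \<subseteq> I \<Longrightarrow> linear (act ws)"
proof (induction ws)
  case Nil
  show ?case by (simp add: act_def id_def linear_ident)
next
  case (Cons i ws)
  then have "linear (ref i \<circ> act ws)" by (intro linear_compose linear_ref) auto
  then show ?case by (simp add: act_def o_def)
qed

lemma ref_self: "i \<in> I \<Longrightarrow> ref i (\<alpha> i) = - \<alpha> i"
  by (simp add: ref_def diag scaleR_2)

lemma ref_ref: "i \<in> I \<Longrightarrow> ref i (ref i v) = v"
  using lin[of i] by (simp add: ref_def linear_diff linear_scale diag algebra_simps scaleR_2 flip: scaleR_2)

lemma act_rev: "set ws \<subseteq> I \<Longrightarrow> act ws (act (rev ws) v) = v"
  by (induction ws arbitrary: v) (auto simp: ref_ref)

lemma act_rev': "set ws \<subseteq> I \<Longrightarrow> act (rev ws) (act ws v) = v"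
  using act_rev[of "rev ws"] by simp

definition pos :: "'a \<Rightarrow> bool" where
  "pos v \<longleftrightarrow> (\<exists>c::'i \<Rightarrow> nat. v = (\<Sum>i\<in>I. real (c i) *\<^sub>R \<alpha> i))"

lemma pos_add: "pos u \<Longrightarrow> pos v \<Longrightarrow> pos (u + v)"
  unfolding pos_def
proof (elim exE)
  fix c d :: "'i \<Rightarrow> nat"
  assume "u = (\<Sum>i\<in>I. real (c i) *\<^sub>R \<alpha> i)" "v = (\<Sum>i\<in>I. real (d i) *\<^sub>R \<alpha> i)"
  then show "\<exists>c::'i \<Rightarrow> nat. u + v = (\<Sum>i\<in>I. real (c i) *\<^sub>R \<alpha> i)"
    by (intro exI[of _ "\<lambda>i. c i + d i"]) (simp add: scaleR_add_left sum.distrib)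
qed

lemma pos_scale: "pos u \<Longrightarrow> pos (real n *\<^sub>R u)"
  unfolding pos_def
proof (elim exE)
  fix c :: "'i \<Rightarrow> nat"
  assume "u = (\<Sum>i\<in>I. real (c i) *\<^sub>R \<alpha> i)"
  then show "\<exists>c::'i \<Rightarrow> nat. real n *\<^sub>R u = (\<Sum>i\<in>I. real (c i) *\<^sub>R \<alpha> i)"
    by (intro exI[of _ "\<lambda>i. n * c i"]) (simp add: scaleR_sum_right)
qed

lemma pos_simple: "i \<in> I \<Longrightarrow> pos (\<alpha> i)"
  unfolding pos_def using fin
  by (intro exI[of _ "\<lambda>j. if j = i then 1 else 0"]) (simp add: if_distrib[of real] if_distrib[of "\<lambda>x. x *\<^sub>R _"] cong: if_cong)

lemma coeff_zero: "(\<Sum>i\<in>I. c i *\<^sub>R \<alpha> i) = 0 \<Longrightarrow> i \<in> I \<Longrightarrow> c i = 0"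
proof -
  assume c: "(\<Sum>i\<in>I. c i *\<^sub>R \<alpha> i) = 0" and i: "i \<in> I"
  have "(\<Sum>v\<in>\<alpha> ` I. c (the_inv_into I \<alpha> v) *\<^sub>R v) = 0"
    using c by (subst sum.reindex[OF inj]) (simp add: the_inv_into_f_f[OF inj])
  from independentD[OF indep _ _ this, of "\<alpha> i"] fin i show "c i = 0"
    by (auto simp: the_inv_into_f_f[OF inj])
qed

lemma coeff_unique: "(\<Sum>i\<in>I. c i *\<^sub>R \<alpha> i) = (\<Sum>i\<in>I. d i *\<^sub>R \<alpha> i) \<Longrightarrow> i \<in> I \<Longrightarrow> c i = d i"
  using coeff_zero[of "\<lambda>i. c i - d i" i] by (simp add: scaleR_diff_left sum_subtractf)

lemma pos_neg_zero: "pos v \<Longrightarrow> pos (- v) \<Longrightarrow> v = 0"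
  unfolding pos_def
proof (elim exE)
  fix c d :: "'i \<Rightarrow> nat"
  assume c: "v = (\<Sum>i\<in>I. real (c i) *\<^sub>R \<alpha> i)" and d: "- v = (\<Sum>i\<in>I. real (d i) *\<^sub>R \<alpha> i)"
  have "(\<Sum>i\<in>I. (real (c i) + real (d i)) *\<^sub>R \<alpha> i) = v + - v"
    by (simp only: c[symmetric] d[symmetric] scaleR_add_left sum.distrib)
  then have "\<forall>i\<in>I. real (c i) + real (d i) = 0" using coeff_zero[of "\<lambda>i. real (c i) + real (d i)"] by simp
  then have "\<forall>i\<in>I. c i = 0" by (simp add: add_nonneg_eq_0_iff)
  then show "v = 0" by (simp add: c)
qed

lemma simple_nonzero: "i \<in> I \<Longrightarrow> \<alpha> i \<noteq> 0"
  using dependent_zero indep by (metis imageI)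

lemma act_nonzero: "set w \<subseteq> I \<Longrightarrow> v \<noteq> 0 \<Longrightarrow> act w v \<noteq> 0"
  using act_rev'[of w v] linear_0[OF linear_act[of "rev w"]] by auto

lemma act_not_pos_neg:
  "set w \<subseteq> I \<Longrightarrow> s \<in> I \<Longrightarrow> pos (act w (\<alpha> s)) \<Longrightarrow> pos (- act w (\<alpha> s)) \<Longrightarrow> False"
  using pos_neg_zero act_nonzero simple_nonzero by blast

section \<open>Rank two: the orbit of a simple vector under two reflections\<close>

context
  fixes s t :: 'i and p q :: nat
  assumes st: "s \<in> I" "t \<in> I" and p: "\<beta> s (\<alpha> t) = - real p" and q: "\<beta> t (\<alpha> s) = - real q"
begin

text \<open>The offset \<open>v\<close> gives formulas on the whole affine plane through
  \<open>v\<close>, so that the braid relation can be checked on arbitrary vectors.\<close>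

lemma ref_s: "ref s (v + x *\<^sub>R \<alpha> s + y *\<^sub>R \<alpha> t) = v + (- x - \<beta> s v + real p * y) *\<^sub>R \<alpha> s + y *\<^sub>R \<alpha> t"
  for x y :: real
proof -
  have "\<beta> s (v + x *\<^sub>R \<alpha> s + y *\<^sub>R \<alpha> t) = \<beta> s v + 2 * x - p * y"
    using lin[OF st(1)] by (simp add: linear_add linear_scale diag st p)
  moreover have "x *\<^sub>R \<alpha> s - (\<beta> s v + 2 * x - p * y) *\<^sub>R \<alpha> s = (- x - \<beta> s v + p * y) *\<^sub>R \<alpha> s"
    by (simp flip: scaleR_diff_left)
  ultimately show ?thesis by (simp add: ref_def diff_eq_eq)
qed

lemma ref_t: "ref t (v + x *\<^sub>R \<alpha> s + y *\<^sub>R \<alpha> t) = v + x *\<^sub>R \<alpha> s + (- y - \<beta> t v + real q * x) *\<^sub>R \<alpha> t"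
  for x y :: real
proof -
  have "\<beta> t (v + x *\<^sub>R \<alpha> s + y *\<^sub>R \<alpha> t) = \<beta> t v + 2 * y - q * x"
    using lin[OF st(2)] by (simp add: linear_add linear_scale diag st q)
  moreover have "y *\<^sub>R \<alpha> t - (\<beta> t v + 2 * y - q * x) *\<^sub>R \<alpha> t = (- y - \<beta> t v + q * x) *\<^sub>R \<alpha> t"
    by (simp flip: scaleR_diff_left)
  ultimately show ?thesis by (simp add: ref_def diff_eq_eq)
qed

lemma pq_cases:
  assumes "p * q \<le> 3" and "p = 0 \<longleftrightarrow> q = 0"
  shows "(p = 0 \<and> q = 0) \<or> (p = 1 \<and> q = 1) \<or> (p = 1 \<and> q = 2) \<or> (p = 2 \<and> q = 1) \<or> (p = 1 \<and> q = 3) \<or> (p = 3 \<and> q = 1)"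
proof (cases "p = 0")
  case False
  with assms have pq: "p \<ge> 1" "q \<ge> 1" by auto
  have "p \<le> p * q" "q \<le> p * q" using pq by auto
  with assms(1) have "p \<le> 3" "q \<le> 3" by linarith+
  with pq have "p \<in> {1,2,3}" "q \<in> {1,2,3}" by auto
  with assms(1) show ?thesis by auto
qed (use assms in auto)

text \<open>Both reflections preserve the affine plane through \<open>v\<close> spanned by the two
  simple vectors; in its coordinates the relation is a polynomial identity for each of the six
  possible pairs \<open>p\<close>, \<open>q\<close>.\<close>

lemma act_braid:
  assumes "p * q \<le> 3" and "p = 0 \<longleftrightarrow> q = 0"
  shows "act (alt_word s t (braid_order (p * q))) v = act (alt_word t s (braid_order (p * q))) v"
proof -
  define E where "E x y = v + x *\<^sub>R \<alpha> s + y *\<^sub>R \<alpha> t" for x y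
  have sE: "ref s (E x y) = E (- x - \<beta> s v + real p * y) y" and tE: "ref t (E x y) = E x (- y - \<beta> t v + real q * x)" for x y
    by (simp_all add: E_def ref_s ref_t)
  have "act (alt_word s t (braid_order (p * q))) (E 0 0) = act (alt_word t s (braid_order (p * q))) (E 0 0)"
    using pq_cases[OF assms] by (elim disjE conjE) (simp_all add: braid_order_def alt_word_expand sE tE algebra_simps)
  then show ?thesis by (simp add: E_def)
qed

text \<open>The inequality says that the form of the next reflection is non-positive on the current
  vector, so no coordinate decreases and the natural subtraction does not truncate. It reproduces
  itself because \<open>p * q \<ge> 4\<close>: from 2y \<le> qx one gets 2p(qx - y) \<ge> pqx \<ge>
  4x.\<close>

lemma act_alt_infinite:
  assumes "p * q \<ge> 4"
  shows "\<exists>x y::nat. act (alt_word s t k) (\<alpha> s) = real x *\<^sub>R \<alpha> s + real y *\<^sub>R \<alpha> t \<and>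
    (if even k then q * x \<ge> 2 * y else p * y \<ge> 2 * x)"
proof (induction k)
  case 0
  show ?case by (intro exI[of _ 1] exI[of _ 0]) auto
next
  case (Suc k)
  then obtain x y :: nat where xy: "act (alt_word s t k) (\<alpha> s) = real x *\<^sub>R \<alpha> s + real y *\<^sub>R \<alpha> t"
    and inv: "if even k then q * x \<ge> 2 * y else p * y \<ge> 2 * x" by blast
  have b0: "\<beta> s 0 = 0" "\<beta> t 0 = 0" using st lin linear_0 by blast+
  show ?case
  proof (cases "even k")
    case True
    with inv have i: "2 * y \<le> q * x" by simp
    have "act (alt_word s t (Suc k)) (\<alpha> s) = real x *\<^sub>R \<alpha> s + real (q * x - y) *\<^sub>R \<alpha> t"
      using ref_t[where v=0 and x="real x" and y="real y"] True xy i b0 by (simp add: of_nat_diff)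
    moreover have "2 * x \<le> p * (q * x - y)"
    proof -
      have "2 * (p * y) \<le> p * (q * x)"
        using mult_le_mono2[OF i, of p] by (simp only: mult.left_commute[of p 2])
      moreover have "4 * x \<le> p * (q * x)"
        using mult_le_mono1[OF assms, of x] by (simp only: mult.assoc )
      ultimately show ?thesis unfolding diff_mult_distrib2 by arith
    qed
    ultimately show ?thesis using True by (intro exI[of _ x] exI[of _ "q * x - y"]) auto
  next
    case False
    with inv have i: "2 * x \<le> p * y" by simp
    have "act (alt_word s t (Suc k)) (\<alpha> s) = real (p * y - x) *\<^sub>R \<alpha> s + real y *\<^sub>R \<alpha> t"
      using ref_s[where v=0 and x="real x" and y="real y"] False xy i b0 by (simp add: of_nat_diff)
    moreover have "2 * y \<le> q * (p * y - x)"
    proof -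
      have "2 * (q * x) \<le> q * (p * y)"
        using mult_le_mono2[OF i, of q] by (simp only: mult.left_commute[of q 2])
      moreover have "4 * y \<le> q * (p * y)"
        using mult_le_mono1[OF assms, of y] by (simp only: mult.assoc mult.left_commute[of p q])
      ultimately show ?thesis unfolding diff_mult_distrib2 by arith
    qed
    ultimately show ?thesis using False by (intro exI[of _ "p * y - x"] exI[of _ y]) auto
  qed
qed

text \<open>The coordinates met are (1,0), (1,q), (pq-1,q), (pq-1,(pq-2)q), followed for pq = 3 by
  (1,q), (1,0). Staying below the order keeps them non-negative.\<close>

lemma act_alt_finite:
  assumes "p * q \<le> 3" and "p = 0 \<longleftrightarrow> q = 0" and k: "k < braid_order (p * q)"
  shows "\<exists>x y::nat. act (alt_word s t k) (\<alpha> s) = real x *\<^sub>R \<alpha> s + real y *\<^sub>R \<alpha> t"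
proof -
  define E where "E x y = x *\<^sub>R \<alpha> s + y *\<^sub>R \<alpha> t" for x y
  have b0: "\<beta> s 0 = 0" "\<beta> t 0 = 0" using st lin linear_0 by blast+
  have sE: "ref s (E x y) = E (- x + real p * y) y" and tE: "ref t (E x y) = E x (- y + real q * x)" for x y
    using ref_s[where v=0 and x=x and y=y] ref_t[where v=0 and x=x and y=y] b0 by (simp_all add: E_def)
  have E0: "\<alpha> s = E 1 0" by (simp add: E_def)
  have ex: "\<exists>x y::nat. z = real x *\<^sub>R \<alpha> s + real y *\<^sub>R \<alpha> t" if "z = E (real a) (real b)" for z and a b :: nat
    using that unfolding E_def by blast
  have pq3: "real p * real q = 3" if "p * q = 3" using that by (metis of_nat_mult of_nat_numeral)
  have 0: ?thesis if "k = 0" by (rule ex[of _ 1 0]) (simp add: that E0)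
  have 1: ?thesis if "k = 1"
    by (rule ex[of _ 1 q]) (simp only: that alt_word_expand act_Cons act_Nil id_apply E0 sE tE, simp)
  have 2: ?thesis if "k = 2" "p * q \<ge> 1"
    using that by (intro ex[of _ "p * q - 1" q])
      (simp only: alt_word_expand act_Cons act_Nil id_apply E0 sE tE, simp add: of_nat_diff)
  have 3: ?thesis if k3: "k = 3" "p * q \<ge> 2"
  proof (rule ex[of _ "p * q - 1" "(p * q - 2) * q"])
    obtain c where c: "p * q = c + 2" using k3(2) by (metis add.commute le_Suc_ex)
    then have "real p * real q = real c + 2" by (metis of_nat_add of_nat_mult of_nat_numeral)
    then have "real (p * q - 1) = real p * real q - 1" "real ((p * q - 2) * q) = (real p * real q - 2) * real q"
      using c by simp_all
    then show "act (alt_word s t k) (\<alpha> s) = E (real (p * q - 1)) (real ((p * q - 2) * q))"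
      by (simp only: k3(1) alt_word_expand act_Cons act_Nil id_apply E0 sE tE) (simp add: algebra_simps)
  qed
  have 4: ?thesis if "k = 4" "p * q = 3"
    using that(1) pq3[OF that(2)] by (intro ex[of _ 1 q])
      (simp only: alt_word_expand act_Cons act_Nil id_apply E0 sE tE, simp add: algebra_simps)
  have 5: ?thesis if "k = 5" "p * q = 3"
    using that(1) pq3[OF that(2)] by (intro ex[of _ 1 0])
      (simp only: alt_word_expand act_Cons act_Nil id_apply E0 sE tE, simp add: algebra_simps)
  consider "k = 0" | "k = 1" | "k = 2" "p * q \<ge> 1" | "k = 3" "p * q \<ge> 2" | "k = 4" "p * q = 3" | "k = 5" "p * q = 3"
    using braid_order_cases[OF assms(1) k] by blast
  then show ?thesis using 0 1 2 3 4 5 by cases auto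
qed

end

end

text \<open>\<open>G\<close> sends words to group elements, seen only through equality. Length is
  defined from \<open>G\<close> and not from the action, so two representations with the same
  \<open>G\<close> share their length function.\<close>

locale refl_rep = refl_data +
  fixes G :: "'a list \<Rightarrow> 'g"
  assumes G_act: "set us \<subseteq> I \<Longrightarrow> set ws \<subseteq> I \<Longrightarrow> G us = G ws \<Longrightarrow> act us v = act ws v"
    and G_cong: "set us \<subseteq> I \<Longrightarrow> set ws \<subseteq> I \<Longrightarrow> G us = G ws \<Longrightarrow> set xs \<subseteq> I \<Longrightarrow> set ys \<subseteq> I \<Longrightarrow>
      G (xs @ us @ ys) = G (xs @ ws @ ys)"
    and G_sq: "i \<in> I \<Longrightarrow> G [i, i] = G []"
    and G_braid: "s \<in> I \<Longrightarrow> t \<in> I \<Longrightarrow> s \<noteq> t \<Longrightarrow> \<beta> s (\<alpha> t) = - real p \<Longrightarrow> \<beta> t (\<alpha> s) = - real q \<Longrightarrow> p * q \<le> 3 \<Longrightarrow>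
      G (alt_word s t (braid_order (p * q))) = G (alt_word t s (braid_order (p * q)))"
begin

section \<open>Length, and the sign of images of simple vectors\<close>

definition len :: "'a list \<Rightarrow> nat" where
  "len ws = (LEAST n. \<exists>us. length us = n \<and> set us \<subseteq> I \<and> G us = G ws)"

lemma len_reduced: "set ws \<subseteq> I \<Longrightarrow> \<exists>us. length us = len ws \<and> set us \<subseteq> I \<and> G us = G ws"
  unfolding len_def by (rule LeastI_ex) blast

lemma len_le: "set us \<subseteq> I \<Longrightarrow> G us = G ws \<Longrightarrow> len ws \<le> length us"
  unfolding len_def by (rule Least_le) blast

lemma len_cong: "G us = G ws \<Longrightarrow> len us = len ws"
  by (simp add: len_def)

lemma G_append_cong: "set us \<subseteq> I \<Longrightarrow> set ws \<subseteq> I \<Longrightarrow> G us = G ws \<Longrightarrow> set ys \<subseteq> I \<Longrightarrow> G (us @ ys) = G (ws @ ys)"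
  using G_cong[of us ws "[]" ys] by simp

lemma G_cancel: "set xs \<subseteq> I \<Longrightarrow> set ys \<subseteq> I \<Longrightarrow> i \<in> I \<Longrightarrow> G (xs @ i # i # ys) = G (xs @ ys)"
  using G_cong[of "[i,i]" "[]" xs ys] G_sq by simp

lemma len_append_le:
  assumes "set us \<subseteq> I" "set ws \<subseteq> I" shows "len (us @ ws) \<le> len us + length ws"
proof -
  obtain r where r: "length r = len us" "set r \<subseteq> I" "G r = G us" using len_reduced[OF assms(1)] by blast
  then have "len (us @ ws) \<le> length (r @ ws)" using assms by (intro len_le G_append_cong) auto
  then show ?thesis using r by simp
qed

text \<open>Induction on length. Write \<open>w\<close>, with lengths adding, as \<open>v\<close>
  followed by an alternating word in \<open>s\<close>, \<open>t\<close> ending in \<open>t\<close>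
  and as long as possible. Then neither letter shortens \<open>v\<close> on the right, so
  \<open>v\<close> makes both simple vectors positive, and rank two decides the rest.\<close>

theorem act_simple_pos:
  assumes "set w \<subseteq> I" "s \<in> I" "len w \<le> len (w @ [s])"
  shows "pos (act w (\<alpha> s))"
  using assms
proof (induction "len w" arbitrary: w s rule: less_induct)
  case less
  obtain r where r: "length r = len w" "set r \<subseteq> I" "G r = G w" using len_reduced less.prems(1) by blast
  show ?case
  proof (cases r rule: rev_cases)
    case Nil
    then have "act w (\<alpha> s) = \<alpha> s" using G_act[of w "[]"] r less.prems by simp
    then show ?thesis using pos_simple less.prems by simp
  next
    case (snoc r' t)
    then have t: "t \<in> I" and r': "set r' \<subseteq> I" using r by auto
    have Gws: "G (w @ [s]) = G z" if "G (z @ [s]) = G w" "set z \<subseteq> I" for z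
      using G_append_cong[of "z @ [s]" w "[s]"] G_cancel[of z "[]" s] that less.prems by simp
    \<comment> \<open>A shortest word for \<open>w\<close> cannot end in \<open>s\<close>: without
      that letter it would express \<open>w @ [s]\<close> by fewer than \<open>len w\<close>
      letters.\<close>
    have shorter: False if "G (z @ [s]) = G w" "set z \<subseteq> I" "length z < len w" for z
      using Gws[OF that(1,2)] len_le[of z "w @ [s]"] that less.prems by simp
    have "t \<noteq> s" using shorter[of r'] r r' snoc by auto
    define P where "P k \<longleftrightarrow> (\<exists>v. set v \<subseteq> I \<and> G (v @ alt_word s t k) = G w \<and> length v + k = len w)" for k
    define k where "k = (GREATEST k. P k)"
    have bound: "\<forall>k. P k \<longrightarrow> k \<le> len w" by (auto simp: P_def)
    have "P 1" using r r' snoc by (auto simp: P_def intro!: exI[of _ r'])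
    then have "P k" "1 \<le> k" unfolding k_def using bound by (auto intro: GreatestI_nat Greatest_le_nat)
    have notP: "\<not> P (Suc k)" using bound Greatest_le_nat[of P "Suc k" "len w"] by (auto simp: k_def)
    from \<open>P k\<close> obtain v where v: "set v \<subseteq> I" "G (v @ alt_word s t k) = G w" "length v + k = len w"
      unfolding P_def by blast
    have altI: "set (alt_word s t j) \<subseteq> I" for j using set_alt_word[of s t j] t less.prems by auto
    have lenv: "len v = length v"
    proof -
      have "len w \<le> len v + k" using len_append_le[of v "alt_word s t k"] v altI len_cong[OF v(2)] by simp
      moreover have "len v \<le> length v" using v by (intro len_le) auto
      ultimately show ?thesis using v(3) by simp
    qed
    \<comment> \<open>\<open>c\<close> would be the next letter of the alternating word and
      \<open>d\<close> is its present first letter, so they are \<open>s\<close> and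
      \<open>t\<close> in some order. A descent of \<open>v\<close> at \<open>c\<close> would
      lengthen the alternating part; a descent at \<open>d\<close> would make \<open>w\<close>
      shorter than its length.\<close>
    define c where "c = (if even k then t else s)"
    define d where "d = (if even k then s else t)"
    have cI: "c \<in> I" "d \<in> I" using t less.prems by (auto simp: c_def d_def)
    have alts: "alt_word s t (Suc k) = c # alt_word s t k" by (simp add: c_def)
    have altk: "alt_word s t k = d # alt_word s t (k - 1)" using \<open>1 \<le> k\<close> by (cases k) (auto simp: d_def)
    have "len v \<le> len (v @ [c])"
    proof (rule ccontr)
      assume "\<not> ?thesis"
      then have less': "len (v @ [c]) < len v" by simp
      obtain u where u: "length u = len (v @ [c])" "set u \<subseteq> I" "G u = G (v @ [c])"
        using len_reduced[of "v @ [c]"] v cI by auto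
      have "G (u @ alt_word s t (Suc k)) = G ((v @ [c]) @ alt_word s t (Suc k))"
        using u v cI altI[of "Suc k"] by (intro G_append_cong) (simp_all del: alt_word.simps)
      also have "\<dots> = G w" using G_cancel[of v "alt_word s t k" c] v cI altI alts by simp
      finally have g: "G (u @ alt_word s t (Suc k)) = G w" .
      then have "len w \<le> length u + Suc k" using len_le[of "u @ alt_word s t (Suc k)" w] u altI[of "Suc k"] by simp
      then have "length u + Suc k = len w" using u less' lenv v(3) by simp
      with g u have "P (Suc k)" unfolding P_def by blast
      then show False using notP by simp
    qed
    moreover have "len v \<le> len (v @ [d])"
    proof (rule ccontr)
      assume "\<not> ?thesis"
      then have less': "len (v @ [d]) < len v" by simp
      have "len w \<le> len ((v @ [d]) @ alt_word s t (k - 1))" using altk len_cong[OF v(2)] by simp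
      also have "\<dots> \<le> len (v @ [d]) + (k - 1)" using len_append_le[of "v @ [d]" "alt_word s t (k - 1)"] v cI altI by simp
      also have "\<dots> < len w" using less' lenv v(3) \<open>1 \<le> k\<close> by simp
      finally show False by simp
    qed
    moreover have "len v < len w" using lenv v(3) \<open>1 \<le> k\<close> by simp
    ultimately have "pos (act v (\<alpha> c))" "pos (act v (\<alpha> d))" using less.hyps v(1) cI by blast+
    then have posv: "pos (act v (\<alpha> s))" "pos (act v (\<alpha> t))" by (auto simp: c_def d_def split: if_splits)
    have fin_case: ?thesis if "\<exists>x y::nat. act (alt_word s t k) (\<alpha> s) = real x *\<^sub>R \<alpha> s + real y *\<^sub>R \<alpha> t"
    proof -
      from that obtain x y :: nat where xy: "act (alt_word s t k) (\<alpha> s) = real x *\<^sub>R \<alpha> s + real y *\<^sub>R \<alpha> t" by blast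
      have "act w (\<alpha> s) = act v (act (alt_word s t k) (\<alpha> s))"
        using G_act[of "v @ alt_word s t k" w "\<alpha> s"] v altI less.prems by simp
      also have "\<dots> = real x *\<^sub>R act v (\<alpha> s) + real y *\<^sub>R act v (\<alpha> t)"
        using linear_act[OF v(1)] by (simp add: xy linear_add linear_scale)
      finally show ?thesis using posv by (simp add: pos_add pos_scale)
    qed
    obtain p q :: nat where pq: "\<beta> s (\<alpha> t) = - real p" "\<beta> t (\<alpha> s) = - real q"
      using offdiag[of s t] offdiag[of t s] t less.prems \<open>t \<noteq> s\<close> by metis
    have pq0: "p = 0 \<longleftrightarrow> q = 0" using zero[of s t] zero[of t s] pq t less.prems by auto
    show ?thesis
    proof (cases "p * q \<le> 3")
      case False
      then show ?thesis using act_alt_infinite[OF less.prems(2) t pq, of k] fin_case by auto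
    next
      case True
      define m where "m = braid_order (p * q)"
      show ?thesis
      proof (cases "k < m")
        case True
        then show ?thesis using act_alt_finite[OF less.prems(2) t pq \<open>p * q \<le> 3\<close> pq0, of k] fin_case by (auto simp: m_def)
      next
        \<comment> \<open>An alternating part at least as long as the braid order ends in one side
          of a braid relation; switching sides gives a reduced word ending in
          \<open>s\<close>.\<close>
        case False
        then obtain u where u: "set u \<subseteq> {s, t}" "length u = k - m" "alt_word s t k = u @ alt_word s t m"
          using alt_word_suffix[of m k s t] by auto
        have uI: "set u \<subseteq> I" using u t less.prems by auto
        have "m \<ge> 1" by (simp add: m_def braid_order_def)
        obtain z where z: "set z \<subseteq> {t, s}" "length z = m - 1" "alt_word t s m = z @ [s]"
          using alt_word_suffix[OF \<open>m \<ge> 1\<close>, of t s] by auto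
        have altI': "set (alt_word t s m) \<subseteq> I" using set_alt_word[of t s m] t less.prems by auto
        have "G (v @ u @ alt_word s t m) = G (v @ u @ alt_word t s m)"
          using G_cong[OF altI[of m] altI' _, of "v @ u" "[]"] G_braid[OF less.prems(2) t \<open>t \<noteq> s\<close>[symmetric] pq \<open>p * q \<le> 3\<close>] v uI
          by (simp add: m_def)
        then have "G ((v @ u @ z) @ [s]) = G w" using v(2) u(3) z(3) by simp
        moreover have "set (v @ u @ z) \<subseteq> I" using v uI z t less.prems by auto
        moreover have "length (v @ u @ z) < len w" using u z v(3) False \<open>m \<ge> 1\<close> by simp
        ultimately show ?thesis using shorter by blast
      qed
    qed
  qed
qed

lemma act_simple_neg:
  assumes "set w \<subseteq> I" "s \<in> I" "len (w @ [s]) < len w"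
  shows "pos (- act w (\<alpha> s))"
proof -
  have "G ((w @ [s]) @ [s]) = G w" using G_cancel[of w "[]" s] assms by simp
  then have "len (w @ [s]) \<le> len ((w @ [s]) @ [s])" using len_cong assms(3) by (metis less_imp_le)
  then have "pos (act (w @ [s]) (\<alpha> s))" using assms by (intro act_simple_pos) auto
  then show ?thesis using assms linear_act by (simp add: ref_self linear_neg)
qed

lemma act_pos_or_neg: "set w \<subseteq> I \<Longrightarrow> s \<in> I \<Longrightarrow> pos (act w (\<alpha> s)) \<or> pos (- act w (\<alpha> s))"
  using act_simple_pos act_simple_neg by (meson leI)

lemma act_pos_iff: "set w \<subseteq> I \<Longrightarrow> s \<in> I \<Longrightarrow> pos (act w (\<alpha> s)) \<longleftrightarrow> len w \<le> len (w @ [s])"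
  using act_simple_pos act_simple_neg act_not_pos_neg by (meson leI)

text \<open>If a reduced word ends in \<open>t\<close>, its action makes the simple vector of
  \<open>t\<close> negative. Fixing all simple vectors leaves only the empty word, so the
  representation is faithful relative to \<open>G\<close>.\<close>

lemma G_trivial_if_fixes:
  assumes w: "set w \<subseteq> I" and fixes_simple: "\<And>i. i \<in> I \<Longrightarrow> act w (\<alpha> i) = \<alpha> i"
  shows "G w = G []"
proof -
  obtain r where r: "length r = len w" "set r \<subseteq> I" "G r = G w" using len_reduced w by blast
  show ?thesis
  proof (cases r rule: rev_cases)
    case (snoc r' t)
    then have rt: "set r' \<subseteq> I" "t \<in> I" using r by auto
    have "G (w @ [t]) = G (r @ [t])" using r w rt by (intro G_append_cong) auto
    also have "\<dots> = G r'" using snoc G_cancel[of r' "[]" t] rt by simp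
    finally have "len (w @ [t]) \<le> length r'" using rt by (intro len_le) auto
    then have "len (w @ [t]) < len w" using r snoc by simp
    then have False using act_pos_iff[OF w rt(2)] fixes_simple[OF rt(2)] pos_simple[OF rt(2)] by simp
    then show ?thesis ..
  qed (use r in simp)
qed

text \<open>The word below acts as a transvection \<open>v \<mapsto> v + \<lambda>(v) \<alpha>\<^sub>j\<close> with \<open>\<lambda>(\<alpha>\<^sub>j) = 0\<close>. Both it and its
  inverse map simple roots to positive or negative roots, and this forces \<open>\<lambda>\<close> to vanish on them.\<close>

lemma G_conjugate_reflection:
  assumes w: "set w \<subseteq> I" and i: "i \<in> I" and j: "j \<in> I" and eq: "act w (\<alpha> i) = \<alpha> j"
  shows "G (j # w @ i # rev w) = G []"
proof (rule G_trivial_if_fixes)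
  let ?u = "j # w @ i # rev w"
  show uI: "set ?u \<subseteq> I" using w i j by auto
  have uI': "set (rev ?u) \<subseteq> I" using uI by simp
  have revj: "act (rev w) (\<alpha> j) = \<alpha> i" using act_rev'[OF w, of "\<alpha> i"] eq by simp
  define l where "l v = \<beta> i (act (rev w) v) - \<beta> j v" for v
  have lin_l: "linear l" unfolding l_def[abs_def]
    using linear_compose[OF linear_act[of "rev w"] lin[OF i]] w
    by (intro linear_compose_sub lin[OF j]) (simp add: o_def)
  have lj: "l (\<alpha> j) = 0" by (simp add: l_def revj diag i j)
  have inner: "act (w @ i # rev w) v = v - \<beta> i (act (rev w) v) *\<^sub>R \<alpha> j" for v
  proof -
    have "act (w @ i # rev w) v = act w (act (rev w) v - \<beta> i (act (rev w) v) *\<^sub>R \<alpha> i)" by (simp add: ref_def)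
    also have "\<dots> = act w (act (rev w) v) - \<beta> i (act (rev w) v) *\<^sub>R \<alpha> j"
      using linear_act[OF w] eq by (simp add: linear_diff linear_scale)
    finally show ?thesis using act_rev[OF w] by simp
  qed
  have u: "act ?u v = v + l v *\<^sub>R \<alpha> j" for v
  proof -
    let ?x = "\<beta> i (act (rev w) v)"
    have "act ?u v = ref j (v - ?x *\<^sub>R \<alpha> j)" by (simp only: act_Cons inner)
    also have "\<dots> = v - (?x *\<^sub>R \<alpha> j + (\<beta> j v - 2 * ?x) *\<^sub>R \<alpha> j)"
      using lin[OF j] by (simp add: ref_def linear_diff linear_scale diag j)
    also have "\<dots> = v + l v *\<^sub>R \<alpha> j"
    proof -
      have "?x *\<^sub>R \<alpha> j + (\<beta> j v - 2 * ?x) *\<^sub>R \<alpha> j = (- l v) *\<^sub>R \<alpha> j"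
        by (simp add: l_def flip: scaleR_add_left)
      then show ?thesis by simp
    qed
    finally show ?thesis .
  qed
  have u': "act (rev ?u) v = v - l v *\<^sub>R \<alpha> j" for v
  proof -
    have "act (rev ?u) (v + l v *\<^sub>R \<alpha> j) = v" for v using act_rev'[OF uI, of v] unfolding u .
    from this[of "v - l v *\<^sub>R \<alpha> j"] show ?thesis using lin_l by (simp add: linear_diff linear_scale lj)
  qed
  \<comment> \<open>The coefficient 1 of \<open>\<alpha> k\<close> rules out the negative sign, so
    the dichotomy becomes a condition on the coefficient of \<open>\<alpha> j\<close>.\<close>
  have nonneg: "c \<ge> 0" if k: "k \<in> I" "k \<noteq> j" and or: "pos (\<alpha> k + c *\<^sub>R \<alpha> j) \<or> pos (- (\<alpha> k + c *\<^sub>R \<alpha> j))" for k c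
  proof -
    have e: "\<alpha> k + c *\<^sub>R \<alpha> j = (\<Sum>i\<in>I. (if i = k then 1 else if i = j then c else 0) *\<^sub>R \<alpha> i)"
    proof -
      have "(\<Sum>i\<in>I. (if i = k then 1 else if i = j then c else 0) *\<^sub>R \<alpha> i) =
        (\<Sum>i\<in>I. (if i = k then \<alpha> k else 0) + (if i = j then c *\<^sub>R \<alpha> j else 0))"
        using k by (intro sum.cong) auto
      then show ?thesis using k j fin by (simp add: sum.distrib)
    qed
    show ?thesis using or
    proof
      assume "pos (\<alpha> k + c *\<^sub>R \<alpha> j)"
      then obtain n :: "'a \<Rightarrow> nat" where n: "\<alpha> k + c *\<^sub>R \<alpha> j = (\<Sum>i\<in>I. real (n i) *\<^sub>R \<alpha> i)" unfolding pos_def by blast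
      show ?thesis using coeff_unique[OF trans[OF e[symmetric] n] j] k by auto
    next
      assume "pos (- (\<alpha> k + c *\<^sub>R \<alpha> j))"
      then obtain n :: "'a \<Rightarrow> nat" where n: "- (\<alpha> k + c *\<^sub>R \<alpha> j) = (\<Sum>i\<in>I. real (n i) *\<^sub>R \<alpha> i)" unfolding pos_def by blast
      then have "\<alpha> k + c *\<^sub>R \<alpha> j = (\<Sum>i\<in>I. (- real (n i)) *\<^sub>R \<alpha> i)"
        by (simp only: scaleR_minus_left sum_negf n[symmetric] minus_minus)
      from coeff_unique[OF trans[OF e[symmetric] this] k(1)] show ?thesis by simp
    qed
  qed
  fix k assume k: "k \<in> I"
  show "act ?u (\<alpha> k) = \<alpha> k"
  proof (cases "k = j")
    case False
    have "l (\<alpha> k) \<ge> 0" using act_pos_or_neg[OF uI k] k False unfolding u by (intro nonneg) auto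
    moreover have "- l (\<alpha> k) \<ge> 0" using act_pos_or_neg[OF uI' k] k False unfolding u' by (intro nonneg) auto
    ultimately show ?thesis unfolding u by simp
  qed (simp add: u lj del: act_Cons)
qed

end

section \<open>Real roots and coroots\<close>

context refl_rep
begin

lemma len_rev_le:
  assumes G_rev: "\<And>us ws. set us \<subseteq> I \<Longrightarrow> set ws \<subseteq> I \<Longrightarrow> G us = G ws \<Longrightarrow> G (rev us) = G (rev ws)" and w: "set w \<subseteq> I"
  shows "len (rev w) \<le> len w"
proof -
  obtain r where r: "length r = len w" "set r \<subseteq> I" "G r = G w" using len_reduced[OF w] by blast
  then have "len (rev w) \<le> length (rev r)" using G_rev[of r w] w by (intro len_le) auto
  then show ?thesis using r by simp
qed

end

context kac_moody_root_system
begin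

lemma pairing_nat:
  assumes "a \<in> \<Delta>" "b \<in> \<Delta>" "a \<noteq> b"
  shows "\<exists>n::nat. blinfun_apply (co b) a = - real n"
proof -
  obtain z :: int where z: "blinfun_apply (co b) a = of_int z"
    using pairing_off_diag[OF assms] by (auto elim: Ints_cases)
  then have "z \<le> 0" using pairing_off_diag[OF assms] by simp
  then show ?thesis using z by (intro exI[of _ "nat (- z)"]) simp
qed

sublocale V: refl_data \<Delta> "\<lambda>a. a" "\<lambda>a. blinfun_apply (co a)"
proof (rule refl_data.intro)
  show "linear (blinfun_apply (co i))" for i
    using blinfun.bounded_linear_right bounded_linear.linear by blast
qed (use finite_simple independent_simple pairing_diag pairing_nat pairing_zero in auto)

lemma ref_eq: "V.ref a = simple_reflection co a"
  by (rule ext) (simp add: V.ref_def simple_reflection_def)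

lemma act_eq: "V.act ws = foldr (\<lambda>a u. simple_reflection co a \<circ> u) ws id"
  by (simp add: V.act_def ref_eq)

sublocale V: refl_rep \<Delta> "\<lambda>a. a" "\<lambda>a. blinfun_apply (co a)" V.act
proof
  show "V.act (xs @ us @ ys) = V.act (xs @ ws @ ys)"
    if "set us \<subseteq> \<Delta>" "set ws \<subseteq> \<Delta>" "V.act us = V.act ws" "set xs \<subseteq> \<Delta>" "set ys \<subseteq> \<Delta>" for us ws xs ys
    using that by (intro ext) simp
  show "V.act [i, i] = V.act []" if "i \<in> \<Delta>" for i
    using that by (intro ext) (simp add: V.ref_ref)
  show "V.act (alt_word s t (braid_order (p * q))) = V.act (alt_word t s (braid_order (p * q)))"
    if st: "s \<in> \<Delta>" "t \<in> \<Delta>" "s \<noteq> t" and pq: "blinfun_apply (co s) t = - real p" "blinfun_apply (co t) s = - real q" "p * q \<le> 3"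
    for s t and p q :: nat
  proof (rule ext, rule V.act_braid[OF st(1,2) pq])
    show "p = 0 \<longleftrightarrow> q = 0" using pairing_zero[of s t] pairing_zero[of t s] st pq by auto
  qed
qed auto

sublocale D: refl_data \<Delta> co "\<lambda>a l. blinfun_apply l a"
proof (rule refl_data.intro)
  show "linear (\<lambda>l. blinfun_apply l a)" for a :: 'v
    using blinfun.bounded_linear_left bounded_linear.linear by blast
qed (use finite_simple independent_co inj_co pairing_diag pairing_nat pairing_zero in auto)

lemma bounded_linear_ref: "bounded_linear (V.ref a)"
  unfolding V.ref_def[abs_def]
  by (intro bounded_linear_sub bounded_linear_ident bounded_linear_scaleR_const blinfun.bounded_linear_right)

lemma bounded_linear_act: "bounded_linear (V.act ws)"
proof (induction ws)
  case Nil
  then show ?case by (simp add: V.act_def id_def bounded_linear_ident)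
next
  case (Cons a ws)
  have "V.act (a # ws) = (\<lambda>v. V.ref a (V.act ws v))" by (rule ext) simp
  then show ?case using bounded_linear_compose[OF bounded_linear_ref Cons] by simp
qed

lemma D_act_apply: "blinfun_apply (D.act ws l) v = blinfun_apply l (V.act (rev ws) v)"
proof (induction ws arbitrary: v)
  case (Cons a ws)
  have "V.act (rev ws) (V.ref a v) = V.act (rev ws) v - blinfun_apply (co a) v *\<^sub>R V.act (rev ws) a"
    using bounded_linear.linear[OF bounded_linear_act] by (simp add: V.ref_def linear_diff linear_scale)
  then show ?case using Cons[of v] Cons[of a] by (simp add: D.ref_def blinfun.bilinear_simps)
qed simp

lemma act_rev_cong:
  assumes "set us \<subseteq> \<Delta>" "set ws \<subseteq> \<Delta>" "V.act us = V.act ws"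
  shows "V.act (rev us) = V.act (rev ws)"
proof
  fix v
  have "V.act (rev us) v = V.act (rev us) (V.act ws (V.act (rev ws) v))" using V.act_rev assms by simp
  also have "\<dots> = V.act (rev ws) v" unfolding assms(3)[symmetric] using V.act_rev' assms(1) by simp
  finally show "V.act (rev us) v = V.act (rev ws) v" .
qed

text \<open>The word map stays \<open>V.act\<close>: acting trivially on simple coroots then yields
  a relation in the Weyl group itself, and the two length functions coincide.\<close>

sublocale D: refl_rep \<Delta> co "\<lambda>a l. blinfun_apply l a" V.act
proof
  show "D.act us l = D.act ws l" if "set us \<subseteq> \<Delta>" "set ws \<subseteq> \<Delta>" "V.act us = V.act ws" for us ws l
    using act_rev_cong[OF that] by (intro blinfun_eqI) (simp add: D_act_apply)
  show "V.act (alt_word s t (braid_order (p * q))) = V.act (alt_word t s (braid_order (p * q)))"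
    if st: "s \<in> \<Delta>" "t \<in> \<Delta>" "s \<noteq> t" and pq: "blinfun_apply (co t) s = - real p" "blinfun_apply (co s) t = - real q" "p * q \<le> 3"
    for s t and p q :: nat
    using V.G_braid[OF st pq(2,1)] pq(3) by (simp add: mult.commute)
  show "V.act (xs @ us @ ys) = V.act (xs @ ws @ ys)"
    if "set us \<subseteq> \<Delta>" "set ws \<subseteq> \<Delta>" "V.act us = V.act ws" "set xs \<subseteq> \<Delta>" "set ys \<subseteq> \<Delta>" for us ws xs ys
    using that by (intro ext) simp
  show "V.act [i, i] = V.act []" if "i \<in> \<Delta>" for i
    by (rule V.G_sq[OF that])
qed

lemma V_len_rev:
  assumes "set w \<subseteq> \<Delta>" shows "V.len (rev w) = V.len w"
proof (rule antisym)
  have le: "V.len (rev u) \<le> V.len u" if "set u \<subseteq> \<Delta>" for u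
    by (rule V.len_rev_le) (fact act_rev_cong, fact that)
  from le[OF assms] show "V.len (rev w) \<le> V.len w" .
  from le[of "rev w"] assms show "V.len w \<le> V.len (rev w)" by simp
qed

section \<open>The Weyl group in terms of words\<close>

abbreviation W where "W \<equiv> weyl_group \<Delta> co"

lemma act_in_W: "set ws \<subseteq> \<Delta> \<Longrightarrow> V.act ws \<in> W"
proof (induction ws)
  case (Cons a ws)
  then have "simple_reflection co a \<circ> V.act ws \<in> W" by (intro weyl_comp weyl_gen) auto
  then show ?case by (simp add: act_eq o_def)
qed (simp add: weyl_id)

lemma inv_act: "set ws \<subseteq> \<Delta> \<Longrightarrow> inv (V.act ws) = V.act (rev ws)"
  by (rule inv_unique_comp) (auto simp: V.act_rev V.act_rev')

lemma W_word: "w \<in> W \<Longrightarrow> \<exists>ws. set ws \<subseteq> \<Delta> \<and> w = V.act ws"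
proof (induction rule: weyl_group.induct)
  case weyl_id
  then show ?case by (intro exI[of _ "[]"]) simp
next
  case (weyl_gen a)
  then show ?case by (intro exI[of _ "[a]"]) (simp add: act_eq)
next
  case (weyl_comp u w)
  then obtain us ws where "set us \<subseteq> \<Delta>" "u = V.act us" "set ws \<subseteq> \<Delta>" "w = V.act ws" by blast
  then show ?case by (intro exI[of _ "us @ ws"]) auto
next
  case (weyl_inv w)
  then obtain ws where "set ws \<subseteq> \<Delta>" "w = V.act ws" by blast
  then show ?case using inv_act by (intro exI[of _ "rev ws"]) auto
qed

lemma weyl_length_act: "weyl_length \<Delta> co (V.act ws) = V.len ws"
  unfolding weyl_length_def V.len_def act_eq by (rule arg_cong[where f = Least]) (auto simp: eq_commute)

lemma bounded_linear_W: "w \<in> W \<Longrightarrow> bounded_linear w"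
  using W_word bounded_linear_act by blast

lemma W_bij: "w \<in> W \<Longrightarrow> bij w"
  using W_word V.act_rev V.act_rev' by (metis bijI')

lemma W_inv_apply: "w \<in> W \<Longrightarrow> inv w (w v) = v" "w \<in> W \<Longrightarrow> w (inv w v) = v"
  using W_bij by (auto simp: bij_def surj_f_inv_f)

lemma dual_action_act: "set ws \<subseteq> \<Delta> \<Longrightarrow> dual_action (V.act ws) l = D.act ws l"
  unfolding dual_action_def
  by (simp add: inv_act flip: D_act_apply) (simp add: blinfun_apply_inverse)

lemma dual_action_apply: "w \<in> W \<Longrightarrow> blinfun_apply (dual_action w l) v = blinfun_apply l (inv w v)"
  using W_word[of w] by (auto simp: dual_action_act D_act_apply inv_act)

text \<open>The relation says that conjugating the reflection in \<open>b\<close> by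
  \<open>x\<close> gives the reflection in \<open>c\<close>. Equating the displacements of the two
  reflections gives an identity of rank-one operators that links roots to coroots.\<close>

lemma conjugate_reflection:
  assumes x: "set x \<subseteq> \<Delta>" and b: "b \<in> \<Delta>" "c \<in> \<Delta>" and G: "V.act (c # x @ b # rev x) = V.act []"
  shows "blinfun_apply (D.act x (co b)) v *\<^sub>R V.act x b = blinfun_apply (co c) v *\<^sub>R c"
proof -
  have "V.ref c (V.act (x @ b # rev x) v) = v" using fun_cong[OF G, of v] by simp
  then have "V.act (x @ b # rev x) v = V.ref c v" using V.ref_ref[OF b(2)] by metis
  moreover have "V.act (x @ b # rev x) v = V.act x (V.act (rev x) v - blinfun_apply (co b) (V.act (rev x) v) *\<^sub>R b)"
    by (simp add: V.ref_def)
  moreover have "\<dots> = v - blinfun_apply (D.act x (co b)) v *\<^sub>R V.act x b"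
    using V.linear_act[OF x] V.act_rev[OF x] by (simp add: linear_diff linear_scale D_act_apply)
  ultimately show ?thesis by (simp add: V.ref_def)
qed

text \<open>Either equality implies the same relation between reflections, which then yields the
  other one: cancel the nonzero vector \<open>c\<close> in one direction, evaluate at
  \<open>c\<close>, where its coroot is 2, in the other.\<close>

lemma act_simple_iff:
  assumes x: "set x \<subseteq> \<Delta>" and b: "b \<in> \<Delta>" "c \<in> \<Delta>"
  shows "V.act x b = c \<longleftrightarrow> D.act x (co b) = co c"
proof
  assume eq: "V.act x b = c"
  show "D.act x (co b) = co c"
    using conjugate_reflection[OF x b V.G_conjugate_reflection[OF x b eq]] V.simple_nonzero[OF b(2)]
    by (intro blinfun_eqI) (simp add: eq)
next
  assume eq: "D.act x (co b) = co c"
  show "V.act x b = c"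
    using conjugate_reflection[OF x b D.G_conjugate_reflection[OF x b eq], of c] pairing_diag[OF b(2)]
    by (simp add: eq)
qed

text \<open>One direction makes the coroot of a real root independent of how the root is written;
  the other makes distinct real roots have distinct coroots.\<close>

lemma act_root_iff:
  assumes "set us \<subseteq> \<Delta>" "set ws \<subseteq> \<Delta>" "b \<in> \<Delta>" "c \<in> \<Delta>"
  shows "V.act us b = V.act ws c \<longleftrightarrow> D.act us (co b) = D.act ws (co c)"
proof -
  have "V.act us b = V.act ws c \<longleftrightarrow> V.act (rev ws @ us) b = c"
    unfolding V.act_append using V.act_rev[OF assms(2)] V.act_rev'[OF assms(2)] by metis
  also have "\<dots> \<longleftrightarrow> D.act (rev ws @ us) (co b) = co c" using assms by (intro act_simple_iff) auto
  also have "\<dots> \<longleftrightarrow> D.act us (co b) = D.act ws (co c)"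
    unfolding D.act_append using D.act_rev[OF assms(2)] D.act_rev'[OF assms(2)] by metis
  finally show ?thesis .
qed

section \<open>Real roots: signs, integrality and proportionality\<close>

abbreviation R where "R \<equiv> real_roots \<Delta> co"
abbreviation Rp where "Rp \<equiv> pos_real_roots \<Delta> co"
abbreviation cr where "cr \<equiv> coroot \<Delta> co"

lemma real_root_word: "a \<in> R \<Longrightarrow> \<exists>ws b. set ws \<subseteq> \<Delta> \<and> b \<in> \<Delta> \<and> a = V.act ws b"
  unfolding real_roots_def using W_word by blast

lemma act_in_R: "set ws \<subseteq> \<Delta> \<Longrightarrow> b \<in> \<Delta> \<Longrightarrow> V.act ws b \<in> R"
  unfolding real_roots_def using act_in_W by blast

lemma coroot_act: "set ws \<subseteq> \<Delta> \<Longrightarrow> b \<in> \<Delta> \<Longrightarrow> cr (V.act ws b) = D.act ws (co b)"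
  unfolding coroot_def
proof (rule the_equality)
  assume ws: "set ws \<subseteq> \<Delta>" "b \<in> \<Delta>"
  then show "\<exists>w\<in>W. \<exists>c\<in>\<Delta>. V.act ws b = w c \<and> D.act ws (co b) = dual_action w (co c)"
    using act_in_W dual_action_act by metis
  fix l assume "\<exists>w\<in>W. \<exists>c\<in>\<Delta>. V.act ws b = w c \<and> l = dual_action w (co c)"
  then obtain w c where w: "w \<in> W" "c \<in> \<Delta>" "V.act ws b = w c" "l = dual_action w (co c)" by blast
  obtain us where us: "set us \<subseteq> \<Delta>" "w = V.act us" using W_word w by blast
  show "l = D.act ws (co b)" using act_root_iff[OF ws(1) us(1) ws(2) w(2)] w us dual_action_act by simp
qed

lemma coroot_inj: "a \<in> R \<Longrightarrow> b \<in> R \<Longrightarrow> cr a = cr b \<Longrightarrow> a = b"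
  using real_root_word[of a] real_root_word[of b] coroot_act act_root_iff by metis

lemma W_root: "w \<in> W \<Longrightarrow> a \<in> R \<Longrightarrow> w a \<in> R"
proof -
  assume "w \<in> W" "a \<in> R"
  then obtain us ws b where "set us \<subseteq> \<Delta>" "w = V.act us" "set ws \<subseteq> \<Delta>" "b \<in> \<Delta>" "a = V.act ws b"
    using W_word real_root_word by meson
  then show ?thesis using act_in_R[of "us @ ws" b] by simp
qed

lemma coroot_W: "w \<in> W \<Longrightarrow> a \<in> R \<Longrightarrow> cr (w a) = dual_action w (cr a)"
proof -
  assume "w \<in> W" "a \<in> R"
  then obtain us ws b where w: "set us \<subseteq> \<Delta>" "w = V.act us" "set ws \<subseteq> \<Delta>" "b \<in> \<Delta>" "a = V.act ws b"
    using W_word real_root_word by meson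
  have "cr (w a) = cr (V.act (us @ ws) b)" by (simp add: w)
  also have "\<dots> = dual_action w (cr a)"
    using coroot_act[of "us @ ws" b] w by (simp add: coroot_act dual_action_act del: V.act_append)
  finally show ?thesis .
qed

lemma coroot_W_apply: "w \<in> W \<Longrightarrow> a \<in> R \<Longrightarrow> blinfun_apply (cr (w a)) (w v) = blinfun_apply (cr a) v"
  by (simp add: coroot_W dual_action_apply W_inv_apply(1))

lemma Rp_iff: "a \<in> Rp \<longleftrightarrow> a \<in> R \<and> V.pos a"
  by (simp add: pos_real_roots_def V.pos_def)

lemma Rp_R: "a \<in> Rp \<Longrightarrow> a \<in> R" by (simp add: Rp_iff)

lemma root_minus: "a \<in> R \<Longrightarrow> - a \<in> R \<and> cr (- a) = - cr a"
proof -
  assume "a \<in> R"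
  then obtain ws b where w: "set ws \<subseteq> \<Delta>" "b \<in> \<Delta>" "a = V.act ws b" using real_root_word by blast
  have "- a = V.act (ws @ [b]) b" using w V.linear_act[OF w(1)] by (simp add: V.ref_self linear_neg)
  moreover have "- cr a = D.act (ws @ [b]) (co b)"
    using w D.linear_act[OF w(1)] by (simp add: coroot_act D.ref_self linear_neg)
  ultimately show ?thesis using act_in_R[of "ws @ [b]" b] coroot_act[of "ws @ [b]" b] w by simp
qed

lemma root_nonzero: "a \<in> R \<Longrightarrow> a \<noteq> 0"
proof -
  assume "a \<in> R"
  then obtain ws b where w: "set ws \<subseteq> \<Delta>" "b \<in> \<Delta>" "a = V.act ws b" using real_root_word by blast
  show ?thesis unfolding w(3) by (rule V.act_nonzero[OF w(1) V.simple_nonzero[OF w(2)]])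
qed

lemma root_pos_or_neg: "a \<in> R \<Longrightarrow> a \<in> Rp \<or> - a \<in> Rp"
proof -
  assume a: "a \<in> R"
  then obtain ws b where w: "set ws \<subseteq> \<Delta>" "b \<in> \<Delta>" "a = V.act ws b" using real_root_word by blast
  then show ?thesis using V.act_pos_or_neg[OF w(1,2)] root_minus[OF a] a unfolding Rp_iff by simp
qed

lemma not_pos_neg: "a \<in> Rp \<Longrightarrow> - a \<notin> Rp"
  unfolding Rp_iff using V.pos_neg_zero[of a] root_nonzero[of a] by blast

lemma Rp_neg_iff: "a \<in> R \<Longrightarrow> - a \<in> Rp \<longleftrightarrow> a \<notin> Rp"
  using root_pos_or_neg not_pos_neg by blast

text \<open>The signs of a root and of its coroot are decided by the same comparison of
  lengths.\<close>

lemma coroot_pos: "a \<in> Rp \<Longrightarrow> D.pos (cr a)"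
proof -
  assume a: "a \<in> Rp"
  then obtain ws b where w: "set ws \<subseteq> \<Delta>" "b \<in> \<Delta>" "a = V.act ws b" using real_root_word Rp_R by blast
  have "V.pos (V.act ws b)" using a w(3) Rp_iff by blast
  then have "V.len ws \<le> V.len (ws @ [b])" using V.act_pos_iff[OF w(1,2)] by blast
  then have "D.pos (D.act ws (co b))" by (intro D.act_simple_pos w(1,2))
  then show ?thesis using coroot_act[OF w(1,2)] w(3) by simp
qed

lemma coroot_diag: "a \<in> R \<Longrightarrow> blinfun_apply (cr a) a = 2"
proof -
  assume "a \<in> R"
  then obtain ws b where w: "set ws \<subseteq> \<Delta>" "b \<in> \<Delta>" "a = V.act ws b" using real_root_word by blast
  then show ?thesis using V.act_rev' by (simp add: coroot_act D_act_apply pairing_diag)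
qed

lemma coroot_nonzero: "a \<in> R \<Longrightarrow> cr a \<noteq> 0"
proof
  assume "a \<in> R" and 0: "cr a = 0"
  then have "blinfun_apply (cr a) a = 2" by (intro coroot_diag)
  then show False unfolding 0 blinfun.zero_left by simp
qed

lemma D_pos_pairing_int:
  assumes "D.pos l" "V.pos a"
  shows "blinfun_apply l a \<in> \<int>"
proof -
  obtain c d :: "'v \<Rightarrow> nat" where c: "l = (\<Sum>i\<in>\<Delta>. real (c i) *\<^sub>R co i)" and d: "a = (\<Sum>i\<in>\<Delta>. real (d i) *\<^sub>R i)"
    using assms unfolding D.pos_def V.pos_def by blast
  have int: "blinfun_apply (co i) j \<in> \<int>" if "i \<in> \<Delta>" "j \<in> \<Delta>" for i j
    using that pairing_diag[of i] pairing_off_diag[of j i] by (cases "i = j") auto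
  have "blinfun_apply l a = (\<Sum>j\<in>\<Delta>. \<Sum>i\<in>\<Delta>. real (d j) * (real (c i) * blinfun_apply (co i) j))"
    by (simp add: c d blinfun.sum_left blinfun.sum_right blinfun.scaleR_left blinfun.scaleR_right sum_distrib_left)
  also have "\<dots> \<in> \<int>" by (intro Ints_sum Ints_mult int) auto
  finally show ?thesis .
qed

text \<open>Integrality makes the exponentials, and hence the sum, invariant under translation by
  real roots.\<close>

lemma root_pairing_int: "a \<in> R \<Longrightarrow> b \<in> R \<Longrightarrow> blinfun_apply (cr b) a \<in> \<int>"
proof -
  assume ab: "a \<in> R" "b \<in> R"
  have "\<exists>a'. (a' = a \<or> a' = - a) \<and> a' \<in> Rp" "\<exists>b'. (b' = b \<or> b' = - b) \<and> b' \<in> Rp" using ab root_pos_or_neg by blast+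
  then obtain a' b' where "a' = a \<or> a' = - a" "a' \<in> Rp" "b' = b \<or> b' = - b" "b' \<in> Rp" by blast
  moreover from this have "blinfun_apply (cr b') a' \<in> \<int>" by (intro D_pos_pairing_int coroot_pos) (auto simp: Rp_iff)
  ultimately show ?thesis using root_minus[OF ab(2)] by (auto simp: blinfun.bilinear_simps)
qed

lemma reflection_in_W: "a \<in> R \<Longrightarrow> (\<lambda>v. v - blinfun_apply (cr a) v *\<^sub>R a) \<in> W"
proof -
  assume "a \<in> R"
  then obtain ws b where w: "set ws \<subseteq> \<Delta>" "b \<in> \<Delta>" "a = V.act ws b" using real_root_word by blast
  have "V.act (ws @ b # rev ws) v = v - blinfun_apply (cr a) v *\<^sub>R a" for v
  proof -
    have "V.act (ws @ b # rev ws) v = V.act ws (V.act (rev ws) v - blinfun_apply (co b) (V.act (rev ws) v) *\<^sub>R b)"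
      by (simp add: V.ref_def)
    then show ?thesis using w V.linear_act[OF w(1)] V.act_rev[OF w(1)]
      by (simp add: linear_diff linear_scale D_act_apply coroot_act)
  qed
  then have "(\<lambda>v. v - blinfun_apply (cr a) v *\<^sub>R a) = V.act (ws @ b # rev ws)" by (intro ext) simp
  moreover have "V.act (ws @ b # rev ws) \<in> W" using w by (intro act_in_W) auto
  ultimately show ?thesis by simp
qed

lemma D_multiple_int:
  assumes b: "b \<in> \<Delta>" and "D.pos (c *\<^sub>R co b) \<or> D.pos (- (c *\<^sub>R co b))"
  shows "c \<in> \<int>"
proof -
  have e: "x *\<^sub>R co b = (\<Sum>i\<in>\<Delta>. (if i = b then x else 0) *\<^sub>R co i)" for x
    using b finite_simple by (simp add: if_distrib[of "\<lambda>x. x *\<^sub>R _"] cong: if_cong)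
  have "x \<in> \<int>" if "D.pos (x *\<^sub>R co b)" for x
  proof -
    from that obtain n :: "'v \<Rightarrow> nat" where "x *\<^sub>R co b = (\<Sum>i\<in>\<Delta>. real (n i) *\<^sub>R co i)" unfolding D.pos_def by blast
    from D.coeff_unique[OF trans[OF e[symmetric] this] b] show ?thesis by simp
  qed
  from this[of c] this[of "- c"] assms(2) show ?thesis by auto
qed

text \<open>After moving \<open>a\<close> to a simple root, the other coroot is \<open>c\<close>
  times a simple coroot and, up to sign, a natural combination of simple coroots; independence makes
  \<open>c\<close> an integer.\<close>

lemma coroot_multiple_int:
  assumes "a \<in> R" "b \<in> R" "cr b = c *\<^sub>R cr a"
  shows "c \<in> \<int>"
proof -
  obtain ws d where w: "set ws \<subseteq> \<Delta>" "d \<in> \<Delta>" "a = V.act ws d" using real_root_word assms(1) by blast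
  define b' where "b' = V.act (rev ws) b"
  have b': "b' \<in> R" unfolding b'_def by (rule W_root[OF act_in_W assms(2)]) (use w in simp)
  have "cr b' = D.act (rev ws) (cr b)"
    unfolding b'_def using coroot_W[OF act_in_W assms(2)] w dual_action_act by simp
  also have "\<dots> = c *\<^sub>R co d"
    using w D.linear_act[of "rev ws"] D.act_rev'[OF w(1)] by (simp add: assms(3) linear_scale coroot_act)
  finally have "cr b' = c *\<^sub>R co d" .
  moreover have "D.pos (cr b') \<or> D.pos (- cr b')"
    using root_pos_or_neg[OF b'] coroot_pos root_minus[OF b'] by metis
  ultimately show ?thesis using D_multiple_int[OF w(2), of c] by simp
qed

text \<open>The factor and its inverse would both be integers, hence 1 or -1: the first gives equal
  roots, the second opposite ones, which cannot both be positive.\<close>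

lemma coroot_not_proportional:
  assumes "a \<in> Rp" "b \<in> Rp" "a \<noteq> b"
  shows "cr b \<noteq> c *\<^sub>R cr a"
proof
  assume eq: "cr b = c *\<^sub>R cr a"
  have R: "a \<in> R" "b \<in> R" using assms Rp_R by auto
  have c0: "c \<noteq> 0" using eq coroot_nonzero[OF R(2)] by auto
  then have eq': "cr a = inverse c *\<^sub>R cr b" using eq by simp
  obtain m n :: int where m: "c = of_int m" and n: "inverse c = of_int n"
    using coroot_multiple_int[OF R eq] coroot_multiple_int[OF R(2,1) eq'] by (auto elim!: Ints_cases)
  have "real_of_int (m * n) = 1" using c0 unfolding of_int_mult m[symmetric] n[symmetric] by simp
  then have "m * n = 1" by linarith
  then have "m = 1 \<or> m = - 1" by (rule pos_zmult_eq_1_iff_lemma)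
  then show False
  proof
    assume "m = 1"
    then show False using eq m coroot_inj[OF R(2,1)] assms by simp
  next
    assume "m = - 1"
    then have "cr b = cr (- a)" using eq m root_minus[OF R(1)] by simp
    then have "b = - a" using coroot_inj[OF R(2)] root_minus[OF R(1)] by blast
    then show False using assms not_pos_neg by blast
  qed
qed

section \<open>Inversion sets and length\<close>

lemma multiple_of_simple:
  assumes "b \<in> \<Delta>" "c *\<^sub>R b \<in> Rp"
  shows "c *\<^sub>R b = b"
proof (rule ccontr)
  assume ne: "c *\<^sub>R b \<noteq> b"
  have bR: "b \<in> Rp" using act_in_R[of "[]" b] V.pos_simple assms by (simp add: Rp_iff)
  define s where "s v = v - blinfun_apply (cr (c *\<^sub>R b)) v *\<^sub>R (c *\<^sub>R b)" for v
  have cb: "c *\<^sub>R b \<in> R" using assms Rp_R by blast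
  then have sW: "s \<in> W" unfolding s_def[abs_def] by (rule reflection_in_W)
  have "blinfun_apply (cr (c *\<^sub>R b)) (c *\<^sub>R b) = 2" by (rule coroot_diag[OF cb])
  \<comment> \<open>The reflection in \<open>c *\<^sub>R b\<close> also negates \<open>b\<close>,
    hence the coroot of \<open>b\<close>, and this forces the two coroots to be
    proportional.\<close>
  then have "s b = - b" by (simp add: s_def blinfun.bilinear_simps mult.commute scaleR_2)
  then have "cr b = dual_action s (cr (- b))" using coroot_W[OF sW, of "- b"] root_minus[OF Rp_R[OF bR]]
    bounded_linear.linear[OF bounded_linear_W[OF sW]] by (simp add: linear_neg)
  then have "cr b = dual_action s (- cr b)" using root_minus[OF Rp_R[OF bR]] by simp
  then have "blinfun_apply (cr b) (s v) = blinfun_apply (dual_action s (- cr b)) (s v)" for v by (rule arg_cong)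
  then have "blinfun_apply (cr b) (s v) = - blinfun_apply (cr b) v" for v
    using dual_action_apply[OF sW] W_inv_apply(1)[OF sW] by (simp add: blinfun.minus_left)
  then have "2 * blinfun_apply (cr b) v = blinfun_apply (cr (c *\<^sub>R b)) v * (c * 2)" for v
    using coroot_diag[OF Rp_R[OF bR]] by (simp add: s_def blinfun.bilinear_simps)
  then have "cr b = c *\<^sub>R cr (c *\<^sub>R b)" by (intro blinfun_eqI) (simp add: blinfun.bilinear_simps)
  then show False using coroot_not_proportional[OF assms(2) bR ne] by simp
qed

text \<open>A simple reflection changes only the coefficient of \<open>a\<close>. If the image were
  negative, all other coefficients of \<open>b\<close> would vanish, making \<open>b\<close> a
  multiple of \<open>a\<close> and so \<open>a\<close> itself.\<close>

lemma simple_reflection_pos: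
  assumes a: "a \<in> \<Delta>" and b: "b \<in> Rp" "b \<noteq> a"
  shows "V.ref a b \<in> Rp"
proof (rule ccontr)
  assume neg: "V.ref a b \<notin> Rp"
  have "V.act [a] b \<in> R" by (rule W_root[OF act_in_W Rp_R[OF b(1)]]) (use a in simp)
  then have R: "V.ref a b \<in> R" by simp
  with neg have "- V.ref a b \<in> Rp" using root_pos_or_neg by blast
  then obtain d :: "'v \<Rightarrow> nat" where d: "- V.ref a b = (\<Sum>i\<in>\<Delta>. real (d i) *\<^sub>R i)" unfolding Rp_iff V.pos_def by blast
  obtain c :: "'v \<Rightarrow> nat" where c: "b = (\<Sum>i\<in>\<Delta>. real (c i) *\<^sub>R i)" using b unfolding Rp_iff V.pos_def by blast
  have e: "x *\<^sub>R a = (\<Sum>i\<in>\<Delta>. (if i = a then x else 0) *\<^sub>R i)" for x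
    using a finite_simple by (simp add: if_distrib[of "\<lambda>x. x *\<^sub>R _"] cong: if_cong)
  have "(\<Sum>i\<in>\<Delta>. (real (c i) + real (d i)) *\<^sub>R i) = b + - V.ref a b"
    by (simp only: c[symmetric] d[symmetric] scaleR_add_left sum.distrib)
  also have "\<dots> = blinfun_apply (co a) b *\<^sub>R a" by (simp add: V.ref_def)
  finally have eq: "(\<Sum>i\<in>\<Delta>. (real (c i) + real (d i)) *\<^sub>R i) = (\<Sum>i\<in>\<Delta>. (if i = a then blinfun_apply (co a) b else 0) *\<^sub>R i)"
    by (simp only: e)
  have "c i = 0" if "i \<in> \<Delta>" "i \<noteq> a" for i
    using V.coeff_unique[OF eq that(1)] that(2) by simp
  then have "b = real (c a) *\<^sub>R a"
    unfolding c using a finite_simple by (subst sum.remove[of _ a]) auto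
  then show False using multiple_of_simple[OF a, of "real (c a)"] b by simp
qed

text \<open>These are the roots whose factors take the form with \<open>t - E b\<close>; their
  number gives the power of \<rho> that governs convergence.\<close>

definition Inv where "Inv w = {b \<in> Rp. inv w b \<notin> Rp}"

text \<open>For a reduced word starting with \<open>a\<close>, the set consists of \<open>a\<close>
  and the reflection in \<open>a\<close> of the set for the remaining word.\<close>

lemma Inv_card_word:
  "set ws \<subseteq> \<Delta> \<Longrightarrow> V.len ws = length ws \<Longrightarrow> finite (Inv (V.act ws)) \<and> card (Inv (V.act ws)) = length ws"
proof (induction ws)
  case Nil
  show ?case by (simp add: Inv_def)
next
  case (Cons a ws)
  have ws: "set ws \<subseteq> \<Delta>" and a: "a \<in> \<Delta>" using Cons.prems by auto
  have "V.len (rev (a # ws)) \<le> V.len (rev ws) + length [a]" unfolding rev.simps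
    using ws a by (intro V.len_append_le) auto
  then have lenws: "V.len (a # ws) \<le> V.len ws + 1" using V_len_rev[of "a # ws"] V_len_rev[of ws] ws a by simp
  moreover have "V.len ws \<le> length ws" using ws by (intro V.len_le) auto
  ultimately have red: "V.len ws = length ws" using Cons.prems by simp
  have IH: "finite (Inv (V.act ws))" "card (Inv (V.act ws)) = length ws" using Cons.IH[OF ws red] by auto
  \<comment> \<open>The sign criterion concerns letters added on the right, so the leftmost letter
    \<open>a\<close> is handled through reversed words.\<close>
  have "V.len (rev ws) \<le> V.len (rev ws @ [a])"
    using Cons.prems red V_len_rev[of "a # ws"] V_len_rev[of ws] ws by simp
  then have apos: "V.act (rev ws) a \<in> Rp"
    using V.act_simple_pos[of "rev ws" a] act_in_R[of "rev ws" a] ws a by (simp add: Rp_iff)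
  have inv1: "inv (V.act ws) = V.act (rev ws)" using inv_act ws by blast
  have inv2: "inv (V.act (a # ws)) b = V.act (rev ws) (V.ref a b)" for b
    using inv_act[of "a # ws"] ws a by simp
  have aRp: "a \<in> Rp" using act_in_R[of "[]" a] V.pos_simple a by (simp add: Rp_iff)
  have refp: "V.ref a b \<in> Rp" if "b \<in> Rp" "b \<noteq> a" for b using simple_reflection_pos[OF a that] .
  have eq: "Inv (V.act (a # ws)) = insert a (V.ref a ` Inv (V.act ws))"
  proof (intro equalityI subsetI)
    fix b assume "b \<in> Inv (V.act (a # ws))"
    then have b: "b \<in> Rp" "V.act (rev ws) (V.ref a b) \<notin> Rp" unfolding Inv_def inv2 by auto
    show "b \<in> insert a (V.ref a ` Inv (V.act ws))"
    proof (cases "b = a")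
      case False
      have "V.ref a b \<in> Inv (V.act ws)" unfolding Inv_def inv1 using b refp[OF b(1) False] by simp
      moreover have "b = V.ref a (V.ref a b)" using V.ref_ref[OF a] by simp
      ultimately show ?thesis by blast
    qed simp
  next
    fix b assume "b \<in> insert a (V.ref a ` Inv (V.act ws))"
    then show "b \<in> Inv (V.act (a # ws))"
    proof
      assume "b = a"
      then show ?thesis using aRp not_pos_neg[OF apos] ws V.linear_act[of "rev ws"]
        unfolding Inv_def inv2 by (simp add: V.ref_self[OF a] linear_neg)
    next
      assume "b \<in> V.ref a ` Inv (V.act ws)"
      then obtain c where c: "b = V.ref a c" "c \<in> Rp" "V.act (rev ws) c \<notin> Rp" unfolding Inv_def inv1 by auto
      then have "c \<noteq> a" using apos by auto
      then show ?thesis using c refp[OF c(2)] V.ref_ref[OF a] unfolding Inv_def inv2 by simp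
    qed
  qed
  have "a \<notin> V.ref a ` Inv (V.act ws)"
  proof
    assume "a \<in> V.ref a ` Inv (V.act ws)"
    then obtain c where "a = V.ref a c" "c \<in> Rp" unfolding Inv_def by auto
    then have "c = - a" using V.ref_ref[OF a, of c] V.ref_self[OF a] by simp
    then show False using not_pos_neg[OF aRp] \<open>c \<in> Rp\<close> by simp
  qed
  moreover have "inj (V.ref a)" using V.ref_ref[OF a] by (metis injI)
  ultimately show ?case unfolding eq using IH by (simp add: card_image inj_on_subset)
qed

lemma Inv_card: "w \<in> W \<Longrightarrow> finite (Inv w) \<and> card (Inv w) = weyl_length \<Delta> co w"
proof -
  assume "w \<in> W"
  then obtain ws where ws: "set ws \<subseteq> \<Delta>" "w = V.act ws" using W_word by blast
  obtain us where us: "length us = V.len ws" "set us \<subseteq> \<Delta>" "V.act us = V.act ws" using V.len_reduced[OF ws(1)] by blast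
  then have "V.len us = length us" using V.len_cong by metis
  then show ?thesis using Inv_card_word[OF us(2)] us ws weyl_length_act by metis
qed

lemma finite_length: "finite {w \<in> W. weyl_length \<Delta> co w = n}"
proof (rule finite_subset)
  show "{w \<in> W. weyl_length \<Delta> co w = n} \<subseteq> V.act ` {ws. set ws \<subseteq> \<Delta> \<and> length ws = n}"
  proof
    fix w assume "w \<in> {w \<in> W. weyl_length \<Delta> co w = n}"
    then have w: "w \<in> W" "weyl_length \<Delta> co w = n" by auto
    then obtain ws where ws: "set ws \<subseteq> \<Delta>" "w = V.act ws" using W_word by blast
    with w weyl_length_act have "V.len ws = n" by simp
    with V.len_reduced[OF ws(1)] obtain us where "length us = n" "set us \<subseteq> \<Delta>" "V.act us = w" using ws(2) by auto
    then show "w \<in> V.act ` {ws. set ws \<subseteq> \<Delta> \<and> length ws = n}" by blast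
  qed
qed (rule finite_imageI[OF finite_lists_length_eq[OF finite_simple]])

end

section \<open>Unordered products\<close>

lemma norm_prod_one_plus_le:
  fixes u :: "'i \<Rightarrow> complex"
  assumes "\<And>a. a \<in> F \<Longrightarrow> norm (u a) \<le> M a"
  shows "norm (\<Prod>a\<in>F. 1 + u a) \<le> (\<Prod>a\<in>F. 1 + M a)"
  unfolding prod_norm[symmetric]
proof (rule prod_mono)
  fix a assume "a \<in> F"
  then show "0 \<le> norm (1 + u a) \<and> norm (1 + u a) \<le> 1 + M a"
    using assms norm_triangle_mono[of 1 1 "u a" "M a"] by simp
qed

lemma norm_prod_one_plus_minus_one_le:
  fixes u :: "'i \<Rightarrow> complex"
  assumes "\<And>a. a \<in> F \<Longrightarrow> norm (u a) \<le> M a"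
  shows "norm ((\<Prod>a\<in>F. 1 + u a) - 1) \<le> (\<Prod>a\<in>F. 1 + M a) - 1"
  using assms
proof (induction F rule: infinite_finite_induct)
  case (insert a F)
  let ?P = "\<Prod>a\<in>F. 1 + u a" and ?Q = "\<Prod>a\<in>F. 1 + M a"
  have "norm ?P \<le> ?Q" using insert by (intro norm_prod_one_plus_le) auto
  then have "norm (u a * ?P) \<le> M a * ?Q"
    using insert.prems[of a] order_trans[OF norm_ge_zero insert.prems[of a]] unfolding norm_mult by (intro mult_mono) auto
  moreover have "norm (?P - 1) \<le> ?Q - 1" using insert by auto
  moreover have "(\<Prod>a\<in>insert a F. 1 + u a) - 1 = (?P - 1) + u a * ?P" using insert by (simp add: algebra_simps)
  ultimately have "norm ((\<Prod>a\<in>insert a F. 1 + u a) - 1) \<le> (?Q - 1) + M a * ?Q"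
    by (metis norm_triangle_mono)
  then show ?case using insert by (simp add: algebra_simps)
qed auto

text \<open>Past a finite set \<open>F n\<close> the sums of \<open>M\<close> stay within 1/(n+1) of
  the total, so enlarging the set changes the product by at most \<open>\<delta> n\<close>,
  uniformly in \<open>x\<close>. The resulting limit is the value that \<open>infprod\<close>
  returns.\<close>

lemma unordered_prod_uniform_limit:
  fixes u :: "'i \<Rightarrow> 'x \<Rightarrow> complex"
  assumes M: "M summable_on A" and u: "\<And>a x. a \<in> A \<Longrightarrow> x \<in> X \<Longrightarrow> norm (u a x) \<le> M a"
  shows "uniform_limit X (\<lambda>F x. \<Prod>a\<in>F. 1 + u a x) (\<lambda>x. infprod (\<lambda>a. 1 + u a x) A) (finite_subsets_at_top A)"
proof (cases "X = {}")
  case False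
  then obtain x0 where x0: "x0 \<in> X" by blast
  have M0: "M a \<ge> 0" if "a \<in> A" for a using u[OF that x0] norm_ge_zero[of "u a x0"] by linarith
  define S where "S = infsum M A"
  have hs: "(sum M \<longlongrightarrow> S) (finite_subsets_at_top A)"
    using M unfolding S_def has_sum_def[symmetric] by simp
  have "\<exists>F. finite F \<and> F \<subseteq> A \<and> (\<forall>Y. finite Y \<and> F \<subseteq> Y \<and> Y \<subseteq> A \<longrightarrow> dist (sum M Y) S < inverse (real (Suc n)))" for n
    using tendstoD[OF hs, of "inverse (real (Suc n))"] unfolding eventually_finite_subsets_at_top by simp
  then obtain F where F: "\<And>n. finite (F n)" "\<And>n. F n \<subseteq> A"
    and FS: "\<And>n Y. finite Y \<Longrightarrow> F n \<subseteq> Y \<Longrightarrow> Y \<subseteq> A \<Longrightarrow> dist (sum M Y) S < inverse (real (Suc n))" by metis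
  define P where "P Y x = (\<Prod>a\<in>Y. 1 + u a x)" for Y x
  \<comment> \<open>\<open>exp S\<close> bounds the product over \<open>F n\<close>; the sum of
    \<open>M\<close> over the added indices is at most 2/(n+1), as a difference of two sums near the
    total.\<close>
  define \<delta> where "\<delta> n = exp S * (exp (2 * inverse (real (Suc n))) - 1)" for n
  have SF: "sum M Y \<le> S" if "finite Y" "Y \<subseteq> A" for Y
    unfolding S_def using that M M0 by (intro finite_sum_le_infsum) auto
  have near: "norm (P Y x - P (F n) x) \<le> \<delta> n" if Y: "finite Y" "F n \<subseteq> Y" "Y \<subseteq> A" and x: "x \<in> X" for Y n x
  proof -
    let ?D = "Y - F n"
    have D: "finite ?D" "?D \<subseteq> A" using Y by auto
    have "P Y x = P (F n) x * P ?D x"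
      unfolding P_def using prod.subset_diff[OF Y(2,1)] by (simp add: mult.commute)
    then have "P Y x - P (F n) x = P (F n) x * (P ?D x - 1)" by (simp add: algebra_simps)
    then have "norm (P Y x - P (F n) x) = norm (P (F n) x) * norm (P ?D x - 1)" by (simp add: norm_mult)
    also have "\<dots> \<le> exp S * (exp (2 * inverse (real (Suc n))) - 1)"
    proof (rule mult_mono)
      have "norm (P (F n) x) \<le> (\<Prod>a\<in>F n. 1 + M a)" unfolding P_def
        using F(2) u x by (intro norm_prod_one_plus_le) auto
      also have "\<dots> \<le> exp (sum M (F n))" using M0 F(2) by (intro prod_le_exp_sum) auto
      also have "\<dots> \<le> exp S" using SF[OF F(1,2)] by simp
      finally show "norm (P (F n) x) \<le> exp S" .
      have "norm (P ?D x - 1) \<le> (\<Prod>a\<in>?D. 1 + M a) - 1" unfolding P_def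
        using D u x by (intro norm_prod_one_plus_minus_one_le) auto
      also have "\<dots> \<le> exp (sum M ?D) - 1" using M0 D prod_le_exp_sum[of ?D M] by auto
      also have "sum M ?D = sum M Y - sum M (F n)" using Y by (simp add: sum_diff)
      also have "\<dots> \<le> 2 * inverse (real (Suc n))"
        using FS[OF Y] FS[OF F(1) order_refl F(2), of n] unfolding dist_real_def by linarith
      finally show "norm (P ?D x - 1) \<le> exp (2 * inverse (real (Suc n))) - 1" by simp
    qed auto
    finally show ?thesis by (simp add: \<delta>_def)
  qed
  have \<delta>0: "\<delta> \<longlonglongrightarrow> 0"
  proof -
    have "(\<lambda>n. exp S * (exp (2 * inverse (real (Suc n))) - 1)) \<longlonglongrightarrow> exp S * (exp (2 * 0) - 1)"
      by (intro tendsto_intros LIMSEQ_inverse_real_of_nat)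
    then show ?thesis by (simp add: \<delta>_def[abs_def])
  qed
  \<comment> \<open>The sets \<open>F n\<close> need not be nested, so both products are compared
    with the one over the union.\<close>
  have near2: "norm (P (F m) x - P (F n) x) \<le> \<delta> m + \<delta> n" if x: "x \<in> X" for m n x
  proof -
    have "norm (P (F m \<union> F n) x - P (F m) x) \<le> \<delta> m" "norm (P (F m \<union> F n) x - P (F n) x) \<le> \<delta> n"
      using F x by (auto intro!: near)
    moreover have "P (F m) x - P (F n) x = (P (F m \<union> F n) x - P (F n) x) - (P (F m \<union> F n) x - P (F m) x)" by simp
    ultimately show ?thesis
      using norm_triangle_ineq4[of "P (F m \<union> F n) x - P (F n) x" "P (F m \<union> F n) x - P (F m) x"] by (smt (verit))
  qed
  have "\<exists>l. (\<lambda>n. P (F n) x) \<longlonglongrightarrow> l" if x: "x \<in> X" for x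
  proof -
    have "Cauchy (\<lambda>n. P (F n) x)"
    proof (rule metric_CauchyI)
      fix e :: real assume "e > 0"
      then obtain K where K: "\<And>n. n \<ge> K \<Longrightarrow> \<delta> n < e/2"
        using order_tendstoD(2)[OF \<delta>0, of "e/2"] by (auto simp: eventually_sequentially)
      show "\<exists>K. \<forall>m\<ge>K. \<forall>n\<ge>K. dist (P (F m) x) (P (F n) x) < e"
        using K near2[OF x] unfolding dist_norm by (intro exI[of _ K] allI impI) (smt (verit) field_sum_of_halves)
    qed
    then show ?thesis by (simp add: Cauchy_convergent_iff convergent_def)
  qed
  then obtain l where l: "\<And>x. x \<in> X \<Longrightarrow> (\<lambda>n. P (F n) x) \<longlonglongrightarrow> l x" by metis
  have lF: "norm (P (F n) x - l x) \<le> \<delta> n" if x: "x \<in> X" for n x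
  proof (rule LIMSEQ_le)
    show "(\<lambda>m. norm (P (F n) x - P (F m) x)) \<longlonglongrightarrow> norm (P (F n) x - l x)" by (intro tendsto_intros l x)
    have "(\<lambda>m. \<delta> n + \<delta> m) \<longlonglongrightarrow> \<delta> n + 0" by (intro tendsto_intros \<delta>0)
    then show "(\<lambda>m. \<delta> n + \<delta> m) \<longlonglongrightarrow> \<delta> n" by simp
  qed (use near2[OF x] in blast)
  have ul: "uniform_limit X P l (finite_subsets_at_top A)"
  proof (rule uniform_limitI)
    fix e :: real assume "e > 0"
    then obtain n where n: "\<delta> n < e/2"
      using order_tendstoD(2)[OF \<delta>0, of "e/2"] by (auto simp: eventually_sequentially)
    have "dist (P Y x) (l x) < e" if "finite Y" "F n \<subseteq> Y" "Y \<subseteq> A" "x \<in> X" for Y x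
      using norm_triangle_mono[OF near[OF that] lF[OF that(4), of n]] n unfolding dist_norm by simp
    then show "\<forall>\<^sub>F Y in finite_subsets_at_top A. \<forall>x\<in>X. dist (P Y x) (l x) < e"
      unfolding eventually_finite_subsets_at_top using F by (intro exI[of _ "F n"]) auto
  qed
  have "infprod (\<lambda>a. 1 + u a x) A = l x" if x: "x \<in> X" for x
    unfolding infprod_def
  proof (rule tendsto_Lim)
    show "(prod (\<lambda>a. 1 + u a x) \<longlongrightarrow> l x) (finite_subsets_at_top A)"
      using tendsto_uniform_limitI[OF ul x] unfolding P_def .
  qed simp
  then show ?thesis using ul unfolding P_def by (simp cong: uniform_limit_cong')
qed auto

lemma infprod_reindex_bij_betw:
  assumes "bij_betw g A B"
  shows "infprod (\<lambda>a. f (g a)) A = infprod f B"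
proof -
  have inj: "inj_on g A" and im: "g ` A = B" using assms by (auto simp: bij_betw_def)
  have "(prod f \<longlongrightarrow> l) (finite_subsets_at_top B) \<longleftrightarrow> (prod (\<lambda>a. f (g a)) \<longlongrightarrow> l) (finite_subsets_at_top A)" for l
  proof -
    have "(prod f \<longlongrightarrow> l) (finite_subsets_at_top B) \<longleftrightarrow> ((\<lambda>F. prod f (g ` F)) \<longlongrightarrow> l) (finite_subsets_at_top A)"
      unfolding im[symmetric] filtermap_image_finite_subsets_at_top[OF inj, symmetric] filterlim_filtermap by simp
    also have "\<dots> \<longleftrightarrow> (prod (\<lambda>a. f (g a)) \<longlongrightarrow> l) (finite_subsets_at_top A)"
      by (intro tendsto_cong eventually_finite_subsets_at_top_weakI)
        (simp add: prod.reindex inj_on_subset[OF inj])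
    finally show ?thesis .
  qed
  then show ?thesis unfolding infprod_def Topological_Spaces.Lim_def by simp
qed

lemma infprod_split_finite:
  assumes lim: "(prod f \<longlongrightarrow> l) (finite_subsets_at_top (A - N))" and N: "finite N" "N \<subseteq> A"
  shows "infprod f A = prod f N * l"
  unfolding infprod_def
proof (rule tendsto_Lim)
  have fl: "filterlim (\<lambda>F. F - N) (finite_subsets_at_top (A - N)) (finite_subsets_at_top A)"
    unfolding filterlim_iff
  proof (intro allI impI)
    fix Q assume "eventually Q (finite_subsets_at_top (A - N))"
    then obtain Z where Z: "finite Z" "Z \<subseteq> A - N" "\<forall>Y. finite Y \<and> Z \<subseteq> Y \<and> Y \<subseteq> A - N \<longrightarrow> Q Y"
      unfolding eventually_finite_subsets_at_top by blast
    show "\<forall>\<^sub>F F in finite_subsets_at_top A. Q (F - N)"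
      unfolding eventually_finite_subsets_at_top
    proof (intro exI[of _ Z] conjI allI impI)
      fix Y assume "finite Y \<and> Z \<subseteq> Y \<and> Y \<subseteq> A"
      then show "Q (Y - N)" using Z(2) by (intro Z(3)[rule_format]) auto
    qed (use Z in auto)
  qed
  have "((\<lambda>F. prod f N * prod f (F - N)) \<longlongrightarrow> prod f N * l) (finite_subsets_at_top A)"
    by (intro tendsto_intros filterlim_compose[OF lim fl])
  moreover have "\<forall>\<^sub>F F in finite_subsets_at_top A. prod f N * prod f (F - N) = prod f F"
    unfolding eventually_finite_subsets_at_top
  proof (intro exI[of _ N] conjI allI impI N)
    fix Y assume "finite Y \<and> N \<subseteq> Y \<and> Y \<subseteq> A"
    then show "prod f N * prod f (Y - N) = prod f Y" using prod.subset_diff[of N Y f] by (simp add: mult.commute)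
  qed
  ultimately show "(prod f \<longlongrightarrow> prod f N * l) (finite_subsets_at_top A)" by (rule Lim_transform_eventually)
qed simp

text \<open>Distinct indices have distinct exponent vectors, so every finite partial sum is bounded
  by the product of the full geometric series.\<close>

lemma geometric_multi_summable:
  fixes x :: "'i \<Rightarrow> real" and \<nu> :: "'b \<Rightarrow> 'i \<Rightarrow> nat"
  assumes I: "finite I" and x: "\<And>i. i \<in> I \<Longrightarrow> 0 \<le> x i \<and> x i < 1"
    and inj: "\<And>a b. a \<in> A \<Longrightarrow> b \<in> A \<Longrightarrow> (\<And>i. i \<in> I \<Longrightarrow> \<nu> a i = \<nu> b i) \<Longrightarrow> a = b"
  shows "(\<lambda>a. \<Prod>i\<in>I. x i ^ \<nu> a i) summable_on A"
proof (rule nonneg_bdd_above_summable_on)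
  show "0 \<le> (\<Prod>i\<in>I. x i ^ \<nu> a i)" for a using x by (intro prod_nonneg) auto
  show "bdd_above (sum (\<lambda>a. \<Prod>i\<in>I. x i ^ \<nu> a i) ` {F. F \<subseteq> A \<and> finite F})"
  proof (rule bdd_aboveI2)
    fix F assume "F \<in> {F. F \<subseteq> A \<and> finite F}"
    then have F: "F \<subseteq> A" "finite F" by auto
    define K where "K = Max (insert 0 ((\<lambda>(a, i). \<nu> a i) ` (F \<times> I)))"
    have K: "\<nu> a i \<le> K" if "a \<in> F" "i \<in> I" for a i
      unfolding K_def using that F I by (intro Max_ge) auto
    let ?r = "\<lambda>a. restrict (\<nu> a) I"
    have injr: "inj_on ?r F"
    proof (rule inj_onI)
      fix a b assume "a \<in> F" "b \<in> F" and eq: "?r a = ?r b"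
      have "\<nu> a i = \<nu> b i" if "i \<in> I" for i using fun_cong[OF eq, of i] that by simp
      then show "a = b" using F(1) \<open>a \<in> F\<close> \<open>b \<in> F\<close> by (intro inj) auto
    qed
    have "(\<Sum>a\<in>F. \<Prod>i\<in>I. x i ^ \<nu> a i) = (\<Sum>n\<in>?r ` F. \<Prod>i\<in>I. x i ^ n i)"
      by (subst sum.reindex[OF injr]) simp
    also have "\<dots> \<le> (\<Sum>n\<in>PiE I (\<lambda>_. {..K}). \<Prod>i\<in>I. x i ^ n i)"
      using I K x by (intro sum_mono2 finite_PiE) (auto intro!: prod_nonneg)
    also have "\<dots> = (\<Prod>i\<in>I. \<Sum>k\<in>{..K}. x i ^ k)"
      using I by (subst prod_sum_PiE) auto
    also have "\<dots> \<le> (\<Prod>i\<in>I. 1 / (1 - x i))"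
    proof (rule prod_mono)
      fix i assume i: "i \<in> I"
      have "(\<Sum>k\<in>{..K}. x i ^ k) \<le> suminf (\<lambda>k. x i ^ k)"
        using x[OF i] by (intro sum_le_suminf summable_geometric) auto
      then show "0 \<le> (\<Sum>k\<in>{..K}. x i ^ k) \<and> (\<Sum>k\<in>{..K}. x i ^ k) \<le> 1 / (1 - x i)"
        using x[OF i] by (simp add: suminf_geometric sum_nonneg)
    qed
    finally show "(\<Sum>a\<in>F. \<Prod>i\<in>I. x i ^ \<nu> a i) \<le> (\<Prod>i\<in>I. 1 / (1 - x i))" .
  qed
qed

section \<open>Local convergence\<close>

context kac_moody_root_system
begin

definition E :: "'v \<Rightarrow> 'v \<times> 'v \<Rightarrow> complex" where
  "E b h = exp (2 * of_real pi * \<i> * cpairing h (cr b))"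

lemma exp_coroot_eq: "w \<in> W \<Longrightarrow> a \<in> R \<Longrightarrow> exp_coroot \<Delta> co w a h = E (w a) h"
  by (simp add: exp_coroot_def E_def coroot_W)

lemma norm_E: "norm (E b h) = exp (- (2 * pi * blinfun_apply (cr b) (snd h)))"
  by (simp add: E_def cpairing_def norm_exp_eq_Re)

lemma E_nonzero [simp]: "E b h \<noteq> 0"
  by (simp add: E_def)

lemma E_minus: "a \<in> R \<Longrightarrow> E (- a) h = inverse (E a h)"
  by (simp add: E_def root_minus cpairing_alt blinfun.minus_left exp_minus[symmetric] algebra_simps)

lemma holo_E: "holomorphic_several_on (\<lambda>p. E b (snd p)) S"
  unfolding E_def by (intro holo_exp holo_mult holo_const holo_cpairing)

text \<open>\<open>fac w b\<close> is the factor of the summand of \<open>w\<close> at the root \<open>a\<close>, re-indexed by the positive root \<open>b = \<plusminus>w a\<close>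
  and written in terms of \<open>E b\<close>, which is small on the positive side also when \<open>w a\<close> is negative.\<close>

definition num :: "('v \<Rightarrow> 'v) \<Rightarrow> 'v \<Rightarrow> complex \<times> ('v \<times> 'v) \<Rightarrow> complex" where
  "num w b p = (if inv w b \<in> Rp then 1 - fst p * E b (snd p) else fst p - E b (snd p))"

definition fac :: "('v \<Rightarrow> 'v) \<Rightarrow> 'v \<Rightarrow> complex \<times> ('v \<times> 'v) \<Rightarrow> complex" where
  "fac w b p = num w b p / (1 - E b (snd p))"

definition flip :: "('v \<Rightarrow> 'v) \<Rightarrow> 'v \<Rightarrow> 'v" where
  "flip w a = (if w a \<in> Rp then w a else - w a)"

lemma W_minus: "w \<in> W \<Longrightarrow> w (- v) = - w v"
  using bounded_linear_W bounded_linear.linear linear_neg by blast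

lemma flip_Rp: "w \<in> W \<Longrightarrow> a \<in> Rp \<Longrightarrow> flip w a \<in> Rp"
  using Rp_neg_iff[OF W_root, of w a] Rp_R by (simp add: flip_def)

lemma flip_flip: "w \<in> W \<Longrightarrow> a \<in> Rp \<Longrightarrow> flip (inv w) (flip w a) = a"
  using W_inv_apply(1)[of w] W_minus[OF weyl_inv, of w] not_pos_neg by (simp add: flip_def)

lemma inv_inv_W: "w \<in> W \<Longrightarrow> inv (inv w) = w"
  using W_bij inv_inv_eq by blast

lemma flip_bij: "w \<in> W \<Longrightarrow> bij_betw (flip w) Rp Rp"
proof (rule bij_betw_byWitness[where f' = "flip (inv w)"])
  assume w: "w \<in> W"
  show "\<forall>a\<in>Rp. flip (inv w) (flip w a) = a" using flip_flip[OF w] by blast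
  show "\<forall>a\<in>Rp. flip w (flip (inv w) a) = a" using flip_flip[OF weyl_inv[OF w]] inv_inv_W[OF w] by simp
qed (auto intro: flip_Rp weyl_inv)

lemma C_factor_flip:
  assumes w: "w \<in> W" and a: "a \<in> Rp"
  shows "C_factor \<Delta> co w a p = fac w (flip w a) p"
proof -
  obtain t h where p: "p = (t, h)" by (cases p)
  have R: "a \<in> R" "w a \<in> R" using W_root[OF w] a Rp_R by auto
  show ?thesis
  proof (cases "w a \<in> Rp")
    case True
    then show ?thesis using a W_inv_apply(1)[OF w] exp_coroot_eq[OF w R(1)]
      by (simp add: C_factor_def fac_def num_def flip_def p)
  next
    case False
    have "inv w (- w a) \<notin> Rp" using W_minus[OF weyl_inv[OF w]] W_inv_apply(1)[OF w] not_pos_neg[OF a] by simp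
    then have "fac w (flip w a) p = (t - inverse (E (w a) h)) / (1 - inverse (E (w a) h))"
      using False by (simp add: fac_def num_def flip_def p E_minus[OF R(2)])
    also have "\<dots> = (1 - t * E (w a) h) / (1 - E (w a) h)"
    proof -
      \<comment> \<open>For \<open>e = 1\<close> both denominators vanish and both quotients are 0
        by convention, so the rewriting holds at every point.\<close>
      have "(t - inverse e) / (1 - inverse e) = (1 - t * e) / (1 - e)" if "e \<noteq> 0" for e :: complex
        using that by (cases "e = 1") (simp_all add: field_simps)
      then show ?thesis by simp
    qed
    finally show ?thesis using exp_coroot_eq[OF w R(1)] by (simp add: C_factor_def p)
  qed
qed

lemma C_term_flip: "w \<in> W \<Longrightarrow> C_term \<Delta> co w p = infprod (\<lambda>b. fac w b p) Rp"
proof -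
  assume w: "w \<in> W"
  have "C_term \<Delta> co w p = infprod (\<lambda>a. fac w (flip w a) p) Rp"
  proof -
    have "(\<lambda>F. \<Prod>a\<in>F. C_factor \<Delta> co w a p) F = (\<lambda>F. \<Prod>a\<in>F. fac w (flip w a) p) F" if "F \<subseteq> Rp" for F
      using that C_factor_flip[OF w, of _ p] by (auto intro!: prod.cong)
    then have "((\<lambda>F. \<Prod>a\<in>F. C_factor \<Delta> co w a p) \<longlongrightarrow> l) (finite_subsets_at_top Rp) \<longleftrightarrow>
        ((\<lambda>F. \<Prod>a\<in>F. fac w (flip w a) p) \<longlongrightarrow> l) (finite_subsets_at_top Rp)" for l
      by (intro tendsto_cong eventually_finite_subsets_at_top_weakI) auto
    then show ?thesis unfolding C_term_def infprod_def Topological_Spaces.Lim_def by simp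
  qed
  also have "\<dots> = infprod (\<lambda>b. fac w b p) Rp" by (rule infprod_reindex_bij_betw[OF flip_bij[OF w]])
  finally show ?thesis .
qed

lemma D_pos_nonneg: "D.pos l \<Longrightarrow> (\<And>a. a \<in> \<Delta> \<Longrightarrow> blinfun_apply (co a) y \<ge> 0) \<Longrightarrow> blinfun_apply l y \<ge> 0"
proof -
  assume "D.pos l" and y: "\<And>a. a \<in> \<Delta> \<Longrightarrow> blinfun_apply (co a) y \<ge> 0"
  then obtain n :: "'v \<Rightarrow> nat" where "l = (\<Sum>i\<in>\<Delta>. real (n i) *\<^sub>R co i)" unfolding D.pos_def by blast
  then show ?thesis using y by (simp add: blinfun.sum_left blinfun.scaleR_left sum_nonneg)
qed

definition coef :: "'v \<Rightarrow> 'v \<Rightarrow> nat" where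
  "coef b = (SOME n. cr b = (\<Sum>i\<in>\<Delta>. real (n i) *\<^sub>R co i))"

lemma coef: "b \<in> Rp \<Longrightarrow> cr b = (\<Sum>i\<in>\<Delta>. real (coef b i) *\<^sub>R co i)"
  unfolding coef_def using coroot_pos[of b] unfolding D.pos_def by (rule someI_ex)

lemma coroot_apply: "b \<in> Rp \<Longrightarrow> blinfun_apply (cr b) y = (\<Sum>i\<in>\<Delta>. real (coef b i) * blinfun_apply (co i) y)"
  by (subst coef) (simp_all add: blinfun.sum_left blinfun.scaleR_left)

text \<open>A positive coroot has natural coefficients, not all zero, so its value on
  \<open>c\<close> is at least the smallest value of a simple coroot.\<close>

lemma coroot_chamber_bound:
  assumes c: "c \<in> chamber \<Delta> co"
  shows "\<exists>\<mu>>0. \<forall>b\<in>Rp. blinfun_apply (cr b) c \<ge> \<mu>"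
proof -
  \<comment> \<open>The inserted 1 covers an empty set of simple roots.\<close>
  define \<mu> where "\<mu> = Min (insert 1 ((\<lambda>a. blinfun_apply (co a) c) ` \<Delta>))"
  have pos: "blinfun_apply (co a) c > 0" if "a \<in> \<Delta>" for a using c that by (simp add: chamber_def)
  have "\<mu> > 0" unfolding \<mu>_def using finite_simple pos by (subst Min_gr_iff) auto
  have \<mu>: "\<mu> \<le> blinfun_apply (co a) c" if "a \<in> \<Delta>" for a
    unfolding \<mu>_def using that finite_simple by (intro Min_le) auto
  have "blinfun_apply (cr b) c \<ge> \<mu>" if b: "b \<in> Rp" for b
  proof -
    have "\<exists>i\<in>\<Delta>. coef b i \<noteq> 0"
    proof (rule ccontr)
      assume "\<not> ?thesis"
      then have "cr b = 0" using coef[OF b] by simp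
      then show False using coroot_nonzero Rp_R[OF b] by blast
    qed
    then obtain i where i: "i \<in> \<Delta>" "coef b i \<ge> 1" by force
    have "\<mu> \<le> real (coef b i) * blinfun_apply (co i) c"
    proof -
      have "1 * blinfun_apply (co i) c \<le> real (coef b i) * blinfun_apply (co i) c"
        using i(2) pos[OF i(1)] by (intro mult_right_mono) auto
      then show ?thesis using \<mu>[OF i(1)] by simp
    qed
    also have "\<dots> \<le> (\<Sum>i\<in>\<Delta>. real (coef b i) * blinfun_apply (co i) c)"
      using finite_simple i(1) pos by (intro member_le_sum) (auto simp: less_imp_le)
    finally show ?thesis using coroot_apply[OF b] by simp
  qed
  with \<open>\<mu> > 0\<close> show ?thesis by blast
qed

text \<open>This is the modulus of \<open>E b\<close> at imaginary part \<open>c\<close>.\<close>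

definition decay :: "'v \<Rightarrow> 'v \<Rightarrow> real" where
  "decay c b = exp (- (2 * pi * blinfun_apply (cr b) c))"

text \<open>In terms of simple coroots this is a monomial with exponents \<open>coef b\<close> in
  numbers below 1, and distinct roots have distinct exponent vectors.\<close>

lemma decay_summable:
  assumes c: "c \<in> chamber \<Delta> co"
  shows "decay c summable_on Rp"
proof -
  have eq: "decay c b = (\<Prod>i\<in>\<Delta>. exp (- (2 * pi * blinfun_apply (co i) c)) ^ coef b i)" if "b \<in> Rp" for b
  proof -
    have "decay c b = exp (\<Sum>i\<in>\<Delta>. real (coef b i) * (- (2 * pi * blinfun_apply (co i) c)))"
      by (simp add: decay_def coroot_apply[OF that] sum_distrib_left sum_negf algebra_simps)
    also have "\<dots> = (\<Prod>i\<in>\<Delta>. exp (real (coef b i) * (- (2 * pi * blinfun_apply (co i) c))))"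
      by (rule exp_sum[OF finite_simple])
    finally show ?thesis unfolding exp_of_nat_mult .
  qed
  have "decay c summable_on Rp \<longleftrightarrow> (\<lambda>b. \<Prod>i\<in>\<Delta>. exp (- (2 * pi * blinfun_apply (co i) c)) ^ coef b i) summable_on Rp"
    by (rule summable_on_cong) (rule eq)
  moreover have "(\<lambda>b. \<Prod>i\<in>\<Delta>. exp (- (2 * pi * blinfun_apply (co i) c)) ^ coef b i) summable_on Rp"
  proof (rule geometric_multi_summable[OF finite_simple])
    show "0 \<le> exp (- (2 * pi * blinfun_apply (co i) c)) \<and> exp (- (2 * pi * blinfun_apply (co i) c)) < 1" if "i \<in> \<Delta>" for i
      using c that by (simp add: chamber_def)
    fix a b assume ab: "a \<in> Rp" "b \<in> Rp" "\<And>i. i \<in> \<Delta> \<Longrightarrow> coef a i = coef b i"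
    then have "cr a = cr b" using coef[OF ab(1)] coef[OF ab(2)] by simp
    then show "a = b" using coroot_inj Rp_R ab by blast
  qed
  ultimately show ?thesis by simp
qed

lemma open_chamber: "open (chamber \<Delta> co)"
proof -
  have "chamber \<Delta> co = (\<Inter>a\<in>\<Delta>. {x. blinfun_apply (co a) x > 0})" by (auto simp: chamber_def)
  then show ?thesis using finite_simple
    by (simp add: open_INT open_Collect_less continuous_intros)
qed

end

text \<open>Imaginary parts range over \<open>y1 + c + C\<close>. The roots in \<open>N\<close> below are the only ones whose denominators
  can vanish there, and the functions \<open>T w\<close> and \<open>G\<close> are the summand and the sum multiplied by these
  denominators.\<close>

locale kac_nbhd = kac_moody_root_system +
  fixes y1 c :: 'a and \<rho> B :: real
  assumes c: "c \<in> chamber \<Delta> co" and finN: "finite {b \<in> Rp. blinfun_apply (cr b) y1 < 0}"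
    and \<rho>: "\<rho> > 0" and sumW: "(\<lambda>w. \<rho> ^ weyl_length \<Delta> co w) summable_on W"
begin

definition N where "N = {b \<in> Rp. blinfun_apply (cr b) y1 < 0}"

text \<open>The bound \<open>B\<close> controls the finitely many exponentials of roots in
  \<open>N\<close>, which need not decay here.\<close>

definition X :: "(complex \<times> ('a \<times> 'a)) set" where
  "X = {p. norm (fst p) < \<rho> \<and> norm (snd p) < B \<and> snd (snd p) - y1 - c \<in> chamber \<Delta> co}"

lemma finite_N: "finite N" and N_Rp: "N \<subseteq> Rp"
  using finN by (auto simp: N_def)

lemma open_X: "open X"
proof -
  have "X = {p. norm (fst p) < \<rho>} \<inter> {p. norm (snd p) < B} \<inter> (\<lambda>p. snd (snd p) - y1 - c) -` chamber \<Delta> co"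
    by (auto simp: X_def)
  then show ?thesis
    by (simp, intro open_Int open_Collect_less open_vimage open_chamber continuous_intros)
qed

text \<open>The imaginary part is \<open>y1 + c\<close> plus a chamber vector; outside
  \<open>N\<close> both \<open>y1\<close> and the chamber vector contribute non-negatively.\<close>

lemma pairing_X:
  assumes "p \<in> X" "b \<in> Rp" "b \<notin> N"
  shows "blinfun_apply (cr b) (snd (snd p)) \<ge> blinfun_apply (cr b) c"
proof -
  have "blinfun_apply (cr b) (snd (snd p) - y1 - c) \<ge> 0"
  proof (rule D_pos_nonneg[OF coroot_pos[OF assms(2)]])
    fix a assume "a \<in> \<Delta>"
    then have "blinfun_apply (co a) (snd (snd p) - y1 - c) > 0"
      using assms(1) unfolding X_def chamber_def by blast
    then show "blinfun_apply (co a) (snd (snd p) - y1 - c) \<ge> 0" by linarith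
  qed
  moreover have "blinfun_apply (cr b) y1 \<ge> 0" using assms by (auto simp: N_def)
  ultimately show ?thesis by (simp add: blinfun.diff_right)
qed

lemma norm_E_X: "p \<in> X \<Longrightarrow> b \<in> Rp \<Longrightarrow> b \<notin> N \<Longrightarrow> norm (E b (snd p)) \<le> decay c b"
  using pairing_X[of p b] by (simp add: norm_E decay_def)

text \<open>A single bound below 1 for all decay factors, so that \<open>1 - q0\<close> keeps the
  denominators away from zero.\<close>

definition q0 where "q0 = (SOME x. x < 1 \<and> (\<forall>b\<in>Rp. decay c b \<le> x))"

lemma q0: "q0 < 1" "b \<in> Rp \<Longrightarrow> decay c b \<le> q0"
proof -
  obtain \<mu> where \<mu>: "\<mu> > 0" "\<And>b. b \<in> Rp \<Longrightarrow> blinfun_apply (cr b) c \<ge> \<mu>" using coroot_chamber_bound[OF c] by blast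
  have "exp (- (2 * pi * \<mu>)) < 1 \<and> (\<forall>b\<in>Rp. decay c b \<le> exp (- (2 * pi * \<mu>)))"
    using \<mu> by (auto simp: decay_def)
  then have "q0 < 1 \<and> (\<forall>b\<in>Rp. decay c b \<le> q0)" unfolding q0_def by (rule someI)
  then show "q0 < 1" "b \<in> Rp \<Longrightarrow> decay c b \<le> q0" by auto
qed

lemma norm_one_minus_E:
  assumes "p \<in> X" "b \<in> Rp" "b \<notin> N"
  shows "norm (1 - E b (snd p)) \<ge> 1 - q0"
  using norm_triangle_ineq2[of 1 "E b (snd p)"] norm_E_X[OF assms] q0(2)[OF assms(2)] by simp

lemma E_ne_1: "p \<in> X \<Longrightarrow> b \<in> Rp \<Longrightarrow> b \<notin> N \<Longrightarrow> E b (snd p) \<noteq> 1"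
  using norm_one_minus_E[of p b] q0(1) by auto

text \<open>The factor \<open>1 + \<rho>\<close> bounds |1 - t|; the extra
  \<open>1 + 1 / \<rho>\<close> lets the same majorant serve for inverted roots once \<rho> has been
  factored out.\<close>

definition M where "M b = (1 + \<rho>) * (1 + 1 / \<rho>) * decay c b / (1 - q0)"

lemma M_nonneg: "M b \<ge> 0"
  using \<rho> q0(1) by (simp add: M_def decay_def)

lemma M_summable: "M summable_on A" if "A \<subseteq> Rp"
proof -
  have "(\<lambda>b. ((1 + \<rho>) * (1 + 1 / \<rho>) / (1 - q0)) * decay c b) summable_on A"
    using summable_on_subset_banach[OF decay_summable[OF c] that] by (rule summable_on_cmult_right)
  then show ?thesis by (simp add: M_def[abs_def])
qed

lemma fac_bound_pos:
  assumes p: "p \<in> X" and b: "b \<in> Rp" "b \<notin> N" and w: "inv w b \<in> Rp"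
  shows "norm (fac w b p - 1) \<le> M b"
proof -
  let ?e = "E b (snd p)"
  have "fac w b p - 1 = (1 - fst p) * ?e / (1 - ?e)"
    using E_ne_1[OF p b] w by (simp add: fac_def num_def field_simps)
  then have "norm (fac w b p - 1) = norm (1 - fst p) * norm ?e / norm (1 - ?e)" by (simp add: norm_mult norm_divide)
  also have "\<dots> \<le> (1 + \<rho>) * decay c b / (1 - q0)"
  proof (rule frac_le)
    have "norm (1 - fst p) \<le> 1 + \<rho>" using norm_triangle_ineq4[of 1 "fst p"] p by (simp add: X_def)
    then show "norm (1 - fst p) * norm ?e \<le> (1 + \<rho>) * decay c b" using norm_E_X[OF p b] \<rho> by (intro mult_mono) auto
  qed (use norm_one_minus_E[OF p b] q0 \<rho> in \<open>auto simp: decay_def\<close>)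
  also have "\<dots> = (1 + \<rho>) * 1 * decay c b / (1 - q0)" by simp
  also have "\<dots> \<le> M b" unfolding M_def using \<rho> q0(1) by (intro divide_right_mono mult_right_mono mult_left_mono) (auto simp: decay_def)
  finally show ?thesis .
qed

text \<open>An inverted factor is close to \<open>t\<close>, not to 1. Its modulus is at most \<rho>
  plus a multiple of the decay, so after extracting \<rho> the remaining factors have a convergent
  majorant.\<close>

lemma fac_bound_neg:
  assumes p: "p \<in> X" and b: "b \<in> Rp" "b \<notin> N" and w: "inv w b \<notin> Rp"
  shows "norm (fac w b p) \<le> \<rho> * (1 + M b)"
proof -
  let ?e = "E b (snd p)"
  have q1: "decay c b < 1" using q0(1) q0(2)[OF b(1)] by simp
  have "norm (fac w b p) = norm (fst p - ?e) / norm (1 - ?e)"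
    using w by (simp add: fac_def num_def norm_divide)
  also have "\<dots> \<le> (\<rho> + decay c b) / (1 - decay c b)"
  proof (rule frac_le)
    show "norm (fst p - ?e) \<le> \<rho> + decay c b" using norm_triangle_ineq4[of "fst p" ?e] norm_E_X[OF p b] p by (simp add: X_def)
    show "1 - decay c b \<le> norm (1 - ?e)" using norm_triangle_ineq2[of 1 ?e] norm_E_X[OF p b] by simp
  qed (use q1 \<rho> in \<open>auto simp: decay_def\<close>)
  also have "\<dots> = \<rho> + (1 + \<rho>) * decay c b / (1 - decay c b)" using q1 by (simp add: field_simps)
  also have "(1 + \<rho>) * decay c b / (1 - decay c b) \<le> (1 + \<rho>) * decay c b / (1 - q0)"
    using q0(1) q0(2)[OF b(1)] \<rho> by (intro frac_le) (auto simp: decay_def)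
  also have "\<rho> + (1 + \<rho>) * decay c b / (1 - q0) \<le> \<rho> + \<rho> * M b"
  proof -
    have "(1 + \<rho>) * 1 * decay c b / (1 - q0) \<le> (1 + \<rho>) * (\<rho> * (1 + 1 / \<rho>)) * decay c b / (1 - q0)"
      using \<rho> q0(1) by (intro divide_right_mono mult_right_mono mult_left_mono) (auto simp: decay_def distrib_left)
    moreover have "\<rho> * M b = (1 + \<rho>) * (\<rho> * (1 + 1 / \<rho>)) * decay c b / (1 - q0)" by (simp add: M_def)
    ultimately show ?thesis by simp
  qed
  finally show ?thesis by (simp add: algebra_simps)
qed

text \<open>For fixed \<open>w\<close> convergence is measured by the distance of the factors from
  1; the finitely many inverted roots get a crude bound instead of a small one.\<close>

definition Mw where "Mw w b = M b + (if b \<in> Inv w then \<rho> * (1 + M b) + 1 else 0)"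

lemma fac_bound: "p \<in> X \<Longrightarrow> b \<in> Rp - N \<Longrightarrow> norm (fac w b p - 1) \<le> Mw w b"
proof -
  assume p: "p \<in> X" and b: "b \<in> Rp - N"
  show ?thesis
  proof (cases "inv w b \<in> Rp")
    case True
    then show ?thesis using fac_bound_pos[OF p, of b w] b by (simp add: Mw_def Inv_def)
  next
    case False
    then have "norm (fac w b p - 1) \<le> \<rho> * (1 + M b) + 1"
      using fac_bound_neg[OF p, of b w] b norm_triangle_ineq4[of "fac w b p" 1] by simp
    then show ?thesis using False b M_nonneg[of b] by (simp add: Mw_def Inv_def)
  qed
qed

lemma Mw_summable: "w \<in> W \<Longrightarrow> Mw w summable_on Rp - N"
  unfolding Mw_def
  by (intro summable_on_add M_summable finite_nonzero_values_imp_summable_on)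
    (auto intro: finite_subset[OF _ conjunct1[OF Inv_card]])

lemma fac_summable: "p \<in> X \<Longrightarrow> w \<in> W \<Longrightarrow> (\<lambda>b. norm (fac w b p - 1)) summable_on Rp"
proof -
  assume p: "p \<in> X" and w: "w \<in> W"
  have "(\<lambda>b. norm (fac w b p - 1)) summable_on (Rp - N)"
    by (rule summable_on_comparison_test[OF Mw_summable[OF w]]) (use fac_bound[OF p] in auto)
  then have "(\<lambda>b. norm (fac w b p - 1)) summable_on ((Rp - N) \<union> N)"
    by (rule summable_on_Un_disjoint[OF _ summable_on_finite[OF finite_N]]) auto
  then show ?thesis using N_Rp by (simp add: Un_absorb2)
qed

definition tail where "tail w p = infprod (\<lambda>b. fac w b p) (Rp - N)"

lemma tail_uniform:
  "w \<in> W \<Longrightarrow> uniform_limit X (\<lambda>F p. \<Prod>b\<in>F. fac w b p) (tail w) (finite_subsets_at_top (Rp - N))"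
  using unordered_prod_uniform_limit[OF Mw_summable, of w X "\<lambda>b p. fac w b p - 1"] fac_bound
  by (simp add: tail_def[abs_def])

lemma tail_tendsto:
  "w \<in> W \<Longrightarrow> p \<in> X \<Longrightarrow> (prod (\<lambda>b. fac w b p) \<longlongrightarrow> tail w p) (finite_subsets_at_top (Rp - N))"
  by (rule tendsto_uniform_limitI[OF tail_uniform])

lemma holo_num: "holomorphic_several_on (num w b) S"
  unfolding num_def[abs_def] by (cases "inv w b \<in> Rp") (simp_all, (intro holo_diff holo_mult holo_const holo_fst holo_E)+)

lemma holo_fac: "b \<in> Rp - N \<Longrightarrow> holomorphic_several_on (fac w b) X"
  unfolding fac_def[abs_def] using E_ne_1[of _ b] by (intro holo_divide holo_num holo_diff holo_const holo_E) auto

lemma holo_tail: "w \<in> W \<Longrightarrow> holomorphic_several_on (tail w) X"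
  by (rule holo_uniform_limit[OF open_X tail_uniform])
    (auto intro!: holo_prod holo_fac)

section \<open>The summands with cleared denominators, and their sum\<close>

definition T where "T w p = (\<Prod>b\<in>N. num w b p) * tail w p"

lemma holo_T: "w \<in> W \<Longrightarrow> holomorphic_several_on (T w) X"
  unfolding T_def[abs_def] by (intro holo_mult holo_prod holo_num holo_tail)

lemma prod_fac_bound:
  assumes p: "p \<in> X" and F: "finite F" "F \<subseteq> Rp - N"
  shows "norm (\<Prod>b\<in>F. fac w b p) \<le> \<rho> ^ card (F \<inter> Inv w) * exp (infsum M (Rp - N))"
proof -
  have "norm (\<Prod>b\<in>F. fac w b p) \<le> (\<Prod>b\<in>F. (if b \<in> Inv w then \<rho> else 1) * (1 + M b))"
    unfolding prod_norm[symmetric]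
  proof (rule prod_mono)
    fix b assume b: "b \<in> F"
    then have b': "b \<in> Rp" "b \<notin> N" using F by auto
    show "0 \<le> norm (fac w b p) \<and> norm (fac w b p) \<le> (if b \<in> Inv w then \<rho> else 1) * (1 + M b)"
      using fac_bound_neg[OF p b', of w] fac_bound_pos[OF p b', of w] norm_triangle_mono[of 1 1 "fac w b p - 1" "M b"] b'
      by (auto simp: Inv_def)
  qed
  also have "\<dots> = \<rho> ^ card (F \<inter> Inv w) * (\<Prod>b\<in>F. 1 + M b)"
    using F(1) by (simp add: prod.distrib prod.If_cases)
  also have "\<dots> \<le> \<rho> ^ card (F \<inter> Inv w) * exp (infsum M (Rp - N))"
  proof (rule mult_left_mono)
    have "(\<Prod>b\<in>F. 1 + M b) \<le> exp (sum M F)" by (rule prod_le_exp_sum) (rule M_nonneg)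
    also have "\<dots> \<le> exp (infsum M (Rp - N))"
      using F M_nonneg M_summable by (simp add: finite_sum_le_infsum)
    finally show "(\<Prod>b\<in>F. 1 + M b) \<le> exp (infsum M (Rp - N))" .
  qed (use \<rho> in simp)
  finally show ?thesis .
qed

text \<open>Inverted roots in \<open>N\<close> are absent from the tail. At most
  \<open>card N\<close> powers of \<rho> are missing, which \<open>(1 + 1 / \<rho>) ^ card N\<close>
  repays whether \<rho> is below or above 1.\<close>

lemma tail_bound:
  assumes p: "p \<in> X" and w: "w \<in> W"
  shows "norm (tail w p) \<le> \<rho> ^ weyl_length \<Delta> co w * ((1 + 1 / \<rho>) ^ card N * exp (infsum M (Rp - N)))"
proof -
  have fin: "finite (Inv w)" and card: "card (Inv w) = weyl_length \<Delta> co w" using Inv_card[OF w] by auto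
  have sub: "Inv w \<subseteq> Rp" by (auto simp: Inv_def)
  have "norm (tail w p) \<le> \<rho> ^ card (Inv w - N) * exp (infsum M (Rp - N))"
  proof (rule tendsto_upperbound[OF tendsto_norm[OF tail_tendsto[OF w p]]])
    show "\<forall>\<^sub>F F in finite_subsets_at_top (Rp - N).
        norm (\<Prod>b\<in>F. fac w b p) \<le> \<rho> ^ card (Inv w - N) * exp (infsum M (Rp - N))"
      unfolding eventually_finite_subsets_at_top
    proof (intro exI[of _ "Inv w - N"] conjI allI impI)
      \<comment> \<open>Once the finite set contains all inverted roots outside \<open>N\<close>,
        the power of \<rho> is exact.\<close>
      fix F assume F: "finite F \<and> Inv w - N \<subseteq> F \<and> F \<subseteq> Rp - N"
      then have "F \<inter> Inv w = Inv w - N" by auto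
      then show "norm (\<Prod>b\<in>F. fac w b p) \<le> \<rho> ^ card (Inv w - N) * exp (infsum M (Rp - N))"
        using prod_fac_bound[OF p, of F w] F by simp
    qed (use fin sub in auto)
  qed simp
  also have "\<dots> \<le> (\<rho> ^ card (Inv w) * (1 + 1 / \<rho>) ^ card N) * exp (infsum M (Rp - N))"
  proof (rule mult_right_mono)
    have "card (Inv w) = card (Inv w - N) + card (Inv w \<inter> N)"
      using fin by (metis add.commute card_Diff_subset_Int card_mono finite_Int inf_le1 le_add_diff_inverse2 ordered_cancel_comm_monoid_diff_class.add_diff_inverse)
    then have "\<rho> ^ card (Inv w - N) = \<rho> ^ card (Inv w) * (1 / \<rho>) ^ card (Inv w \<inter> N)"
      using \<rho> by (simp add: power_add power_one_over)
    also have "(1 / \<rho>) ^ card (Inv w \<inter> N) \<le> (1 + 1 / \<rho>) ^ card (Inv w \<inter> N)" using \<rho> by (intro power_mono) auto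
    also have "\<dots> \<le> (1 + 1 / \<rho>) ^ card N" using \<rho> finite_N by (intro power_increasing card_mono) auto
    finally show "\<rho> ^ card (Inv w - N) \<le> \<rho> ^ card (Inv w) * (1 + 1 / \<rho>) ^ card N" using \<rho> by simp
  qed simp
  finally show ?thesis by (simp add: card mult.assoc)
qed

lemma num_bound:
  assumes p: "p \<in> X" and b: "b \<in> N"
  shows "norm (num w b p) \<le> (1 + \<rho>) * (1 + exp (2 * pi * (norm (cr b) * B)))"
proof -
  let ?x = "exp (2 * pi * (norm (cr b) * B))"
  have "\<bar>blinfun_apply (cr b) (snd (snd p))\<bar> \<le> norm (cr b) * norm (snd (snd p))"
    using norm_blinfun[of "cr b" "snd (snd p)"] by simp
  also have "\<dots> \<le> norm (cr b) * B"
    using p norm_snd_le[of "snd (snd p)" "fst (snd p)"] by (intro mult_left_mono) (auto simp: X_def)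
  finally have "- blinfun_apply (cr b) (snd (snd p)) \<le> norm (cr b) * B" by linarith
  then have "2 * pi * (- blinfun_apply (cr b) (snd (snd p))) \<le> 2 * pi * (norm (cr b) * B)"
    by (intro mult_left_mono) auto
  then have e: "norm (E b (snd p)) \<le> ?x" unfolding norm_E exp_le_cancel_iff by (simp only: mult_minus_right)
  have t: "norm (fst p) \<le> \<rho>" using p by (simp add: X_def)
  have "norm (num w b p) \<le> max (1 + norm (fst p) * norm (E b (snd p))) (norm (fst p) + norm (E b (snd p)))"
    using norm_triangle_ineq4[of 1 "fst p * E b (snd p)"] norm_triangle_ineq4[of "fst p" "E b (snd p)"]
    by (auto simp: num_def norm_mult)
  also have "\<dots> \<le> max (1 + \<rho> * ?x) (\<rho> + ?x)"
    using e t \<rho> by (intro max.mono add_mono mult_mono) auto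
  also have "\<dots> \<le> (1 + \<rho>) * (1 + ?x)" using \<rho> by (auto simp: algebra_simps)
  finally show ?thesis .
qed

lemma T_bound: "\<exists>K. \<forall>w\<in>W. \<forall>p\<in>X. norm (T w p) \<le> K * \<rho> ^ weyl_length \<Delta> co w"
proof -
  define Q where "Q = (\<Prod>b\<in>N. (1 + \<rho>) * (1 + exp (2 * pi * (norm (cr b) * B))))"
  have "norm (T w p) \<le> Q * ((1 + 1 / \<rho>) ^ card N * exp (infsum M (Rp - N))) * \<rho> ^ weyl_length \<Delta> co w"
    if w: "w \<in> W" and p: "p \<in> X" for w p
  proof -
    have "norm (\<Prod>b\<in>N. num w b p) \<le> Q"
      unfolding Q_def prod_norm[symmetric] using num_bound[OF p] by (intro prod_mono) auto
    moreover have "Q \<ge> 0" unfolding Q_def using \<rho> by (intro prod_nonneg) auto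
    ultimately have "norm (T w p) \<le> Q * (\<rho> ^ weyl_length \<Delta> co w * ((1 + 1 / \<rho>) ^ card N * exp (infsum M (Rp - N))))"
      unfolding T_def norm_mult using tail_bound[OF p w] by (intro mult_mono) auto
    then show ?thesis by (simp add: algebra_simps)
  qed
  then show ?thesis by blast
qed

definition G where "G p = (\<Sum>\<^sub>\<infinity>w\<in>W. T w p)"

lemma G_uniform: "uniform_limit X (\<lambda>F p. \<Sum>w\<in>F. T w p) G (finite_subsets_at_top W)"
proof -
  obtain K where K: "\<And>w p. w \<in> W \<Longrightarrow> p \<in> X \<Longrightarrow> norm (T w p) \<le> K * \<rho> ^ weyl_length \<Delta> co w" using T_bound by blast
  show ?thesis unfolding G_def[abs_def]
    by (rule Weierstrass_m_test_general[OF K summable_on_cmult_right[OF sumW]])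
qed

lemma T_abs_summable: "p \<in> X \<Longrightarrow> (\<lambda>w. norm (T w p)) summable_on W"
proof -
  assume p: "p \<in> X"
  obtain K where K: "\<And>w p. w \<in> W \<Longrightarrow> p \<in> X \<Longrightarrow> norm (T w p) \<le> K * \<rho> ^ weyl_length \<Delta> co w" using T_bound by blast
  show ?thesis
    by (rule summable_on_comparison_test[OF summable_on_cmult_right[OF sumW, of K]]) (use K[OF _ p] in auto)
qed

lemma holo_G: "holomorphic_several_on G X"
  by (rule holo_uniform_limit[OF open_X G_uniform])
    (auto intro!: holo_sum holo_T)

definition P where "P p = (\<Prod>b\<in>N. 1 - E b (snd p))"

lemma C_term_eq:
  assumes w: "w \<in> W" and p: "p \<in> X" and ne: "P p \<noteq> 0"
  shows "C_term \<Delta> co w p = T w p / P p"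
proof -
  have "C_term \<Delta> co w p = (\<Prod>b\<in>N. fac w b p) * tail w p"
    unfolding C_term_flip[OF w] by (rule infprod_split_finite[OF tail_tendsto[OF w p] finite_N N_Rp])
  then show ?thesis by (simp add: fac_def T_def P_def prod_dividef)
qed

lemma C_sum_eq:
  assumes p: "p \<in> X" and ne: "P p \<noteq> 0"
  shows "C_sum \<Delta> co p = G p / P p"
proof -
  have "C_sum \<Delta> co p = (\<Sum>\<^sub>\<infinity>w\<in>W. T w p * inverse (P p))"
    unfolding C_sum_def using C_term_eq[OF _ p ne] by (intro infsum_cong) (simp add: divide_inverse)
  then show ?thesis unfolding G_def by (simp add: infsum_cmult_left' divide_inverse)
qed

end

section \<open>Analytic continuation\<close>

lemma infprod_cong: "(\<And>a. a \<in> A \<Longrightarrow> f a = g a) \<Longrightarrow> infprod f A = infprod g A"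
proof -
  assume eq: "\<And>a. a \<in> A \<Longrightarrow> f a = g a"
  have "(prod f \<longlongrightarrow> l) (finite_subsets_at_top A) \<longleftrightarrow> (prod g \<longlongrightarrow> l) (finite_subsets_at_top A)" for l
    using eq by (intro tendsto_cong eventually_finite_subsets_at_top_weakI prod.cong) auto
  then show ?thesis unfolding infprod_def Topological_Spaces.Lim_def by simp
qed

lemma eventually_at_0_exp_ne_1:
  fixes c :: real assumes "c \<noteq> 0"
  shows "\<forall>\<^sub>F x in at (0::real). exp (2 * of_real pi * \<i> * of_real (x * c)) \<noteq> (1::complex)"
proof -
  have "\<forall>\<^sub>F x in at (0::real). x \<noteq> 0" by (simp add: eventually_at_filter)
  moreover have "((\<lambda>x. \<bar>x * c\<bar>) \<longlongrightarrow> \<bar>0 * c\<bar>) (at (0::real))" by (intro tendsto_intros)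
  then have "\<forall>\<^sub>F x in at (0::real). \<bar>x * c\<bar> < 1" by (rule order_tendstoD) simp
  ultimately show ?thesis
  proof eventually_elim
    case (elim x)
    show ?case
    proof
      assume "exp (2 * of_real pi * \<i> * of_real (x * c)) = (1::complex)"
      then have "of_real (x * c) \<in> (\<int> :: complex set)" using one_minus_exp_eq_0_iff[of "of_real (x * c)"] by simp
      then obtain n :: int where "of_real (x * c) = (of_int n :: complex)" by (auto elim: Ints_cases)
      then have n: "x * c = of_int n" by (metis of_real_eq_iff of_real_of_int_eq)
      then have "n = 0" using elim by linarith
      then show False using n elim assms by simp
    qed
  qed
qed

text \<open>The imaginary part stays fixed, so each \<open>E b\<close> is multiplied by an explicit
  phase.\<close>

definition real_shift :: "complex \<times> ('v::real_vector \<times> 'v) \<Rightarrow> 'v \<Rightarrow> real \<Rightarrow> complex \<times> ('v \<times> 'v)" where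
  "real_shift p v x = (fst p, (fst (snd p) + x *\<^sub>R v, snd (snd p)))"

lemma real_shift_tendsto:
  fixes p :: "complex \<times> ('v::real_normed_vector \<times> 'v)"
  assumes "(f \<longlongrightarrow> 0) F"
  shows "((\<lambda>x. real_shift p v (f x)) \<longlongrightarrow> p) F"
proof -
  have "((\<lambda>x. real_shift p v (f x)) \<longlongrightarrow> (fst p, (fst (snd p) + 0 *\<^sub>R v, snd (snd p)))) F"
    unfolding real_shift_def by (intro tendsto_intros assms)
  then show ?thesis by simp
qed

context kac_moody_root_system
begin

section \<open>Symmetries of the sum and generic directions\<close>

lemma E_real_shift:
  "E b (snd (real_shift p v x)) = E b (snd p) * exp (2 * of_real pi * \<i> * of_real (x * blinfun_apply (cr b) v))"
  unfolding E_def mult_exp_exp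
  by (rule arg_cong[where f = exp])
    (simp add: real_shift_def cpairing_alt blinfun.add_right blinfun.scaleR_right algebra_simps)

text \<open>Moving \<open>h\<close> by \<open>u\<close> amounts to replacing \<open>w\<close> by
  \<open>inv u \<circ> w\<close> in the pairing, and this permutes the summands.\<close>

lemma C_sum_W_invariant:
  assumes u: "u \<in> W"
  shows "C_sum \<Delta> co (t, (u x, u y)) = C_sum \<Delta> co (t, (x, y))"
proof -
  have transform: "C_term \<Delta> co w (t, (u x, u y)) = C_term \<Delta> co (inv u \<circ> w) (t, (x, y))" if w: "w \<in> W" for w
    unfolding C_term_def
  proof (rule infprod_cong)
    fix a assume "a \<in> Rp"
    have uw: "inv u \<circ> w \<in> W" by (intro weyl_comp weyl_inv u w)
    have "inv (inv u \<circ> w) = inv w \<circ> u"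
      using W_bij[OF u] W_bij[OF w] by (simp add: o_inv_distrib bij_imp_bij_inv inv_inv_eq)
    then have "blinfun_apply (dual_action w l) (u v) = blinfun_apply (dual_action (inv u \<circ> w) l) v" for l v
      by (simp add: dual_action_apply[OF w] dual_action_apply[OF uw])
    then show "C_factor \<Delta> co w a (t, (u x, u y)) = C_factor \<Delta> co (inv u \<circ> w) a (t, (x, y))"
      by (simp add: C_factor_def exp_coroot_def cpairing_def)
  qed
  have bij: "bij_betw (\<lambda>w. inv u \<circ> w) W W"
  proof (rule bij_betw_byWitness[where f' = "\<lambda>w. u \<circ> w"])
    show "\<forall>w\<in>W. u \<circ> (inv u \<circ> w) = w" "\<forall>w\<in>W. inv u \<circ> (u \<circ> w) = w"
      using W_inv_apply[OF u] by (auto simp: fun_eq_iff)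
  qed (auto intro: weyl_comp weyl_inv u)
  have "C_sum \<Delta> co (t, (u x, u y)) = (\<Sum>\<^sub>\<infinity>w\<in>W. C_term \<Delta> co (inv u \<circ> w) (t, (x, y)))"
    unfolding C_sum_def using transform by (rule infsum_cong)
  also have "\<dots> = C_sum \<Delta> co (t, (x, y))"
    unfolding C_sum_def by (rule infsum_reindex_bij_betw[OF bij])
  finally show ?thesis .
qed

text \<open>Real roots pair integrally with real coroots, so every exponential is unchanged.\<close>

lemma C_sum_translation_invariant:
  assumes a: "a \<in> R"
  shows "C_sum \<Delta> co (t, (x + of_int k *\<^sub>R a, y)) = C_sum \<Delta> co (t, (x, y))"
  unfolding C_sum_def
proof (rule infsum_cong)
  fix w assume w: "w \<in> W"
  show "C_term \<Delta> co w (t, (x + of_int k *\<^sub>R a, y)) = C_term \<Delta> co w (t, (x, y))"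
    unfolding C_term_def
  proof (rule infprod_cong)
    fix b assume "b \<in> Rp"
    then have bR: "b \<in> R" by (rule Rp_R)
    obtain n :: int where n: "blinfun_apply (cr (w b)) a = of_int n"
      using root_pairing_int[OF a W_root[OF w bR]] by (auto elim: Ints_cases)
    have "E (w b) (x + of_int k *\<^sub>R a, y) = E (w b) (x, y) * exp (2 * of_real pi * \<i> * of_int (k * n))"
      unfolding E_def mult_exp_exp
      by (rule arg_cong[where f = exp]) (simp add: cpairing_alt blinfun.add_right blinfun.scaleR_right n algebra_simps)
    also have "exp (2 * of_real pi * \<i> * of_int (k * n)) = (1::complex)"
      using one_minus_exp_eq_0_iff[of "of_int (k * n)"] by simp
    finally show "C_factor \<Delta> co w b (t, (x + of_int k *\<^sub>R a, y)) = C_factor \<Delta> co w b (t, (x, y))"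
      by (simp add: C_factor_def exp_coroot_eq[OF w bR])
  qed
qed

text \<open>On this divisor \<open>q\<close> pairs with the coroot of \<open>a\<close> to an integer
  \<open>k\<close>. Reflecting in \<open>a\<close> and then translating by \<open>k\<close> times
  \<open>a\<close> fixes \<open>q\<close>, preserves the sum, and exchanges the shifts of
  \<open>q\<close> by \<open>x\<close> and \<open>- x\<close> along \<open>a\<close>.\<close>

lemma C_sum_reflection_invariant:
  assumes a: "a \<in> R" and q: "E a (snd q) = 1"
  shows "C_sum \<Delta> co (real_shift q a (- x)) = C_sum \<Delta> co (real_shift q a x)"
proof -
  obtain t u y where qd: "q = (t, (u, y))" by (metis prod.collapse)
  have "cpairing (u, y) (cr a) \<in> \<int>" using q one_minus_exp_eq_0_iff[of "cpairing (u, y) (cr a)"] by (simp add: E_def qd)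
  then obtain k :: int where "cpairing (u, y) (cr a) = of_int k" by (auto elim: Ints_cases)
  then have k: "blinfun_apply (cr a) u = of_int k" "blinfun_apply (cr a) y = 0"
    by (auto simp: cpairing_def complex_eq_iff)
  define s where "s v = v - blinfun_apply (cr a) v *\<^sub>R a" for v
  have s: "s \<in> W" unfolding s_def[abs_def] by (rule reflection_in_W[OF a])
  have "s (u + x *\<^sub>R a) + of_int k *\<^sub>R a = u - x *\<^sub>R a"
  proof -
    have "x *\<^sub>R a - (of_int k + x * 2) *\<^sub>R a + of_int k *\<^sub>R a = - (x *\<^sub>R a)"
      by (simp flip: scaleR_add_left scaleR_diff_left scaleR_minus_left)
    then show ?thesis by (simp add: s_def blinfun.add_right blinfun.scaleR_right k coroot_diag[OF a] diff_eq_eq add_eq_0_iff)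
  qed
  moreover have "s y = y" by (simp add: s_def k)
  ultimately have "real_shift q a (- x) = (t, (s (u + x *\<^sub>R a) + of_int k *\<^sub>R a, s y))" by (simp add: real_shift_def qd)
  then show ?thesis
    using C_sum_translation_invariant[OF a, of t "s (u + x *\<^sub>R a)" k "s y"] C_sum_W_invariant[OF s, of t "u + x *\<^sub>R a" y]
    by (simp add: real_shift_def qd)
qed

text \<open>By non-proportionality the kernel of \<open>cr a\<close> lies in no other of these
  kernels, and finitely many proper subspaces do not fill it.\<close>

lemma exists_generic_direction:
  assumes a: "a \<in> Rp" and "finite A" "A \<subseteq> Rp - {a}"
  shows "\<exists>v. blinfun_apply (cr a) v = 0 \<and> (\<forall>b\<in>A. blinfun_apply (cr b) v \<noteq> 0)"
  using assms(2,3)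
proof (induction A rule: finite_induct)
  case empty
  show ?case by (intro exI[of _ 0]) simp
next
  case (insert b A)
  then obtain v where v: "blinfun_apply (cr a) v = 0" "\<And>d. d \<in> A \<Longrightarrow> blinfun_apply (cr d) v \<noteq> 0" by auto
  have "\<exists>u. blinfun_apply (cr a) u = 0 \<and> blinfun_apply (cr b) u \<noteq> 0"
  proof (rule ccontr)
    assume no: "\<not> ?thesis"
    \<comment> \<open>Any \<open>z\<close> differs from a kernel vector of \<open>cr a\<close> by a
      multiple of \<open>a\<close>, so an inclusion of kernels would make \<open>cr b\<close>
      proportional to \<open>cr a\<close>.\<close>
    have "blinfun_apply (cr b) z = (blinfun_apply (cr b) a / 2) * blinfun_apply (cr a) z" for z
    proof -
      let ?u = "z - (blinfun_apply (cr a) z / 2) *\<^sub>R a"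
      have "blinfun_apply (cr a) ?u = 0" using coroot_diag[OF Rp_R[OF a]] by (simp add: blinfun.bilinear_simps)
      then have "blinfun_apply (cr b) ?u = 0" using no by blast
      then show ?thesis by (simp add: blinfun.bilinear_simps)
    qed
    then have "cr b = (blinfun_apply (cr b) a / 2) *\<^sub>R cr a" by (intro blinfun_eqI) (simp add: blinfun.scaleR_left)
    then show False using coroot_not_proportional[OF a, of b] insert.prems by auto
  qed
  then obtain u where u: "blinfun_apply (cr a) u = 0" "blinfun_apply (cr b) u \<noteq> 0" by blast
  show ?case
  proof (cases "blinfun_apply (cr b) v = 0")
    case False
    then show ?thesis using v by blast
  next
    case True
    \<comment> \<open>A nonzero multiple of \<open>u\<close> repairs the failure at
      \<open>b\<close>; avoiding finitely many values of \<open>e\<close> preserves the earlier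
      conditions.\<close>
    have "finite (insert 0 ((\<lambda>d. - blinfun_apply (cr d) v / blinfun_apply (cr d) u) ` A))" using insert by simp
    then obtain e :: real where "e \<notin> insert 0 ((\<lambda>d. - blinfun_apply (cr d) v / blinfun_apply (cr d) u) ` A)"
      using ex_new_if_finite[OF infinite_UNIV_char_0] by blast
    then have e: "e \<noteq> 0" "\<And>d. d \<in> A \<Longrightarrow> e \<noteq> - blinfun_apply (cr d) v / blinfun_apply (cr d) u" by auto
    have "blinfun_apply (cr d) (v + e *\<^sub>R u) \<noteq> 0" if "d \<in> A" for d
    proof
      assume "blinfun_apply (cr d) (v + e *\<^sub>R u) = 0"
      then have "e * blinfun_apply (cr d) u = - blinfun_apply (cr d) v" by (simp add: blinfun.bilinear_simps)
      then show False using e(2)[OF that] v(2)[OF that] by (cases "blinfun_apply (cr d) u = 0") (auto simp: field_simps)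
    qed
    then show ?thesis using u v True e(1) by (intro exI[of _ "v + e *\<^sub>R u"]) (auto simp: blinfun.bilinear_simps)
  qed
qed

section \<open>The Tits cone and admissible base points\<close>

lemma closure_chamber_nonneg: "y \<in> closure (chamber \<Delta> co) \<Longrightarrow> a \<in> \<Delta> \<Longrightarrow> blinfun_apply (co a) y \<ge> 0"
proof -
  assume y: "y \<in> closure (chamber \<Delta> co)" and a: "a \<in> \<Delta>"
  have "closed {y. blinfun_apply (co a) y \<ge> 0}" by (intro closed_Collect_le continuous_intros)
  moreover have "chamber \<Delta> co \<subseteq> {y. blinfun_apply (co a) y \<ge> 0}" using a by (auto simp: chamber_def less_imp_le)
  ultimately show ?thesis using closure_minimal y by blast
qed

text \<open>If \<open>y = w z\<close> with \<open>z\<close> in the closed chamber, a positive root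
  whose coroot is negative on \<open>y\<close> must be made negative by \<open>inv w\<close>, and
  these roots are finite in number.\<close>

lemma finite_negative_coroots:
  assumes "y \<in> tits_cone \<Delta> co"
  shows "finite {b \<in> Rp. blinfun_apply (cr b) y < 0}"
proof -
  obtain w z where w: "w \<in> W" and z: "z \<in> closure (chamber \<Delta> co)" and y: "y = w z"
    using assms by (auto simp: tits_cone_def)
  have "{b \<in> Rp. blinfun_apply (cr b) y < 0} \<subseteq> Inv w"
  proof
    fix b assume "b \<in> {b \<in> Rp. blinfun_apply (cr b) y < 0}"
    then have b: "b \<in> Rp" "blinfun_apply (cr b) y < 0" by auto
    have "blinfun_apply (cr (inv w b)) z = blinfun_apply (cr b) y"
      using coroot_W_apply[OF w W_root[OF weyl_inv[OF w] Rp_R[OF b(1)]], of z] W_inv_apply(2)[OF w] y by simp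
    moreover have "blinfun_apply (cr (inv w b)) z \<ge> 0" if "inv w b \<in> Rp"
      using D_pos_nonneg[OF coroot_pos[OF that]] closure_chamber_nonneg[OF z] by blast
    ultimately show "b \<in> Inv w" using b by (auto simp: Inv_def)
  qed
  then show ?thesis using Inv_card[OF w] finite_subset by blast
qed

text \<open>Grouping by length bounds every partial sum by the Poincare series at \<rho>, each
  length class being finite.\<close>

lemma length_power_summable:
  assumes \<rho>: "\<rho> > 0" "ereal \<rho> < poincare_radius \<Delta> co"
  shows "(\<lambda>w. \<rho> ^ weyl_length \<Delta> co w) summable_on W"
proof (rule nonneg_bdd_above_summable_on)
  define Wn where "Wn n = {w \<in> W. weyl_length \<Delta> co w = n}" for n
  have "summable (\<lambda>n. norm (complex_of_nat (card (Wn n)) * of_real \<rho> ^ n))"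
    using \<rho> unfolding poincare_radius_def Wn_def by (intro abs_summable_in_conv_radius) auto
  then have sum: "summable (\<lambda>n. real (card (Wn n)) * \<rho> ^ n)" using \<rho> by (simp add: norm_mult norm_power)
  show "bdd_above (sum (\<lambda>w. \<rho> ^ weyl_length \<Delta> co w) ` {F. F \<subseteq> W \<and> finite F})"
  proof (rule bdd_aboveI2)
    fix F assume "F \<in> {F. F \<subseteq> W \<and> finite F}"
    then have F: "F \<subseteq> W" "finite F" by auto
    define K where "K = Max (insert 0 (weyl_length \<Delta> co ` F))"
    have sub: "F \<subseteq> (\<Union>n\<in>{..K}. Wn n)" using F by (auto simp: K_def Wn_def)
    have "(\<Sum>w\<in>F. \<rho> ^ weyl_length \<Delta> co w) \<le> (\<Sum>w\<in>(\<Union>n\<in>{..K}. Wn n). \<rho> ^ weyl_length \<Delta> co w)"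
      using sub finite_length \<rho> by (intro sum_mono2) (auto simp: Wn_def)
    also have "\<dots> = (\<Sum>n\<in>{..K}. \<Sum>w\<in>Wn n. \<rho> ^ weyl_length \<Delta> co w)"
      using finite_length by (intro sum.UNION_disjoint) (auto simp: Wn_def)
    also have "\<dots> = (\<Sum>n\<in>{..K}. real (card (Wn n)) * \<rho> ^ n)"
      by (intro sum.cong) (auto simp: Wn_def)
    also have "\<dots> \<le> (\<Sum>n. real (card (Wn n)) * \<rho> ^ n)"
      using sum \<rho> by (intro sum_le_suminf) auto
    finally show "(\<Sum>w\<in>F. \<rho> ^ weyl_length \<Delta> co w) \<le> (\<Sum>n. real (card (Wn n)) * \<rho> ^ n)" .
  qed
qed (use \<rho> in simp)

lemma kac_nbhd_exists:
  assumes t: "ereal (norm t) < poincare_radius \<Delta> co" and y: "y \<in> interior (tits_cone \<Delta> co)"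
  shows "\<exists>y1 c \<rho> B. kac_nbhd \<Delta> co y1 c \<rho> \<and> (t, (x, y)) \<in> kac_nbhd.X \<Delta> co y1 c \<rho> B"
proof -
  obtain \<rho> where \<rho>: "norm t < \<rho>" "ereal \<rho> < poincare_radius \<Delta> co" using ereal_dense2[OF t] by auto
  have "\<rho> > 0" using \<rho>(1) norm_ge_zero[of t] by linarith
  have "y \<in> tits_cone \<Delta> co" using y interior_subset by blast
  then have "chamber \<Delta> co \<noteq> {}" by (auto simp: tits_cone_def)
  then obtain c0 where c0: "c0 \<in> chamber \<Delta> co" by blast
  have "((\<lambda>e. y - e *\<^sub>R c0) \<longlongrightarrow> y - 0 *\<^sub>R c0) (at_right (0::real))" by (intro tendsto_intros)
  then have "\<forall>\<^sub>F e in at_right 0. y - e *\<^sub>R c0 \<in> interior (tits_cone \<Delta> co)"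
    using y by (intro topological_tendstoD) auto
  moreover have "\<forall>\<^sub>F e in at_right (0::real). e > 0" by (simp add: eventually_at_right_less)
  ultimately have "\<forall>\<^sub>F e in at_right 0. e > 0 \<and> y - e *\<^sub>R c0 \<in> interior (tits_cone \<Delta> co)" by eventually_elim simp
  then obtain e where e: "e > 0" "y - e *\<^sub>R c0 \<in> interior (tits_cone \<Delta> co)"
    using eventually_happens'[OF trivial_limit_at_right_real] by blast
  \<comment> \<open>\<open>y1\<close> is reached from \<open>y\<close> by one step back inside the
    cone; half of that step is the decay vector \<open>c\<close>, the other half puts
    \<open>y\<close> into the open set \<open>X\<close>.\<close>
  define c where "c = (e / 2) *\<^sub>R c0"
  define y1 where "y1 = y - e *\<^sub>R c0"
  have c: "c \<in> chamber \<Delta> co" using c0 e by (simp add: c_def chamber_def blinfun.scaleR_right)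
  have "y - y1 - c = c" by (simp add: y1_def c_def flip: scaleR_diff_left)
  have nb: "kac_nbhd \<Delta> co y1 c \<rho>"
  proof (unfold_locales)
    show "finite {b \<in> Rp. blinfun_apply (cr b) y1 < 0}"
      using e(2) interior_subset by (intro finite_negative_coroots) (auto simp: y1_def)
    show "(\<lambda>w. \<rho> ^ weyl_length \<Delta> co w) summable_on W" by (rule length_power_summable[OF \<open>\<rho> > 0\<close> \<rho>(2)])
  qed fact+
  have "(t, (x, y)) \<in> kac_nbhd.X \<Delta> co y1 c \<rho> (norm (x, y) + 1)"
    unfolding kac_nbhd.X_def[OF nb] using \<rho> c \<open>y - y1 - c = c\<close> by simp
  with nb show ?thesis by blast
qed

text \<open>No real coroot vanishes on a translate of the open chamber, so the imaginary part alone
  keeps the modulus of \<open>E b\<close> different from 1.\<close>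

lemma weyl_chambers_regular:
  assumes y: "y \<in> weyl_chambers \<Delta> co" and b: "b \<in> R"
  shows "E b (x, y) \<noteq> 1"
proof -
  obtain w z where w: "w \<in> W" and z: "z \<in> chamber \<Delta> co" and yz: "y = w z"
    using y by (auto simp: weyl_chambers_def)
  have pos: "blinfun_apply (cr d) z > 0" if "d \<in> Rp" for d
    using coroot_chamber_bound[OF z] that by (meson less_le_trans)
  define d where "d = inv w b"
  have dR: "d \<in> R" unfolding d_def by (rule W_root[OF weyl_inv[OF w] b])
  have "blinfun_apply (cr b) y = blinfun_apply (cr d) z"
    using coroot_W_apply[OF w dR, of z] W_inv_apply(2)[OF w] by (simp add: d_def yz)
  moreover have "blinfun_apply (cr d) z \<noteq> 0"
    using root_pos_or_neg[OF dR] pos[of d] pos[of "- d"] root_minus[OF dR] by (auto simp: blinfun.minus_left)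
  ultimately have "norm (E b (x, y)) \<noteq> 1" by (simp add: norm_E)
  then show ?thesis by auto
qed

lemma continuous_W: "w \<in> W \<Longrightarrow> continuous_on A w"
  using bounded_linear_W linear_continuous_on by blast

lemma open_weyl_chambers: "open (weyl_chambers \<Delta> co)"
  unfolding weyl_chambers_def
proof (rule open_UN, rule ballI)
  fix w assume w: "w \<in> W"
  have "w ` chamber \<Delta> co = inv w -` chamber \<Delta> co"
    using W_bij[OF w] by (simp add: bij_vimage_eq_inv_image bij_imp_bij_inv inv_inv_eq)
  then show "open (w ` chamber \<Delta> co)"
    using open_vimage[OF open_chamber continuous_W[OF weyl_inv[OF w]]] by simp
qed

lemma weyl_chambers_interior: "weyl_chambers \<Delta> co \<subseteq> interior (tits_cone \<Delta> co)"
proof (rule interior_maximal[OF _ open_weyl_chambers])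
  show "weyl_chambers \<Delta> co \<subseteq> tits_cone \<Delta> co"
    unfolding weyl_chambers_def tits_cone_def using closure_subset by fast
qed

lemma weyl_chambers_dense: "tits_cone \<Delta> co \<subseteq> closure (weyl_chambers \<Delta> co)"
  unfolding tits_cone_def
proof (rule UN_least)
  fix w assume w: "w \<in> W"
  have "w ` closure (chamber \<Delta> co) \<subseteq> closure (w ` chamber \<Delta> co)"
    by (rule image_closure_subset[OF continuous_W[OF w] closed_closure closure_subset])
  also have "\<dots> \<subseteq> closure (weyl_chambers \<Delta> co)" using w by (intro closure_mono) (auto simp: weyl_chambers_def)
  finally show "w ` closure (chamber \<Delta> co) \<subseteq> closure (weyl_chambers \<Delta> co)" .
qed

end

context kac_nbhd
begin

section \<open>Removing the poles\<close>

lemma P_remove: "b \<in> A \<Longrightarrow> finite A \<Longrightarrow>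
  (\<Prod>b\<in>A. 1 - E b (snd p)) = (1 - E b (snd p)) * (\<Prod>b\<in>A - {b}. 1 - E b (snd p))"
  by (rule prod.remove)

lemma holo_prod_E: "holomorphic_several_on (\<lambda>p. \<Prod>b\<in>A. 1 - E b (snd p)) S"
  by (intro holo_prod holo_diff holo_const holo_E)

lemma holo_P: "holomorphic_several_on P S"
  unfolding P_def[abs_def] by (rule holo_prod_E)

lemma P_nonzero_iff: "P p \<noteq> 0 \<longleftrightarrow> (\<forall>b\<in>N. E b (snd p) \<noteq> 1)"
  using finite_N by (auto simp: P_def)

context
  fixes p0 g and S :: real and A :: "'a set" and a :: 'a
  assumes S: "ball p0 S \<subseteq> X" and g: "holomorphic_several_on g (ball p0 S)"
    and aA: "a \<in> A" "A \<subseteq> N"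
    and gC: "\<And>p. p \<in> ball p0 S \<Longrightarrow> P p \<noteq> 0 \<Longrightarrow> g p = (\<Prod>b\<in>A. 1 - E b (snd p)) * C_sum \<Delta> co p"
begin

lemma aRp: "a \<in> Rp" and aN: "a \<in> N" and finA: "finite A"
  using aA N_Rp finite_N finite_subset by blast+

text \<open>Off the other divisors, invariance of the sum under the reflection in the divisor of \<open>a\<close>
  makes \<open>g\<close> odd to leading order in the transversal coordinate.\<close>

lemma vanish_generic:
  assumes q: "q \<in> ball p0 S" "E a (snd q) = 1" and gen: "\<And>b. b \<in> N - {a} \<Longrightarrow> E b (snd q) \<noteq> 1"
  shows "g q = 0"
proof -
  define Q where "Q p = (\<Prod>b\<in>A - {a}. 1 - E b (snd p))" for p :: "complex \<times> ('a \<times> 'a)"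
  define Q' where "Q' p = (\<Prod>b\<in>N - {a}. 1 - E b (snd p))" for p :: "complex \<times> ('a \<times> 'a)"
  define \<delta> where "\<delta> = real_shift q a"
  define e where "e x = exp (2 * of_real pi * \<i> * of_real (x * 2))" for x :: real
  have lim: "((\<lambda>x. \<delta> x) \<longlongrightarrow> q) (at 0)" "((\<lambda>x. \<delta> (- x)) \<longlongrightarrow> q) (at 0)"
  proof -
    have "((\<lambda>x. - x) \<longlongrightarrow> - (0::real)) (at 0)" by (intro tendsto_intros)
    then show "((\<lambda>x. \<delta> x) \<longlongrightarrow> q) (at 0)" "((\<lambda>x. \<delta> (- x)) \<longlongrightarrow> q) (at 0)"
      unfolding \<delta>_def by (auto intro!: real_shift_tendsto)
  qed
  have Ea: "E a (snd (\<delta> x)) = e x" for x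
    using q(2) coroot_diag[OF Rp_R[OF aRp]] by (simp add: \<delta>_def E_real_shift e_def)
  have em: "e (- x) = inverse (e x)" for x by (simp add: e_def exp_minus)
  have ev_ball: "\<forall>\<^sub>F x in at 0. \<delta> x \<in> ball p0 S" "\<forall>\<^sub>F x in at 0. \<delta> (- x) \<in> ball p0 S"
    by (rule topological_tendstoD[OF lim(1) open_ball q(1)], rule topological_tendstoD[OF lim(2) open_ball q(1)])
  have Q'q: "Q' q \<noteq> 0" using gen finite_N by (simp add: Q'_def)
  have contQ': "isCont Q' q" "isCont Q q" "isCont g q"
    using holo_isCont[OF holo_prod_E[of _ UNIV]] holo_isCont[OF g q(1)] unfolding Q'_def[abs_def] Q_def[abs_def] by auto
  have ev_Q': "\<forall>\<^sub>F x in at 0. Q' (\<delta> x) \<noteq> 0" "\<forall>\<^sub>F x in at 0. Q' (\<delta> (- x)) \<noteq> 0"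
    using isCont_tendsto_compose[OF contQ'(1) lim(1)] isCont_tendsto_compose[OF contQ'(1) lim(2)] Q'q
    by (auto intro: tendsto_imp_eventually_ne)
  have ev_e: "\<forall>\<^sub>F x in at 0. e x \<noteq> 1" unfolding e_def by (rule eventually_at_0_exp_ne_1) simp
  \<comment> \<open>Multiplying by \<open>Q\<close> at the opposite point makes both sides multiples
    of the common value of the sum, which itself may be unbounded. As \<open>e x\<close> tends to 1
    the identity becomes \<open>g q * Q q = - (g q * Q q)\<close>.\<close>
  have key: "\<forall>\<^sub>F x in at 0. g (\<delta> x) * Q (\<delta> (- x)) = - e x * (g (\<delta> (- x)) * Q (\<delta> x))"
    using ev_ball ev_Q' ev_e
  proof eventually_elim
    case (elim x)
    have Pd: "P p = (1 - E a (snd p)) * Q' p" for p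
      unfolding P_def Q'_def by (rule P_remove[OF aN finite_N])
    have e0: "e x \<noteq> 0" by (simp add: e_def)
    have P1: "P (\<delta> x) \<noteq> 0" "P (\<delta> (- x)) \<noteq> 0" using elim e0 by (auto simp: Pd Ea em)
    have C: "C_sum \<Delta> co (\<delta> (- x)) = C_sum \<Delta> co (\<delta> x)"
      unfolding \<delta>_def by (rule C_sum_reflection_invariant[OF Rp_R[OF aRp] q(2)])
    have g1: "g (\<delta> x) = (1 - e x) * Q (\<delta> x) * C_sum \<Delta> co (\<delta> x)"
      using gC[OF elim(1) P1(1)] unfolding P_remove[OF aA(1) finA] Q_def by (simp add: Ea)
    have g2: "g (\<delta> (- x)) = (1 - inverse (e x)) * Q (\<delta> (- x)) * C_sum \<Delta> co (\<delta> x)"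
      using gC[OF elim(2) P1(2)] unfolding P_remove[OF aA(1) finA] Q_def by (simp add: Ea em C)
    have "- e x * (1 - inverse (e x)) = 1 - e x" using e0 by (simp add: algebra_simps)
    then show ?case unfolding g1 g2 by (metis (no_types, lifting) mult.assoc mult.commute)
  qed
  have l1: "((\<lambda>x. g (\<delta> x) * Q (\<delta> (- x))) \<longlongrightarrow> g q * Q q) (at 0)"
    by (intro tendsto_mult isCont_tendsto_compose[OF contQ'(3)] isCont_tendsto_compose[OF contQ'(2)] lim)
  have "(e \<longlongrightarrow> e 0) (at 0)" unfolding e_def by (intro tendsto_intros)
  then have "((\<lambda>x. - e x * (g (\<delta> (- x)) * Q (\<delta> x))) \<longlongrightarrow> - e 0 * (g q * Q q)) (at 0)"
    by (intro tendsto_mult tendsto_minus isCont_tendsto_compose[OF contQ'(3)] isCont_tendsto_compose[OF contQ'(2)] lim)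
  then have l2: "((\<lambda>x. g (\<delta> x) * Q (\<delta> (- x))) \<longlongrightarrow> - e 0 * (g q * Q q)) (at 0)"
    using key by (rule Lim_transform_eventually[OF _ eventually_mono]) simp
  have "g q * Q q = - e 0 * (g q * Q q)" using tendsto_unique[OF _ l1 l2] by simp
  then have "g q * Q q = 0" by (auto simp: e_def)
  moreover have "Q q \<noteq> 0" using gen aA finA by (auto simp: Q_def)
  ultimately show ?thesis by simp
qed

text \<open>From a point where several divisors cross, move inside the divisor of \<open>a\<close>
  in a direction transversal to the others: nearby points are generic, and \<open>g\<close> is
  continuous.\<close>

lemma vanish:
  assumes q: "q \<in> ball p0 S" "E a (snd q) = 1"
  shows "g q = 0"
proof -
  have "N - {a} \<subseteq> Rp - {a}" using N_Rp by blast
  then obtain v where v: "blinfun_apply (cr a) v = 0" "\<And>b. b \<in> N - {a} \<Longrightarrow> blinfun_apply (cr b) v \<noteq> 0"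
    using exists_generic_direction[OF aRp, of "N - {a}"] finite_N by auto
  define \<delta> where "\<delta> = real_shift q v"
  have lim: "((\<lambda>x. \<delta> x) \<longlongrightarrow> q) (at 0)" unfolding \<delta>_def by (intro real_shift_tendsto tendsto_intros)
  have ev_ball: "\<forall>\<^sub>F x in at 0. \<delta> x \<in> ball p0 S" by (rule topological_tendstoD[OF lim open_ball q(1)])
  have "\<forall>\<^sub>F x in at 0. E b (snd (\<delta> x)) \<noteq> 1" if b: "b \<in> N - {a}" for b
  proof (cases "E b (snd q) = 1")
    case True
    then show ?thesis using eventually_at_0_exp_ne_1[OF v(2)[OF b]] by (simp add: \<delta>_def E_real_shift)
  next
    case False
    have "isCont (\<lambda>p. E b (snd p)) q" by (rule holo_isCont[OF holo_E[of _ UNIV]]) simp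
    from isCont_tendsto_compose[OF this lim] False show ?thesis by (rule tendsto_imp_eventually_ne)
  qed
  then have "\<forall>\<^sub>F x in at 0. \<forall>b\<in>N - {a}. E b (snd (\<delta> x)) \<noteq> 1"
    using finite_N by (intro eventually_ball_finite) auto
  with ev_ball have "\<forall>\<^sub>F x in at 0. g (\<delta> x) = 0"
  proof eventually_elim
    case (elim x)
    show ?case
    proof (rule vanish_generic)
      show "E a (snd (\<delta> x)) = 1" using q(2) v(1) by (simp add: \<delta>_def E_real_shift)
    qed (use elim in auto)
  qed
  then have "((\<lambda>x. g (\<delta> x)) \<longlongrightarrow> 0) (at 0)" by (rule tendsto_eventually)
  moreover have "((\<lambda>x. g (\<delta> x)) \<longlongrightarrow> g q) (at 0)" by (rule isCont_tendsto_compose[OF holo_isCont[OF g q(1)] lim])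
  ultimately show ?thesis using tendsto_unique by (metis trivial_limit_at)
qed

end

text \<open>Induction on the set \<open>J\<close> of denominators already removed, starting from
  \<open>G\<close>. Each quotient remains the leftover product times the sum wherever
  \<open>P\<close> is nonzero, the form in which \<open>vanish\<close> applies again; the ball may
  shrink at each step.\<close>

lemma divide_all:
  assumes p0: "p0 \<in> X" and "J \<subseteq> N"
  shows "\<exists>S g. S > 0 \<and> ball p0 S \<subseteq> X \<and> holomorphic_several_on g (ball p0 S) \<and>
    (\<forall>p\<in>ball p0 S. P p \<noteq> 0 \<longrightarrow> g p = (\<Prod>b\<in>N - J. 1 - E b (snd p)) * C_sum \<Delta> co p)"
  using finite_subset[OF assms(2) finite_N] assms(2)
proof (induction J rule: finite_induct)
  case empty
  obtain S where S: "S > 0" "ball p0 S \<subseteq> X" using open_X p0 open_contains_ball by blast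
  have "G p = (\<Prod>b\<in>N - {}. 1 - E b (snd p)) * C_sum \<Delta> co p" if "p \<in> ball p0 S" "P p \<noteq> 0" for p
    using C_sum_eq[of p] that S by (auto simp: P_def)
  then show ?case using S holo_subset[OF holo_G S(2)] by blast
next
  case (insert a J)
  then obtain S g where S: "S > 0" "ball p0 S \<subseteq> X" and g: "holomorphic_several_on g (ball p0 S)"
    and gC: "\<And>p. p \<in> ball p0 S \<Longrightarrow> P p \<noteq> 0 \<Longrightarrow> g p = (\<Prod>b\<in>N - J. 1 - E b (snd p)) * C_sum \<Delta> co p" by auto
  have a: "a \<in> N - J" "N - J \<subseteq> N" "finite (N - J)" using insert finite_N by auto
  have aR: "a \<in> R" using a N_Rp Rp_R by blast
  have NM: "N - J - {a} = N - insert a J" by auto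
  have step: "(\<Prod>b\<in>N - J. 1 - E b (snd p)) = (1 - E a (snd p)) * (\<Prod>b\<in>N - insert a J. 1 - E b (snd p))" for p
    using P_remove[OF a(1,3)] unfolding NM .
  have "\<exists>S' g1. S' > 0 \<and> S' \<le> S \<and> holomorphic_several_on g1 (ball p0 S') \<and> (\<forall>p\<in>ball p0 S'. g p = (1 - E a (snd p)) * g1 p)"
  proof (cases "E a (snd p0) = 1")
    case True
    \<comment> \<open>Half of \<open>a\<close> is the transversal direction, as \<open>a\<close>
      pairs to 2 with its coroot.\<close>
    have "blinfun_apply (cr a) ((1/2) *\<^sub>R a) = 1" using coroot_diag[OF aR] by (simp add: blinfun.scaleR_right)
    moreover have "g q = 0" if "q \<in> ball p0 S" "1 - exp (2 * of_real pi * \<i> * cpairing (snd q) (cr a)) = 0" for q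
      using vanish[OF S(2) g a(1,2) gC that(1)] that(2) by (simp add: E_def)
    ultimately show ?thesis
      using holo_divide_zero[OF g S(1), of "cr a" "(1/2) *\<^sub>R a"] True unfolding E_def by auto
  next
    case False
    have "open {p :: complex \<times> ('a \<times> 'a). E a (snd p) \<noteq> 1}" by (intro open_Collect_neq holo_continuous_on[OF holo_E] continuous_on_const)
    then obtain r where r: "r > 0" "ball p0 r \<subseteq> {p. E a (snd p) \<noteq> 1}" using False open_contains_ball by blast
    have ne: "1 - E a (snd p) \<noteq> 0" if "p \<in> ball p0 (min r S)" for p
      using r(2) that by auto
    have "holomorphic_several_on (\<lambda>p. g p / (1 - E a (snd p))) (ball p0 (min r S))"
      by (rule holo_divide[OF holo_subset[OF g] holo_diff[OF holo_const holo_E]]) (use ne in auto)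
    then show ?thesis using r(1) S(1) ne by (intro exI[of _ "min r S"] exI[of _ "\<lambda>p. g p / (1 - E a (snd p))"]) auto
  qed
  then obtain S' g1 where S': "S' > 0" "S' \<le> S" "holomorphic_several_on g1 (ball p0 S')"
    and g1: "\<And>p. p \<in> ball p0 S' \<Longrightarrow> g p = (1 - E a (snd p)) * g1 p" by blast
  have sub: "ball p0 S' \<subseteq> ball p0 S" using S'(2) by (rule subset_ball)
  have "g1 p = (\<Prod>b\<in>N - insert a J. 1 - E b (snd p)) * C_sum \<Delta> co p" if p: "p \<in> ball p0 S'" and ne: "P p \<noteq> 0" for p
  proof -
    have "1 - E a (snd p) \<noteq> 0" using ne a(1) by (auto simp: P_nonzero_iff)
    moreover have "(1 - E a (snd p)) * g1 p = (1 - E a (snd p)) * ((\<Prod>b\<in>N - insert a J. 1 - E b (snd p)) * C_sum \<Delta> co p)"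
      using gC[of p] g1[OF p] step[of p] p sub ne by auto
    ultimately show ?thesis by simp
  qed
  then show ?case using S' sub S(2) by (intro exI[of _ S'] exI[of _ g1]) blast
qed

lemma local_extension:
  assumes "p0 \<in> X"
  shows "\<exists>S g. S > 0 \<and> holomorphic_several_on g (ball p0 S) \<and>
    (\<forall>p\<in>ball p0 S. (\<forall>b\<in>Rp. E b (snd p) \<noteq> 1) \<longrightarrow> g p = C_sum \<Delta> co p)"
proof -
  from divide_all[OF assms order_refl] obtain S g where S: "S > 0" "holomorphic_several_on g (ball p0 S)"
    and g: "\<And>p. p \<in> ball p0 S \<Longrightarrow> P p \<noteq> 0 \<Longrightarrow> g p = C_sum \<Delta> co p" by auto
  have "P p \<noteq> 0" if "\<forall>b\<in>Rp. E b (snd p) \<noteq> 1" for p using that N_Rp by (auto simp: P_nonzero_iff)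
  then show ?thesis using S g by blast
qed

text \<open>Uniform convergence of the cleared sums survives division by \<open>P\<close> where its
  modulus exceeds half of \<open>norm (P p)\<close>.\<close>

lemma C_sum_locally_uniform:
  assumes p: "p \<in> X" "P p \<noteq> 0"
  shows "\<exists>U. open U \<and> p \<in> U \<and>
    uniform_limit (U \<inter> S) (\<lambda>F q. \<Sum>w\<in>F. C_term \<Delta> co w q) (C_sum \<Delta> co) (finite_subsets_at_top W)"
proof (intro exI conjI)
  define m where "m = norm (P p) / 2"
  define U where "U = X \<inter> {q. m < norm (P q)}"
  have m: "m > 0" using p by (simp add: m_def)
  show "open U" unfolding U_def
    by (intro open_Int open_X open_Collect_less continuous_intros holo_continuous_on[OF holo_P])
  show "p \<in> U" using p by (simp add: U_def m_def)
  show "uniform_limit (U \<inter> S) (\<lambda>F q. \<Sum>w\<in>F. C_term \<Delta> co w q) (C_sum \<Delta> co) (finite_subsets_at_top W)"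
  proof (rule uniform_limitI)
    fix e :: real assume "e > 0"
    then have "\<forall>\<^sub>F F in finite_subsets_at_top W. \<forall>q\<in>X. dist (\<Sum>w\<in>F. T w q) (G q) < e * m"
      using m by (intro uniform_limitD[OF G_uniform]) simp
    moreover have "\<forall>\<^sub>F F in finite_subsets_at_top W. finite F \<and> F \<subseteq> W" by auto
    ultimately show "\<forall>\<^sub>F F in finite_subsets_at_top W. \<forall>q\<in>U \<inter> S. dist (\<Sum>w\<in>F. C_term \<Delta> co w q) (C_sum \<Delta> co q) < e"
    proof eventually_elim
      case (elim F)
      show ?case
      proof
        fix q assume "q \<in> U \<inter> S"
        then have q: "q \<in> X" "m < norm (P q)" by (auto simp: U_def)
        then have ne: "P q \<noteq> 0" using m by auto
        have "(\<Sum>w\<in>F. C_term \<Delta> co w q) = (\<Sum>w\<in>F. T w q / P q)"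
          using elim C_term_eq[OF _ q(1) ne] by (intro sum.cong) auto
        then have "dist (\<Sum>w\<in>F. C_term \<Delta> co w q) (C_sum \<Delta> co q) = dist (\<Sum>w\<in>F. T w q) (G q) / norm (P q)"
          using C_sum_eq[OF q(1) ne] by (simp add: dist_norm sum_divide_distrib[symmetric] diff_divide_distrib[symmetric] norm_divide)
        also have "\<dots> < e * m / m" using elim q m \<open>e > 0\<close> by (intro frac_less) auto
        finally show "dist (\<Sum>w\<in>F. C_term \<Delta> co w q) (C_sum \<Delta> co q) < e" using m by simp
      qed
    qed
  qed
qed

end

context kac_moody_root_system
begin

section \<open>Convergence and global continuation\<close>

lemma C_sum_converges:
  assumes "D = {t. ereal (norm t) < poincare_radius \<Delta> co}"
  shows "C_sum_converges_on \<Delta> co (D \<times> (UNIV \<times> weyl_chambers \<Delta> co))"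
proof -
  let ?S = "D \<times> ((UNIV :: 'v set) \<times> weyl_chambers \<Delta> co)"
  have nb: "\<exists>y1 c \<rho> B. kac_nbhd \<Delta> co y1 c \<rho> \<and> p \<in> kac_nbhd.X \<Delta> co y1 c \<rho> B \<and> kac_nbhd.P \<Delta> co y1 p \<noteq> 0"
    if p: "p \<in> ?S" for p
  proof -
    obtain t x y where pd: "p = (t, (x, y))" by (metis prod.collapse)
    have "ereal (norm t) < poincare_radius \<Delta> co" "y \<in> weyl_chambers \<Delta> co" using p assms by (auto simp: pd)
    then obtain y1 c \<rho> B where nb: "kac_nbhd \<Delta> co y1 c \<rho>" "p \<in> kac_nbhd.X \<Delta> co y1 c \<rho> B"
      using kac_nbhd_exists weyl_chambers_interior unfolding pd by blast
    have "\<forall>b\<in>kac_nbhd.N \<Delta> co y1. E b (snd p) \<noteq> 1"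
      using weyl_chambers_regular[OF \<open>y \<in> weyl_chambers \<Delta> co\<close>, of _ x] kac_nbhd.N_Rp[OF nb(1)] Rp_R
      unfolding pd snd_conv by blast
    then have "kac_nbhd.P \<Delta> co y1 p \<noteq> 0" using kac_nbhd.P_nonzero_iff[OF nb(1), of p] by blast
    with nb show ?thesis by blast
  qed
  show ?thesis unfolding C_sum_converges_on_def
  proof (intro conjI ballI)
    fix p w a assume p: "p \<in> ?S" and w: "w \<in> W" and a: "a \<in> Rp"
    obtain t x y where pd: "p = (t, (x, y))" by (metis prod.collapse)
    show "exp_coroot \<Delta> co w a (snd p) \<noteq> 1"
      using weyl_chambers_regular[OF _ W_root[OF w Rp_R[OF a]]] p exp_coroot_eq[OF w Rp_R[OF a]] by (simp add: pd)
  next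
    fix p w assume p: "p \<in> ?S" and w: "w \<in> W"
    obtain y1 c \<rho> B where nb: "kac_nbhd \<Delta> co y1 c \<rho>" "p \<in> kac_nbhd.X \<Delta> co y1 c \<rho> B" using nb[OF p] by blast
    have "(\<lambda>a. norm (fac w (flip w a) p - 1)) summable_on Rp"
      using kac_nbhd.fac_summable[OF nb w] summable_on_reindex_bij_betw[OF flip_bij[OF w], of "\<lambda>b. norm (fac w b p - 1)"] by simp
    moreover have "(\<lambda>a. norm (fac w (flip w a) p - 1)) summable_on Rp \<longleftrightarrow> (\<lambda>a. norm (C_factor \<Delta> co w a p - 1)) summable_on Rp"
      by (rule summable_on_cong) (simp add: C_factor_flip[OF w])
    ultimately show "(\<lambda>a. norm (C_factor \<Delta> co w a p - 1)) summable_on Rp" by simp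
  next
    fix p assume p: "p \<in> ?S"
    obtain y1 c \<rho> B where nb: "kac_nbhd \<Delta> co y1 c \<rho>" "p \<in> kac_nbhd.X \<Delta> co y1 c \<rho> B" "kac_nbhd.P \<Delta> co y1 p \<noteq> 0"
      using nb[OF p] by blast
    interpret nb: kac_nbhd \<Delta> co y1 c \<rho> B by (rule nb(1))
    have "(\<lambda>w. norm (C_term \<Delta> co w p)) summable_on W \<longleftrightarrow> (\<lambda>w. norm (nb.T w p) * inverse (norm (nb.P p))) summable_on W"
      by (rule summable_on_cong) (simp add: nb.C_term_eq[OF _ nb(2,3)] norm_mult norm_inverse divide_inverse)
    then show "(\<lambda>w. norm (C_term \<Delta> co w p)) summable_on W"
      using summable_on_cmult_left[OF nb.T_abs_summable[OF nb(2)]] by simp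
    show "\<exists>U. open U \<and> p \<in> U \<and> uniform_limit (U \<inter> ?S) (\<lambda>F q. \<Sum>w\<in>F. C_term \<Delta> co w q) (C_sum \<Delta> co) (finite_subsets_at_top W)"
      by (rule nb.C_sum_locally_uniform[OF nb(2,3)])
  qed
qed

lemma C_sum_extension:
  assumes D: "D = {t. ereal (norm t) < poincare_radius \<Delta> co}"
  shows "\<exists>F. holomorphic_several_on F (D \<times> (UNIV \<times> interior (tits_cone \<Delta> co))) \<and>
    (\<forall>p \<in> D \<times> (UNIV \<times> weyl_chambers \<Delta> co). F p = C_sum \<Delta> co p)"
proof -
  define \<Omega> where "\<Omega> = D \<times> ((UNIV :: 'v set) \<times> interior (tits_cone \<Delta> co))"
  define S where "S = D \<times> ((UNIV :: 'v set) \<times> weyl_chambers \<Delta> co)"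
  have SO: "S \<subseteq> \<Omega>" using weyl_chambers_interior by (auto simp: S_def \<Omega>_def)
  have "open D" unfolding D by (intro open_Collect_less continuous_intros)
  then have open\<Omega>: "open \<Omega>" by (simp add: \<Omega>_def open_Times)
  have dense: "\<Omega> \<subseteq> closure S"
    unfolding \<Omega>_def S_def closure_Times closure_UNIV
    by (intro Sigma_mono closure_subset order_refl order_trans[OF interior_subset weyl_chambers_dense])
  have "\<exists>r g. r > 0 \<and> holomorphic_several_on g (ball p r) \<and> ball p r \<subseteq> \<Omega> \<and> (\<forall>q\<in>ball p r \<inter> S. g q = C_sum \<Delta> co q)"
    if p: "p \<in> \<Omega>" for p
  proof -
    obtain t x y where pd: "p = (t, (x, y))" by (metis prod.collapse)
    obtain y1 c \<rho> B where nb: "kac_nbhd \<Delta> co y1 c \<rho>" "p \<in> kac_nbhd.X \<Delta> co y1 c \<rho> B"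
      using kac_nbhd_exists[of t y x] p unfolding pd \<Omega>_def D by auto
    obtain r g where r: "r > 0" "holomorphic_several_on g (ball p r)"
      and g: "\<And>q. q \<in> ball p r \<Longrightarrow> \<forall>b\<in>Rp. E b (snd q) \<noteq> 1 \<Longrightarrow> g q = C_sum \<Delta> co q"
      using kac_nbhd.local_extension[OF nb] by blast
    obtain r' where r': "r' > 0" "ball p r' \<subseteq> \<Omega>" using open\<Omega> p open_contains_ball by blast
    have "\<forall>b\<in>Rp. E b (snd q) \<noteq> 1" if "q \<in> S" for q
      using that weyl_chambers_regular Rp_R by (auto simp: S_def)
    then show ?thesis using r r' g holo_subset[OF r(2) subset_ball[OF min.cobounded1[of r r']]]
      by (intro exI[of _ "min r r'"] exI[of _ g]) auto
  qed
  then obtain r g where r: "\<And>p. p \<in> \<Omega> \<Longrightarrow> r p > 0" and hg: "\<And>p. p \<in> \<Omega> \<Longrightarrow> holomorphic_several_on (g p) (ball p (r p))"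
    and sub: "\<And>p. p \<in> \<Omega> \<Longrightarrow> ball p (r p) \<subseteq> \<Omega>"
    and gS: "\<And>p q. p \<in> \<Omega> \<Longrightarrow> q \<in> ball p (r p) \<inter> S \<Longrightarrow> g p q = C_sum \<Delta> co q" by metis
  \<comment> \<open>Each point takes the value of its own local extension; \<open>glue\<close> shows
    that these values fit together.\<close>
  define F where "F p = g p p" for p
  have FS: "F p = C_sum \<Delta> co p" if "p \<in> S" for p
    using gS[of p p] r[of p] that SO by (auto simp: F_def)
  \<comment> \<open>Two local extensions that differ at \<open>q\<close> differ on a neighbourhood
    of \<open>q\<close>, which meets the dense set \<open>S\<close>, where both equal the
    sum.\<close>
  have glue: "g p q = F q" if p: "p \<in> \<Omega>" and q: "q \<in> ball p (r p)" for p q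
  proof (rule ccontr)
    assume ne: "g p q \<noteq> F q"
    have qO: "q \<in> \<Omega>" using sub[OF p] q by blast
    have qq: "q \<in> ball q (r q)" using r[OF qO] by simp
    define V where "V = ball p (r p) \<inter> ball q (r q)"
    have "holomorphic_several_on (\<lambda>z. g p z - g q z) V"
      by (intro holo_diff holo_subset[OF hg[OF p]] holo_subset[OF hg[OF qO]]) (auto simp: V_def)
    then have "isCont (\<lambda>z. g p z - g q z) q" by (rule holo_isCont) (use q qq in \<open>auto simp: V_def\<close>)
    then have "((\<lambda>z. g p z - g q z) \<longlongrightarrow> g p q - g q q) (nhds q)"
      unfolding isCont_def by (rule tendsto_at_iff_tendsto_nhds[of "\<lambda>z. g p z - g q z" q, THEN iffD1])
    then have "\<forall>\<^sub>F z in nhds q. g p z - g q z \<noteq> 0"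
      by (rule tendsto_imp_eventually_ne) (use ne in \<open>simp add: F_def\<close>)
    moreover have "\<forall>\<^sub>F z in nhds q. z \<in> V" using q qq by (intro eventually_nhds_in_open) (auto simp: V_def)
    ultimately have "\<forall>\<^sub>F z in nhds q. z \<in> V \<and> g p z - g q z \<noteq> 0" by eventually_elim simp
    then obtain Z where Z: "open Z" "q \<in> Z" "\<And>z. z \<in> Z \<Longrightarrow> z \<in> V \<and> g p z - g q z \<noteq> 0"
      unfolding eventually_nhds by blast
    have "q \<in> closure S" using dense qO by blast
    then obtain z where z: "z \<in> S" "z \<in> Z" using Z(1,2) unfolding closure_iff_nhds_not_empty by blast
    then show False using Z(3)[OF z(2)] gS[OF p, of z] gS[OF qO, of z] by (auto simp: V_def)
  qed
  have "holomorphic_several_on F \<Omega>"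
  proof (rule holo_pointwise)
    fix p assume p: "p \<in> \<Omega>"
    have "holomorphic_several_on F (ball p (r p))"
      by (rule holo_cong_open[OF hg[OF p]]) (auto intro: glue[OF p])
    then show "\<exists>T. p \<in> T \<and> holomorphic_several_on F T" using r[OF p] by (intro exI[of _ "ball p (r p)"]) auto
  qed
  with FS show ?thesis unfolding \<Omega>_def S_def by blast
qed

text \<open>Read off from the extension, which coincides with the sum on this open set.\<close>

lemma C_sum_holomorphic:
  assumes D: "D = {t. ereal (norm t) < poincare_radius \<Delta> co}"
  shows "holomorphic_several_on (C_sum \<Delta> co) (D \<times> (UNIV \<times> weyl_chambers \<Delta> co))"
proof -
  have "open D" unfolding D by (intro open_Collect_less continuous_intros)
  then have opn: "open (D \<times> ((UNIV :: 'v set) \<times> weyl_chambers \<Delta> co))" by (simp add: open_Times open_weyl_chambers)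
  obtain F where F: "holomorphic_several_on F (D \<times> (UNIV \<times> interior (tits_cone \<Delta> co)))"
    "\<And>p. p \<in> D \<times> (UNIV \<times> weyl_chambers \<Delta> co) \<Longrightarrow> F p = C_sum \<Delta> co p" using C_sum_extension[OF D] by blast
  have "holomorphic_several_on F (D \<times> (UNIV \<times> weyl_chambers \<Delta> co))"
    by (rule holo_subset[OF F(1) Sigma_mono[OF order_refl Sigma_mono[OF order_refl weyl_chambers_interior]]])
  from holo_cong_open[OF this opn F(2)] show ?thesis .
qed

end

theorem theorem3p3p8:
  fixes \<Delta> :: "'v::{banach,heine_borel} set"
    and co :: "'v \<Rightarrow> ('v \<Rightarrow>\<^sub>L real)"
    and r :: ereal
    and D :: "complex set"
    and \<Omega> :: "('v \<times> 'v) set"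
  assumes "kac_moody_root_system \<Delta> co"
    and "r = poincare_radius \<Delta> co"
    and "D = {t. ereal (norm t) < r}"
    and "\<Omega> = UNIV \<times> interior (tits_cone \<Delta> co)"
  shows "C_sum_converges_on \<Delta> co (D \<times> (UNIV \<times> weyl_chambers \<Delta> co)) \<and>
    holomorphic_several_on (C_sum \<Delta> co) (D \<times> (UNIV \<times> weyl_chambers \<Delta> co)) \<and>
    UNIV \<times> weyl_chambers \<Delta> co \<subseteq> \<Omega> \<and>
    (\<exists>F. holomorphic_several_on F (D \<times> \<Omega>) \<and>
      (\<forall>p \<in> D \<times> (UNIV \<times> weyl_chambers \<Delta> co). F p = C_sum \<Delta> co p))"
proof -
  interpret kac_moody_root_system \<Delta> co by fact
  have D: "D = {t. ereal (norm t) < poincare_radius \<Delta> co}" using assms(2,3) by simp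
  have "(UNIV :: 'v set) \<times> weyl_chambers \<Delta> co \<subseteq> \<Omega>"
    using weyl_chambers_interior unfolding assms(4) by (rule Sigma_mono[OF order_refl])
  moreover have "\<exists>F. holomorphic_several_on F (D \<times> \<Omega>) \<and>
      (\<forall>p \<in> D \<times> (UNIV \<times> weyl_chambers \<Delta> co). F p = C_sum \<Delta> co p)"
    unfolding assms(4) by (rule C_sum_extension[OF D])
  ultimately show ?thesis using C_sum_converges[OF D] C_sum_holomorphic[OF D] by blast
qed

end
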